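(* Let $F$ be the random map associated with a finite collection $\{T_1,\dots,T_N\}$ of good and bad maps containing at least one good and at least one bad map, and with a strictly positive probability vector $\mathbf p=(p_j)_{j\in\Sigma}$. Let $\theta=\sum_{b\in\Sigma_B}p_b\ell_b$, $\ell_{\max}=\max\{\ell_b:b\in\Sigma_B\}$ and $\gamma_1=\frac{\log\theta}{\log\ell_{\max}}$. Assume that $\theta<1$ and let $\mu$ be the unique acs probability measure of $F$. If $\gamma\in(\gamma_1,0)$, $f\in L^\infty(\Sigma^{\mathbb N}\times[0,1],\mathbb P\times\mu)$ and $h\in\mathcal H$, then $$|Cor_n(f,h)|=O(n^{\gamma}).$$
   Context: A map $T_g:[0,1]\to[0,1]$ is called good if, for some $r_g\ge 1$, $T_g(x)=1-2^{r_g}(\frac12-x)^{r_g}$ for $x\in[0,\frac12)$ and $T_g(x)=2x-1$ for $x\in[\frac12,1]$. A map $T_b:[0,1]\to[0,1]$ is called bad if, for some $\ell_b>1$, $T_b(x)=\frac12-2^{\ell_b-1}(\frac12-x)^{\ell_b}$ for $x\in[0,\frac12)$ and $T_b(x)=2x-1$ for $x\in[\frac12,1]$. For a finite collection $T_1,\dots,T_N$ of good and bad maps put $\Sigma=\{1,\dots,N\}$, $\Sigma_G=\{j: T_j\text{ is good}\}$, $\Sigma_B=\{j:T_j\text{ is bad}\}$; both are assumed nonempty. The parameter of $T_g$ is $r_g$ and that of $T_b$ is $\ell_b$. The random map is $F(\omega,x)=(\sigma\omega,T_{\omega_1}(x))$ on $\Sigma^{\mathbb N}\times[0,1]$, with $\sigma$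 the left shift. $\lambda$ is Lebesgue measure on $[0,1]$, $\mathbf p=(p_j)_{j\in\Sigma}$ is a probability vector with strictly positive entries and $\mathbb P$ is the $\mathbf p$-Bernoulli measure on $\Sigma^{\mathbb N}$. An acs measure for $F$ is a Borel measure $\mu\ll\lambda$ on $[0,1]$ with $\sum_{j\in\Sigma}p_j\mu(T_j^{-1}A)=\mu(A)$ for all Borel $A\subseteq[0,1]$. When $\theta<1$ there is a unique acs probability measure, denoted $\mu$. Equip $\Sigma^{\mathbb N}\times[0,1]$ with the metric $d((\omega,x),(\omega',y))=2^{-\min\{i\in\mathbb N:\omega_i\ne\omega_i'\}}+|x-y|$ (first term $0$ if $\omega=\omega'$). For $\alpha\in(0,1)$, $\mathcal H_\alpha$ is the set of $h:\Sigma^{\mathbb N}\times[0,1]\to\mathbb R$ with $\sup_{z_1\ne z_2}\frac{|h(z_1)-h(z_2)|}{d(z_1,z_2)^\alpha}<\infty$, and $\mathcal H=\bigcup_{\alpha\in(0,1)}\mathcal H_\alpha$. The correlations are $$Cor_n(f,h)=\int f\circ F^n\cdot h\,d\mathbb P\times\mu-\int f\,d\mathbb P\times\mu\int h\,d\mathbb P\times\mu,$$ all integrals being over $\Sigma^{\mathbb N}\times[0,1]$. *)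

theory Defs
  imports "HOL-Probability.Probability" "HOL-Library.Landau_Symbols"
begin

text \<open>
  The label set \<open>{1, ..., N}\<close> is a type \<open>'j\<close> of class \<open>finite\<close>, and a probability vector on it is
  a \<open>'j pmf\<close>. Maps of \<open>[0,1]\<close> are functions \<open>real \<Rightarrow> real\<close> of which only the values on
  \<open>{0..1}\<close> matter.
\<close>

definition good_map_with :: "real \<Rightarrow> (real \<Rightarrow> real) \<Rightarrow> bool" where
  "good_map_with r T \<longleftrightarrow> 1 \<le> r \<and>
     (\<forall>x\<in>{0..<1/2}. T x = 1 - 2 powr r * (1/2 - x) powr r) \<and>
     (\<forall>x\<in>{1/2..1}. T x = 2 * x - 1)"

definition bad_map_with :: "real \<Rightarrow> (real \<Rightarrow> real) \<Rightarrow> bool" where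
  "bad_map_with l T \<longleftrightarrow> 1 < l \<and>
     (\<forall>x\<in>{0..<1/2}. T x = 1/2 - 2 powr (l - 1) * (1/2 - x) powr l) \<and>
     (\<forall>x\<in>{1/2..1}. T x = 2 * x - 1)"

definition good_map :: "(real \<Rightarrow> real) \<Rightarrow> bool" where
  "good_map T \<longleftrightarrow> (\<exists>r. good_map_with r T)"

definition bad_map :: "(real \<Rightarrow> real) \<Rightarrow> bool" where
  "bad_map T \<longleftrightarrow> (\<exists>l. bad_map_with l T)"

definition good_labels :: "('j \<Rightarrow> real \<Rightarrow> real) \<Rightarrow> 'j set" where
  "good_labels T = {j. good_map (T j)}"

definition bad_labels :: "('j \<Rightarrow> real \<Rightarrow> real) \<Rightarrow> 'j set" where
  "bad_labels T = {j. bad_map (T j)}"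

text \<open>
  A sequence \<open>(\<omega>\<^sub>1, \<omega>\<^sub>2, ...)\<close> is encoded as \<open>\<omega> :: nat \<Rightarrow> 'j\<close> with \<open>\<omega> i\<close> standing for
  \<open>\<omega>\<close> at position \<open>i + 1\<close>; hence the first symbol is \<open>\<omega> 0\<close>, and the exponent in \<open>seq_dist\<close>
  is shifted by one.
\<close>

definition bernoulli_measure :: "'j pmf \<Rightarrow> (nat \<Rightarrow> 'j) measure" where
  "bernoulli_measure p = PiM UNIV (\<lambda>_::nat. measure_pmf p)"

definition shift :: "(nat \<Rightarrow> 'j) \<Rightarrow> nat \<Rightarrow> 'j" where
  "shift \<omega> = (\<lambda>i. \<omega> (Suc i))"

definition random_map ::
    "('j \<Rightarrow> real \<Rightarrow> real) \<Rightarrow> (nat \<Rightarrow> 'j) \<times> real \<Rightarrow> (nat \<Rightarrow> 'j) \<times> real" where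
  "random_map T = (\<lambda>(\<omega>, x). (shift \<omega>, T (\<omega> 0) x))"

definition acs_measure :: "('j::finite) pmf \<Rightarrow> ('j \<Rightarrow> real \<Rightarrow> real) \<Rightarrow> real measure \<Rightarrow> bool" where
  "acs_measure p T \<mu> \<longleftrightarrow>
     sets \<mu> = sets (restrict_space borel {0..1}) \<and>
     absolutely_continuous (restrict_space lborel {0..1}) \<mu> \<and>
     (\<forall>A\<in>sets \<mu>. (\<Sum>j\<in>UNIV. ennreal (pmf p j) * emeasure \<mu> (T j -` A \<inter> {0..1})) = emeasure \<mu> A)"

definition seq_dist :: "(nat \<Rightarrow> 'j) \<Rightarrow> (nat \<Rightarrow> 'j) \<Rightarrow> real" where
  "seq_dist \<omega> \<omega>' = (if \<omega> = \<omega>' then 0 else (1/2) ^ Suc (LEAST i. \<omega> i \<noteq> \<omega>' i))"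

definition skew_dist :: "(nat \<Rightarrow> 'j) \<times> real \<Rightarrow> (nat \<Rightarrow> 'j) \<times> real \<Rightarrow> real" where
  "skew_dist = (\<lambda>(\<omega>, x) (\<omega>', y). seq_dist \<omega> \<omega>' + \<bar>x - y\<bar>)"

definition hoelder_class :: "real \<Rightarrow> ((nat \<Rightarrow> 'j) \<times> real \<Rightarrow> real) set" where
  "hoelder_class \<alpha> = {h. bdd_above {\<bar>h z1 - h z2\<bar> / skew_dist z1 z2 powr \<alpha> | z1 z2.
     z1 \<in> UNIV \<times> {0..1} \<and> z2 \<in> UNIV \<times> {0..1} \<and> z1 \<noteq> z2}}"

definition hoelder_functions :: "((nat \<Rightarrow> 'j) \<times> real \<Rightarrow> real) set" where
  "hoelder_functions = (\<Union>\<alpha>\<in>{0<..<1}. hoelder_class \<alpha>)"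

text \<open>Representatives of elements of \<open>L\<^sup>\<infinity>(M)\<close>.\<close>

definition ess_bounded :: "'a measure \<Rightarrow> ('a \<Rightarrow> real) set" where
  "ess_bounded M = {f \<in> borel_measurable M. \<exists>C. AE z in M. \<bar>f z\<bar> \<le> C}"

definition correlation ::
    "'j pmf \<Rightarrow> ('j \<Rightarrow> real \<Rightarrow> real) \<Rightarrow> real measure \<Rightarrow> nat \<Rightarrow>
     ((nat \<Rightarrow> 'j) \<times> real \<Rightarrow> real) \<Rightarrow> ((nat \<Rightarrow> 'j) \<times> real \<Rightarrow> real) \<Rightarrow> real" where
  "correlation p T \<mu> n f h =
     (\<integral>z. f ((random_map T ^^ n) z) * h z \<partial>(bernoulli_measure p \<Otimes>\<^sub>M \<mu>)) -
     (\<integral>z. f z \<partial>(bernoulli_measure p \<Otimes>\<^sub>M \<mu>)) * (\<integral>z. h z \<partial>(bernoulli_measure p \<Otimes>\<^sub>M \<mu>))"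

end

theory Submission
  imports Defs "HOL-Computational_Algebra.Formal_Power_Series"
begin

text \<open>
  In the coordinate \<open>y = 1 - 2 x\<close> on the left half a bad map is \<open>y \<mapsto> y powr l\<close>, a good map sends the
  point to distance \<open>y powr r\<close> from \<open>1\<close>, and right branches double this distance until the orbit is
  back in the left half. The returns are full branches \<open>y \<mapsto> 2 ^ k * y powr \<rho> - 1\<close>, uniformly
  expanding with bounded distortion, where \<open>\<rho>\<close> is the product of the exponents met. Markov's
  inequality for the moment of \<open>\<rho>\<close> of order \<open>1 - \<gamma>\<close>, finite because \<open>\<theta> * l_max powr (- \<gamma>) < 1\<close>, bounds the
  probability of a return time above \<open>n\<close> by a multiple of \<open>n powr (\<gamma> - 1)\<close>.

  Log-Hoelder densities on Bernoulli sequences times the left half form a cone contracted by the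
  return branches. A fixed multiple of Lebesgue measure can therefore be split off at every return,
  and the amount can be prescribed so that this regeneration time has exactly the tail
  \<open>(1 + n / K) powr (\<gamma> - 1)\<close>, whatever the initial density. This tail is log-convex, so by Kaluza's
  theorem the associated renewal equation has a solution whose increments are dominated by the
  tail; summing them gives convergence to the invariant measure at rate \<open>n powr \<gamma>\<close>. A Hoelder
  observable seen in the middle of an excursion pulls back along return branches to a density in
  the cone, which turns the convergence into decay of correlations.
\<close>

section \<open>Renewal sequences with log-convex tails\<close>

text \<open>Only an upper bound on the tail of the true return law is available, so its renewal
  equation cannot be inverted directly. Imposing a law with an explicit log-convex tail avoids this:
  the inverse of its generating function is controlled coefficient by coefficient, with no spectral
  or aperiodicity input. What has to be shown instead is that the imposed amount is always
  available. There the scale K helps: stretching the tail by K lowers its hazard rate to order 1 / K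
  and keeps the exponent. No regularity of the density of \<mu> is established, so \<mu> cannot
  itself start in the cone. It enters as the common weak limit of the images of cone densities; the
  correlation estimate is first proved for the image of Lebesgue measure on the left half at a
  finite time k, uniformly in k. The order 1 - \<gamma> of the moment allows one power for \<theta>
  and - \<gamma> powers bounded by l_max; taking logarithms, the smallness condition says exactly
  \<gamma> > \<gamma>1. One power of the tail is lost when increments are summed, which leaves
  \<gamma>.\<close>

lemma kaluza_inverse:
  fixes c :: "nat \<Rightarrow> real"
  assumes c0: "c 0 = 1" and pos: "\<And>n. 0 < c n"
    and logconvex: "\<And>n. c (Suc n) ^ 2 \<le> c n * c (Suc (Suc n))"
  shows "\<bar>fps_nth (inverse (Abs_fps c)) n\<bar> \<le> c n"
proof -
  define d where "d = fps_nth (inverse (Abs_fps c))"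
  have inv: "inverse (Abs_fps c) * Abs_fps c = 1"
    by (rule inverse_mult_eq_1) (simp add: c0)
  have d0: "d 0 = 1" by (simp add: d_def c0)
  have conv: "(\<Sum>k\<le>n. d k * c (n - k)) = 0" if "n > 0" for n
    using arg_cong[OF inv, of "\<lambda>f. fps_nth f n"] that
    by (simp add: fps_mult_nth d_def atMost_atLeast0)
  \<comment> \<open>Log-convexity says that the quotients c (n + 1) / c n increase; this is that
    monotonicity with denominators cleared.\<close>
  have ratio: "c (Suc m) * c n \<le> c (Suc n) * c m" if "m \<le> n" for m n
    using that
  proof (induction n rule: dec_induct)
    case (step n)
    have "c (Suc m) * c (Suc n) * c n \<le> c (Suc n) * c (Suc n) * c m"
      using mult_left_mono[OF step.IH, of "c (Suc n)"] pos[of "Suc n"] by (simp add: mult_ac)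
    also have "\<dots> \<le> c n * c (Suc (Suc n)) * c m"
      using logconvex[of n] pos[of m] by (intro mult_right_mono) (auto simp: power2_eq_square)
    finally have "c n * (c (Suc m) * c (Suc n)) \<le> c n * (c (Suc (Suc n)) * c m)"
      by (simp add: mult_ac)
    then show ?case using pos[of n] by simp
  qed (simp add: mult_ac)
  have split0: "(\<Sum>k\<le>n. d k * c (n - k)) = c n + d n + (\<Sum>k\<in>{1..<n}. d k * c (n - k))" if "n > 0" for n
  proof -
    have "{..n} = insert 0 (insert n {1..<n})" using that by auto
    then show ?thesis using that by (simp add: d0 c0)
  qed
  \<comment> \<open>Kaluza's sign argument. From the identity at m to the one at n = m + 1, each
    weight grows by a quotient of at most c (m + 1) / c m. As the earlier d k are nonpositive, their
    sum at n is at least - c (m + 1), which forces d n \<le> 0.\<close>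
  have dneg: "d n \<le> 0" if "n > 0" for n
    using that
  proof (induction n rule: less_induct)
    case (less n)
    show ?case
    proof (cases "n = 1")
      case True
      then show ?thesis using conv[of 1] pos[of 1] by (simp add: d0 c0)
    next
      case False
      then obtain m where m: "n = Suc m" "m > 0" using less.prems by (cases n) auto
      have "(\<Sum>k\<in>{1..m}. d k * c (Suc m - k)) * c m \<ge> (\<Sum>k\<in>{1..m}. d k * c (m - k)) * c (Suc m)"
      proof -
        have "d k * c (m - k) * c (Suc m) \<le> d k * c (Suc m - k) * c m" if "k \<in> {1..m}" for k
        proof -
          have "d k \<le> 0" using less.IH[of k] that m by auto
          moreover have "c (Suc m - k) * c m \<le> c (m - k) * c (Suc m)"
            using ratio[of "m - k" m] that by (simp add: Suc_diff_le mult_ac)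
          ultimately show ?thesis
            using mult_left_mono_neg[of "c (Suc m - k) * c m" "c (m - k) * c (Suc m)" "d k"]
            by (simp add: mult.assoc)
        qed
        then show ?thesis unfolding sum_distrib_right by (intro sum_mono)
      qed
      moreover have "(\<Sum>k\<in>{1..m}. d k * c (m - k)) = - c m"
      proof -
        have "{..m} = insert 0 {1..m}" by auto
        then show ?thesis using conv[of m] m by (simp add: d0)
      qed
      ultimately have "(\<Sum>k\<in>{1..m}. d k * c (Suc m - k)) * c m \<ge> - c (Suc m) * c m"
        by (simp add: mult.commute)
      then have "(\<Sum>k\<in>{1..m}. d k * c (Suc m - k)) \<ge> - c (Suc m)"
        using pos[of m] mult_le_cancel_right_pos by blast
      moreover have "{1..m} = {1..<n}" using m by auto
      ultimately show ?thesis using split0[of n] conv[of n] m by simp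
    qed
  qed
  show ?thesis
  proof (cases "n = 0")
    case False
    \<comment> \<open>The middle terms of the identity are nonpositive, so c n + d n is
      nonnegative.\<close>
    have "(\<Sum>k\<in>{1..<n}. d k * c (n - k)) \<le> 0"
      using dneg pos by (intro sum_nonpos mult_nonpos_nonneg) (auto simp: less_imp_le)
    then have "- d n \<le> c n" using split0[of n] conv[of n] False by simp
    then show ?thesis using dneg[of n] False by (simp flip: d_def)
  qed (simp add: c0)
qed

text \<open>With Q the generating function of the law \<open>c (k - 1) - c k\<close> one has 1 - Q =
  (1 - X) C, so the renewal equation (1 - Q) A = E becomes (1 - X) A = E / C. The increments of a
  are thus a convolution of E with the coefficients of 1 / C, which Kaluza's theorem bounds by
  c.\<close>

lemma kaluza_renewal:
  fixes c a E :: "nat \<Rightarrow> real"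
  assumes c0: "c 0 = 1" and pos: "\<And>n. 0 < c n"
    and logconvex: "\<And>n. c (Suc n) ^ 2 \<le> c n * c (Suc (Suc n))"
    and renewal: "\<And>n. a n = (\<Sum>m<n. (c (n - m - 1) - c (n - m)) * a m) + E n"
    and E: "\<And>n. \<bar>E n\<bar> \<le> B * c n"
  shows "\<bar>a (Suc n) - a n\<bar> \<le> B * (\<Sum>k\<le>Suc n. c k * c (Suc n - k))"
proof -
  let ?C = "Abs_fps c" and ?A = "Abs_fps a" and ?E = "Abs_fps E"
  let ?q = "Abs_fps (\<lambda>k. if k = 0 then 0 else c (k - 1) - c k)"
  have C: "(1 - fps_X) * ?C = 1 - ?q"
    by (rule fps_ext) (auto simp: algebra_simps c0)
  have A: "(1 - ?q) * ?A = ?E"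
  proof (rule fps_ext)
    fix n
    have "fps_nth (?A * ?q) n = (\<Sum>m\<in>{0..n}. a m * (if n - m = 0 then 0 else c (n - m - 1) - c (n - m)))"
      by (simp add: fps_mult_nth)
    also have "\<dots> = (\<Sum>m<n. (c (n - m - 1) - c (n - m)) * a m)"
      by (rule sum.mono_neutral_cong_right) auto
    finally show "fps_nth ((1 - ?q) * ?A) n = fps_nth ?E n"
      using renewal[of n] by (simp add: algebra_simps)
  qed
  have inv: "inverse ?C * ?C = 1" by (rule inverse_mult_eq_1) (simp add: c0)
  have "(1 - fps_X) * ?A = inverse ?C * ?E"
  proof -
    have "inverse ?C * ?E = inverse ?C * (((1 - fps_X) * ?C) * ?A)" by (simp only: C A)
    also have "\<dots> = (inverse ?C * ?C) * ((1 - fps_X) * ?A)" by (simp only: mult_ac)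
    finally show ?thesis by (simp add: inv)
  qed
  from arg_cong[OF this, of "\<lambda>f. fps_nth f (Suc n)"]
  have "a (Suc n) - a n = (\<Sum>k\<le>Suc n. fps_nth (inverse ?C) k * E (Suc n - k))"
    by (simp add: left_diff_distrib fps_mult_nth[of "inverse ?C"] atMost_atLeast0 del: sum.atMost_Suc)
  also have "\<bar>\<dots>\<bar> \<le> (\<Sum>k\<le>Suc n. c k * (B * c (Suc n - k)))"
  proof (rule order_trans[OF sum_abs sum_mono])
    fix k
    show "\<bar>fps_nth (inverse ?C) k * E (Suc n - k)\<bar> \<le> c k * (B * c (Suc n - k))"
      unfolding abs_mult using kaluza_inverse[OF c0 pos logconvex, of k] E[of "Suc n - k"] pos[of k]
      by (intro mult_mono) auto
  qed
  finally show ?thesis by (simp add: sum_distrib_left mult_ac del: sum.atMost_Suc)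
qed

section \<open>Elementary estimates for negative powers and their sums\<close>

lemma powr_neg_mult_le:
  fixes a b c s :: real
  assumes "0 < a" "0 < b" "0 < c" "c \<le> a + b" "0 \<le> s"
  shows "a powr - s * b powr - s \<le> 2 powr s * c powr - s * (a powr - s + b powr - s)"
proof -
  have *: "u powr - s \<le> 2 powr s * c powr - s" if "c \<le> 2 * u" "0 < u" for u
  proof -
    have "(2 * u) powr - s \<le> c powr - s" using that assms by (intro powr_mono2') auto
    then have "2 powr - s * u powr - s \<le> c powr - s" using that by (simp add: powr_mult)
    then have "2 powr s * (2 powr - s * u powr - s) \<le> 2 powr s * c powr - s" by simp
    then show ?thesis by (simp add: powr_minus field_simps)
  qed
  have p: "0 < a powr - s" "0 < b powr - s" using assms by auto
  have q: "0 \<le> 2 powr s * c powr - s" by simp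
  \<comment> \<open>One of a and b is at least c / 2, and its power is then comparable to that of
    c.\<close>
  consider "c \<le> 2 * a" | "c \<le> 2 * b" using assms by linarith
  then show ?thesis
  proof cases
    case 1
    from mult_right_mono[OF *[OF this \<open>0 < a\<close>], of "b powr - s"] p q show ?thesis
      by (smt (verit) distrib_left mult_nonneg_nonneg)
  next
    case 2
    from mult_left_mono[OF *[OF this \<open>0 < b\<close>], of "a powr - s"] p q show ?thesis
      by (smt (verit) distrib_left mult.commute mult_nonneg_nonneg)
  qed
qed

lemma sum_powr_tail_le:
  fixes x \<beta> :: real
  assumes "0 < x" "0 < \<beta>"
  shows "(\<Sum>k<N. (x + real k + 1) powr - (1 + \<beta>)) \<le> x powr - \<beta> / \<beta>"
proof -
  \<comment> \<open>Integral comparison as a telescoping sum: the mean value theorem bounds each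
    term by a difference of values of \<open>u powr - \<beta>\<close>.\<close>
  have step: "\<beta> * (u + 1) powr - (1 + \<beta>) \<le> u powr - \<beta> - (u + 1) powr - \<beta>" if "0 < u" for u :: real
  proof -
    have "\<exists>z>u. z < u + 1 \<and> (u + 1) powr - \<beta> - u powr - \<beta> = (u + 1 - u) * (- \<beta> * z powr (- \<beta> - 1))"
      using that by (intro MVT2) (auto intro!: derivative_eq_intros)
    then obtain z where z: "u < z" "z < u + 1" "(u + 1) powr - \<beta> - u powr - \<beta> = - \<beta> * z powr (- \<beta> - 1)"
      by auto
    have "(u + 1) powr (- \<beta> - 1) \<le> z powr (- \<beta> - 1)" using z that assms by (intro powr_mono2') auto
    then have "\<beta> * (u + 1) powr (- \<beta> - 1) \<le> \<beta> * z powr (- \<beta> - 1)" using assms by simp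
    moreover have eq: "- (1 + \<beta>) = - \<beta> - 1" by simp
    ultimately show ?thesis using z(3) unfolding eq by linarith
  qed
  have "\<beta> * (\<Sum>k<N. (x + real k + 1) powr - (1 + \<beta>)) \<le> x powr - \<beta> - (x + real N) powr - \<beta>"
  proof (induction N)
    case (Suc N)
    then show ?case using step[of "x + real N"] assms by (simp add: algebra_simps)
  qed simp
  then have "\<beta> * (\<Sum>k<N. (x + real k + 1) powr - (1 + \<beta>)) \<le> x powr - \<beta>"
    by (smt (verit) powr_ge_zero)
  then show ?thesis using assms by (simp add: field_simps)
qed

lemma one_minus_powr_le:
  fixes x s :: real
  assumes "0 \<le> x" "x < 1" "1 \<le> s"
  shows "1 - s * x \<le> (1 - x) powr s"
proof (cases "x = 0")
  case False
  then have "\<exists>z>0. z < x \<and> (1 - x) powr s - (1 - 0) powr s = (x - 0) * (- s * (1 - z) powr (s - 1))"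
    using assms by (intro MVT2) (auto intro!: derivative_eq_intros)
  then obtain z where z: "0 < z" "z < x" "(1 - x) powr s = 1 - s * x * (1 - z) powr (s - 1)"
    by (auto simp: algebra_simps)
  have "(1 - z) powr (s - 1) \<le> 1" using z assms by (intro powr_le1) auto
  then have "s * x * (1 - z) powr (s - 1) \<le> s * x * 1" using assms by (intro mult_left_mono) auto
  then show ?thesis using z by simp
qed simp

text \<open>The prescribed probability that the regeneration time exceeds n. The scale K stretches
  time: it lowers the hazard rate to at most s / K and keeps the order s of decay.\<close>

definition power_tail :: "real \<Rightarrow> real \<Rightarrow> nat \<Rightarrow> real" where
  "power_tail s K n = (1 + real n / K) powr - s"

lemma power_tail_0 [simp]: "power_tail s K 0 = 1"
  by (simp add: power_tail_def)

lemma power_tail_altdef: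
  assumes "0 < K"
  shows "power_tail s K n = K powr s * (K + real n) powr - s"
proof -
  have "1 + real n / K = (K + real n) / K" using assms by (simp add: field_simps)
  then show ?thesis using assms by (simp add: power_tail_def powr_divide powr_minus field_simps)
qed

lemma power_tail_pos:
  assumes "0 < K"
  shows "0 < power_tail s K n"
proof -
  have "0 < 1 + real n / K" using assms by (intro add_pos_nonneg) auto
  then show ?thesis by (simp add: power_tail_def)
qed

lemma power_tail_antimono:
  assumes "0 < K" "0 \<le> s" "m \<le> n"
  shows "power_tail s K n \<le> power_tail s K m"
  unfolding power_tail_def using assms
  by (intro powr_mono2') (auto intro!: divide_right_mono add_pos_nonneg)

text \<open>The bases 1 + n / K form an arithmetic progression, in which the square of a term
  dominates the product of its neighbours; the negative power reverses this.\<close>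

lemma power_tail_logconvex:
  assumes "0 < K" "0 \<le> s"
  shows "power_tail s K (Suc n) ^ 2 \<le> power_tail s K n * power_tail s K (Suc (Suc n))"
proof -
  let ?x = "\<lambda>n. 1 + real n / K"
  have pos: "0 < ?x n" for n using assms by (intro add_pos_nonneg) auto
  have "?x n * ?x (Suc (Suc n)) \<le> ?x (Suc n) * ?x (Suc n)"
    using assms by (simp add: field_simps)
  then have "(?x (Suc n) * ?x (Suc n)) powr - s \<le> (?x n * ?x (Suc (Suc n))) powr - s"
    using assms(2) by (intro powr_mono2' mult_pos_pos pos) auto
  then show ?thesis
    using pos unfolding power_tail_def power2_eq_square
    by (simp only: powr_mult less_imp_le)
qed

lemma power_tail_diff_le:
  assumes "0 < K" "1 \<le> s"
  shows "power_tail s K n - power_tail s K (Suc n) \<le> s / K * power_tail s K n"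
proof -
  \<comment> \<open>With this x the base at n is 1 - x times the base at n + 1, so Bernoulli's
    inequality bounds the ratio of consecutive tails below by 1 - s * x.\<close>
  define x where "x = 1 / (K + real (Suc n))"
  have x: "0 \<le> x" "x < 1" using assms by (auto simp: x_def field_simps)
  have "x \<le> 1 / K" unfolding x_def using assms by (intro divide_left_mono) auto
  have "(1 - x) * (K + real (Suc n)) = K + real n"
    using assms by (simp add: x_def left_diff_distrib)
  then have "1 + real n / K = (1 - x) * (1 + real (Suc n) / K)"
    using assms by (simp add: field_simps)
  then have "power_tail s K n = (1 - x) powr - s * power_tail s K (Suc n)"
    using x assms by (simp add: power_tail_def powr_mult)
  then have "power_tail s K (Suc n) = (1 - x) powr s * power_tail s K n"
    using x by (simp add: powr_minus field_simps)
  moreover have "(1 - s / K) * power_tail s K n \<le> (1 - x) powr s * power_tail s K n"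
  proof (rule mult_right_mono)
    have "s * x \<le> s / K" using \<open>x \<le> 1 / K\<close> assms mult_left_mono[of x "1 / K" s] by simp
    then show "1 - s / K \<le> (1 - x) powr s" using one_minus_powr_le[OF x assms(2)] by simp
    show "0 \<le> power_tail s K n" using power_tail_pos[OF assms(1)] by (simp add: less_imp_le)
  qed
  ultimately show ?thesis by (simp add: algebra_simps)
qed

lemma sum_power_tail_le:
  assumes "0 < K" "0 < \<beta>" "M \<le> N"
  shows "(\<Sum>k\<in>{M..<N}. power_tail (1 + \<beta>) K (Suc k)) \<le> K / \<beta> * power_tail \<beta> K M"
proof -
  have "(\<Sum>k\<in>{M..<N}. (K + real (Suc k)) powr - (1 + \<beta>)) =
        (\<Sum>k<N - M. ((K + real M) + real k + 1) powr - (1 + \<beta>))"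
    using assms by (intro sum.reindex_bij_witness[of _ "\<lambda>k. k + M" "\<lambda>k. k - M"])
       (auto simp: of_nat_diff algebra_simps)
  also have "\<dots> \<le> (K + real M) powr - \<beta> / \<beta>"
    using assms by (intro sum_powr_tail_le) auto
  finally have *: "(\<Sum>k\<in>{M..<N}. (K + real (Suc k)) powr - (1 + \<beta>)) \<le> (K + real M) powr - \<beta> / \<beta>" .
  have "(\<Sum>k\<in>{M..<N}. power_tail (1 + \<beta>) K (Suc k)) =
      K powr (1 + \<beta>) * (\<Sum>k\<in>{M..<N}. (K + real (Suc k)) powr - (1 + \<beta>))"
    using assms by (simp only: power_tail_altdef sum_distrib_left)
  also have "\<dots> \<le> K powr (1 + \<beta>) * ((K + real M) powr - \<beta> / \<beta>)"
    using * by (intro mult_left_mono) auto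
  also have "\<dots> = K / \<beta> * power_tail \<beta> K M"
    using assms by (simp add: power_tail_altdef powr_add)
  finally show ?thesis .
qed

text \<open>Of the indices k and n - k one is at least n / 2, where the tail is already of the order
  of its value at n; the other factor is summable because the exponent exceeds 1.\<close>

lemma power_tail_convolution_le:
  assumes "0 < K" "0 < \<beta>"
  shows "(\<Sum>k\<le>n. power_tail (1 + \<beta>) K k * power_tail (1 + \<beta>) K (n - k))
         \<le> 2 * 2 powr (1 + \<beta>) * (1 + K / \<beta>) * power_tail (1 + \<beta>) K n"
proof -
  let ?s = "1 + \<beta>"
  let ?q = "power_tail ?s K"
  have q0: "0 \<le> ?q k" for k using power_tail_pos[OF assms(1)] by (simp add: less_imp_le)
  have sum: "(\<Sum>k\<le>n. ?q k) \<le> 1 + K / \<beta>"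
  proof -
    have "(\<Sum>k\<le>n. ?q k) = 1 + (\<Sum>k\<in>{0..<n}. ?q (Suc k))"
      by (simp add: sum.atMost_shift lessThan_atLeast0)
    also have "\<dots> \<le> 1 + K / \<beta> * power_tail \<beta> K 0"
      using assms by (intro add_left_mono sum_power_tail_le) auto
    finally show ?thesis by simp
  qed
  have le: "?q k * ?q (n - k) \<le> 2 powr ?s * ?q n * (?q k + ?q (n - k))" if "k \<le> n" for k
  proof -
    have "(K + real k) powr - ?s * (K + real (n - k)) powr - ?s \<le>
        2 powr ?s * (K + real n) powr - ?s * ((K + real k) powr - ?s + (K + real (n - k)) powr - ?s)"
      using that assms by (intro powr_neg_mult_le) auto
    then have "(K powr ?s * K powr ?s) * ((K + real k) powr - ?s * (K + real (n - k)) powr - ?s) \<le>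
        (K powr ?s * K powr ?s) * (2 powr ?s * (K + real n) powr - ?s * ((K + real k) powr - ?s + (K + real (n - k)) powr - ?s))"
      by (intro mult_left_mono) auto
    then show ?thesis
      by (simp only: power_tail_altdef[OF assms(1)]) (simp add: algebra_simps)
  qed
  have "(\<Sum>k\<le>n. ?q k * ?q (n - k)) \<le> (\<Sum>k\<le>n. 2 powr ?s * ?q n * (?q k + ?q (n - k)))"
    by (intro sum_mono le) auto
  also have "\<dots> = 2 powr ?s * ?q n * ((\<Sum>k\<le>n. ?q k) + (\<Sum>k\<le>n. ?q (n - k)))"
    by (simp only: sum.distrib flip: sum_distrib_left)
  also have "(\<Sum>k\<le>n. ?q (n - k)) = (\<Sum>k\<le>n. ?q k)"
    by (rule sum.reindex_bij_witness[of _ "\<lambda>k. n - k" "\<lambda>k. n - k"]) auto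
  also have "2 powr ?s * ?q n * ((\<Sum>k\<le>n. ?q k) + (\<Sum>k\<le>n. ?q k)) \<le>
      2 powr ?s * ?q n * ((1 + K / \<beta>) + (1 + K / \<beta>))"
    using q0 sum by (intro mult_left_mono add_mono) auto
  finally show ?thesis by (simp add: algebra_simps)
qed

text \<open>Kaluza's bound makes the increments of a as small as the tail of order 1 + \<beta>;
  adding them up from n on costs one power. The constant depends on E through the factor B alone,
  which later makes rates uniform over observables.\<close>

lemma renewal_power_rate:
  fixes a E :: "nat \<Rightarrow> real"
  assumes K: "0 < K" and \<beta>: "0 < \<beta>" and B: "0 \<le> B"
    and renewal: "\<And>n. a n = (\<Sum>m<n. (power_tail (1 + \<beta>) K (n - m - 1) - power_tail (1 + \<beta>) K (n - m)) * a m) + E n"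
    and E: "\<And>n. \<bar>E n\<bar> \<le> B * power_tail (1 + \<beta>) K n"
  obtains L where "a \<longlonglongrightarrow> L"
    and "\<And>n. \<bar>a n - L\<bar> \<le> B * (2 * 2 powr (1 + \<beta>) * (1 + K / \<beta>) * (K / \<beta>)) * power_tail \<beta> K n"
proof -
  let ?C = "2 * 2 powr (1 + \<beta>) * (1 + K / \<beta>)"
  let ?q = "power_tail (1 + \<beta>) K"
  have C: "0 \<le> ?C" using K \<beta> by simp
  have step: "\<bar>a (Suc n) - a n\<bar> \<le> B * ?C * ?q (Suc n)" for n
  proof -
    have "\<bar>a (Suc n) - a n\<bar> \<le> B * (\<Sum>k\<le>Suc n. ?q k * ?q (Suc n - k))"
      using K \<beta> by (intro kaluza_renewal[OF _ _ _ renewal E] power_tail_pos power_tail_logconvex) auto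
    also have "\<dots> \<le> B * (?C * ?q (Suc n))"
      by (intro mult_left_mono power_tail_convolution_le K \<beta> B)
    finally show ?thesis by (simp add: mult.assoc)
  qed
  have diff: "\<bar>a n - a m\<bar> \<le> B * (?C * (K / \<beta>)) * power_tail \<beta> K m" if "m \<le> n" for m n
  proof -
    have "a n - a m = (\<Sum>k\<in>{m..<n}. a (Suc k) - a k)" using that by (simp add: sum_Suc_diff')
    also have "\<bar>\<dots>\<bar> \<le> (\<Sum>k\<in>{m..<n}. B * ?C * ?q (Suc k))"
      by (rule order_trans[OF sum_abs sum_mono[OF step]])
    also have "\<dots> = B * ?C * (\<Sum>k\<in>{m..<n}. ?q (Suc k))" by (simp only: sum_distrib_left)
    also have "\<dots> \<le> B * ?C * (K / \<beta> * power_tail \<beta> K m)"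
      using B C by (intro mult_left_mono sum_power_tail_le K \<beta> that) auto
    finally show ?thesis by (simp add: mult_ac)
  qed
  have lim0: "(\<lambda>n. power_tail \<beta> K n) \<longlonglongrightarrow> 0"
  proof -
    have "filterlim (\<lambda>n. 1 + inverse K * real n) at_top sequentially"
      using K by (intro filterlim_tendsto_add_at_top[OF tendsto_const]
          filterlim_tendsto_pos_mult_at_top[OF tendsto_const] filterlim_real_sequentially) auto
    then have "filterlim (\<lambda>n. 1 + real n / K) at_top sequentially"
      by (simp add: divide_inverse mult.commute)
    then show ?thesis unfolding power_tail_def using \<beta> by (intro tendsto_neg_powr) auto
  qed
  have "Cauchy a"
  proof (rule metric_CauchyI)
    fix e :: real assume e: "0 < e"
    have "(\<lambda>m. B * (?C * (K / \<beta>)) * power_tail \<beta> K m) \<longlonglongrightarrow> B * (?C * (K / \<beta>)) * 0"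
      by (intro tendsto_intros lim0)
    then have "eventually (\<lambda>m. B * (?C * (K / \<beta>)) * power_tail \<beta> K m < e / 2) sequentially"
      using e by (intro order_tendstoD(2)) auto
    then obtain M where M: "B * (?C * (K / \<beta>)) * power_tail \<beta> K M < e / 2"
      by (auto simp: eventually_sequentially)
    have "dist (a m) (a n) < e" if "m \<ge> M" "n \<ge> M" for m n
      using diff[OF that(1)] diff[OF that(2)] M unfolding dist_real_def by linarith
    then show "\<exists>M. \<forall>m\<ge>M. \<forall>n\<ge>M. dist (a m) (a n) < e" by blast
  qed
  then obtain L where L: "a \<longlonglongrightarrow> L" using Cauchy_convergent convergent_def by blast
  have "\<bar>a n - L\<bar> \<le> B * (?C * (K / \<beta>)) * power_tail \<beta> K n" for n
  proof -
    have "(\<lambda>m. \<bar>a m - a n\<bar>) \<longlonglongrightarrow> \<bar>L - a n\<bar>" by (intro tendsto_intros L)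
    then have "\<bar>L - a n\<bar> \<le> B * (?C * (K / \<beta>)) * power_tail \<beta> K n"
      by (rule LIMSEQ_le_const2) (use diff in blast)
    then show ?thesis by (simp add: abs_minus_commute)
  qed
  then show thesis using that L by (simp add: mult.assoc)
qed

text \<open>Here \<open>W j\<close> is the mass on the base at time j,
  \<open>power_tail s K j\<close> the mass not yet regenerated, \<open>A * (k + 1) powr - s\<close>
  bounds the chance that an excursion outlasts k steps, and c is a fraction that returns after one
  step. The conclusion says that the next payment is at most an e-fraction of the guaranteed return
  c * W. Young excursions must carry half of the remaining mass, so W was comparable to it not long
  ago. Since then W has lost at most a bounded factor and a few payments, and each payment is
  smaller than the remaining mass by a factor of order 1 / K.\<close>

lemma regeneration_pool:
  fixes s A c e :: real
  assumes s: "1 < s" and A: "0 < A" and c: "0 < c" "c \<le> 1" and e: "0 < e"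
  obtains K where "1 \<le> K" and "\<And>n W. \<lbrakk> 0 < n;
      \<And>j. j < n \<Longrightarrow> 0 \<le> W j; \<And>j. j < n \<Longrightarrow> W j \<le> power_tail s K j;
      \<And>j. j < n \<Longrightarrow> power_tail s K j \<le> (\<Sum>k\<le>j. A * (real k + 1) powr - s * W (j - k));
      \<And>j. Suc j < n \<Longrightarrow> c * W j - (power_tail s K j - power_tail s K (Suc j)) \<le> W (Suc j) \<rbrakk>
    \<Longrightarrow> power_tail s K (n - 1) - power_tail s K n \<le> e * c * W (n - 1)"
proof -
  define \<beta> where "\<beta> = s - 1"
  have \<beta>: "0 < \<beta>" "s = 1 + \<beta>" using s by (auto simp: \<beta>_def)
  have "((\<lambda>x. A * 2 powr s * (2 * (x powr - \<beta> / \<beta>))) \<longlongrightarrow> A * 2 powr s * (2 * (0 / \<beta>))) at_top"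
    using \<beta> by (intro tendsto_intros tendsto_neg_powr filterlim_ident) auto
  then have "eventually (\<lambda>x. A * 2 powr s * (2 * (x powr - \<beta> / \<beta>)) < 1 / 2) at_top"
    by (rule order_tendstoD(2)) auto
  then have "eventually (\<lambda>x. A * 2 powr s * (2 * (x powr - \<beta> / \<beta>)) < 1 / 2 \<and> 1 \<le> x) at_top"
    by (intro eventually_conj eventually_ge_at_top)
  then obtain x0 where x0: "\<And>x. x \<ge> x0 \<Longrightarrow> A * 2 powr s * (2 * (x powr - \<beta> / \<beta>)) < 1 / 2 \<and> 1 \<le> x"
    by (auto simp: eventually_at_top_linorder)
  \<comment> \<open>Chosen so that excursions of age at least M account for at most half of the
    remaining mass, see \<open>tail\<close>.\<close>
  define M where "M = nat \<lceil>x0\<rceil>"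
  have M: "A * 2 powr s * (2 * (real M powr - \<beta> / \<beta>)) < 1 / 2" "1 \<le> M"
    using x0[of "real M"] by (auto simp: M_def real_nat_ceiling_ge)
  define D where "D = s * 2 powr s"
  \<comment> \<open>The summand 2 * M + 1 keeps tails at times within M of each other comparable up
    to 2 powr s, which together with the hazard rate s / K gives the bound D / K on relative
    payments. The last summand is what the final comparison asks for: M payments must leave enough
    of the portion c ^ M that surely returned.\<close>
  define K where "K = 2 * real M + 1 + D * (real M + 1 / (e * c)) * (2 * A * real M / c ^ M)"
  have D: "0 < D" using s by (simp add: D_def)
  have "0 \<le> D * (real M + 1 / (e * c)) * (2 * A * real M / c ^ M)"
    using D A c e by (intro mult_nonneg_nonneg divide_nonneg_nonneg add_nonneg_nonneg) auto
  then have K: "2 * real M + 1 \<le> K" "D * (real M + 1 / (e * c)) * (2 * A * real M / c ^ M) \<le> K"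
    using M by (auto simp: K_def)
  then have K0: "0 < K" "1 \<le> K" using M by auto
  let ?q = "power_tail s K"
  have q0: "0 < ?q j" for j by (rule power_tail_pos[OF K0(1)])
  have tail: "(\<Sum>k\<in>{M..j}. A * (real k + 1) powr - s * ?q (j - k)) \<le> ?q j / 2" for j
  proof (cases "M \<le> j")
    case True
    have 1: "(\<Sum>k\<in>{M..j}. (real k + 1) powr - s) \<le> real M powr - \<beta> / \<beta>"
    proof -
      have "(\<Sum>k\<in>{M..j}. (real k + 1) powr - s) = (\<Sum>k<Suc j - M. (real M + real k + 1) powr - s)"
        using True by (intro sum.reindex_bij_witness[of _ "\<lambda>k. k + M" "\<lambda>k. k - M"]) (auto simp: of_nat_diff)
      also have "\<dots> \<le> real M powr - \<beta> / \<beta>"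
        using \<beta> M sum_powr_tail_le[of "real M" \<beta> "Suc j - M"] by simp
      finally show ?thesis .
    qed
    have 2: "(\<Sum>k\<in>{M..j}. (K + real (j - k)) powr - s) \<le> real M powr - \<beta> / \<beta>"
    proof -
      have "(\<Sum>k\<in>{M..j}. (K + real (j - k)) powr - s) = (\<Sum>k<Suc j - M. (K + real k) powr - s)"
        using True by (intro sum.reindex_bij_witness[of _ "\<lambda>k. j - k" "\<lambda>k. j - k"]) auto
      also have "\<dots> \<le> (\<Sum>k<Suc j - M. (real M + real k + 1) powr - s)"
        using K M s by (intro sum_mono powr_mono2') auto
      also have "\<dots> \<le> real M powr - \<beta> / \<beta>"
        using \<beta> M sum_powr_tail_le[of "real M" \<beta> "Suc j - M"] by simp
      finally show ?thesis .
    qed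
    have "A * (real k + 1) powr - s * ?q (j - k) \<le>
        A * 2 powr s * ?q j * ((real k + 1) powr - s + (K + real (j - k)) powr - s)" if "k \<in> {M..j}" for k
    proof -
      have "(real k + 1) powr - s * (K + real (j - k)) powr - s \<le>
        2 powr s * (K + real j) powr - s * ((real k + 1) powr - s + (K + real (j - k)) powr - s)"
        using K0 s that by (intro powr_neg_mult_le) auto
      then have "(A * K powr s) * ((real k + 1) powr - s * (K + real (j - k)) powr - s) \<le> (A * K powr s) *
        (2 powr s * (K + real j) powr - s * ((real k + 1) powr - s + (K + real (j - k)) powr - s))"
        using A by (intro mult_left_mono) auto
      then show ?thesis by (simp only: power_tail_altdef[OF K0(1)]) (simp add: algebra_simps)
    qed
    then have "(\<Sum>k\<in>{M..j}. A * (real k + 1) powr - s * ?q (j - k)) \<le>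
       (\<Sum>k\<in>{M..j}. A * 2 powr s * ?q j * ((real k + 1) powr - s + (K + real (j - k)) powr - s))"
      by (intro sum_mono) auto
    also have "\<dots> = A * 2 powr s * ?q j * ((\<Sum>k\<in>{M..j}. (real k + 1) powr - s) + (\<Sum>k\<in>{M..j}. (K + real (j - k)) powr - s))"
      by (simp only: sum.distrib flip: sum_distrib_left)
    also have "\<dots> \<le> A * 2 powr s * ?q j * (real M powr - \<beta> / \<beta> + real M powr - \<beta> / \<beta>)"
      using A q0[of j] by (intro mult_left_mono add_mono 1 2) (auto simp: less_imp_le)
    also have "\<dots> = ?q j * (A * 2 powr s * (2 * (real M powr - \<beta> / \<beta>)))" by simp
    also have "\<dots> \<le> ?q j * (1 / 2)" using M(1) q0[of j] by (intro mult_left_mono) auto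
    finally show ?thesis by simp
  qed (use q0[of j] in auto)
  show thesis
  proof (rule that[OF K0(2)])
    fix n :: nat and W :: "nat \<Rightarrow> real"
    assume n: "0 < n" and W0: "\<And>j. j < n \<Longrightarrow> 0 \<le> W j" and Wq: "\<And>j. j < n \<Longrightarrow> W j \<le> ?q j"
      and WQ: "\<And>j. j < n \<Longrightarrow> ?q j \<le> (\<Sum>k\<le>j. A * (real k + 1) powr - s * W (j - k))"
      and step: "\<And>j. Suc j < n \<Longrightarrow> c * W j - (?q j - ?q (Suc j)) \<le> W (Suc j)"
    define j where "j = n - 1"
    have j: "j < n" "n = Suc j" using n by (auto simp: j_def)
    \<comment> \<open>Pigeonhole on the last M times: if W were below q j / (2 * A * M) at all of
      them, young excursions would carry less than half of the remaining mass, while old ones carry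
      at most half.\<close>
    have "\<exists>k. k < M \<and> k \<le> j \<and> ?q j / (2 * A * real M) \<le> W (j - k)"
    proof (rule ccontr)
      assume "\<not> ?thesis"
      then have less: "W (j - k) < ?q j / (2 * A * real M)" if "k < M" "k \<le> j" for k
        using that by force
      have "{..j} = {k. k < M \<and> k \<le> j} \<union> {M..j}" by auto
      then have "(\<Sum>k\<le>j. A * (real k + 1) powr - s * W (j - k)) =
          (\<Sum>k | k < M \<and> k \<le> j. A * (real k + 1) powr - s * W (j - k)) +
          (\<Sum>k\<in>{M..j}. A * (real k + 1) powr - s * W (j - k))"
        by (simp only:) (intro sum.union_disjoint, auto)
      also have "(\<Sum>k\<in>{M..j}. A * (real k + 1) powr - s * W (j - k)) \<le>
          (\<Sum>k\<in>{M..j}. A * (real k + 1) powr - s * ?q (j - k))"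
        using A j by (intro sum_mono mult_left_mono Wq) auto
      also have "\<dots> \<le> ?q j / 2" by (rule tail)
      also have "(\<Sum>k | k < M \<and> k \<le> j. A * (real k + 1) powr - s * W (j - k)) <
          (\<Sum>k | k < M \<and> k \<le> j. A * (?q j / (2 * A * real M)))"
      proof (rule sum_strict_mono)
        show "{k. k < M \<and> k \<le> j} \<noteq> {}" using M(2) by (auto intro!: exI[of _ 0])
        fix k assume k: "k \<in> {k. k < M \<and> k \<le> j}"
        have "A * (real k + 1) powr - s * W (j - k) \<le> A * 1 * W (j - k)"
        proof (intro mult_right_mono mult_left_mono)
          have "(real k + 1) powr - s \<le> 1 powr - s" using s by (intro powr_mono2') auto
          then show "(real k + 1) powr - s \<le> 1" by simp
        qed (use A j W0 in auto)
        also have "\<dots> < A * 1 * (?q j / (2 * A * real M))"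
          using k A less[of k] by (intro mult_strict_left_mono) auto
        finally show "A * (real k + 1) powr - s * W (j - k) < A * (?q j / (2 * A * real M))"
          by (simp only: mult_1_right)
      qed auto
      also have "\<dots> = real (card {k. k < M \<and> k \<le> j}) * (A * (?q j / (2 * A * real M)))" by simp
      also have "\<dots> \<le> real M * (A * (?q j / (2 * A * real M)))"
      proof (rule mult_right_mono)
        have "card {k. k < M \<and> k \<le> j} \<le> card {..<M}" by (rule card_mono) auto
        then show "real (card {k. k < M \<and> k \<le> j}) \<le> real M" by simp
        show "0 \<le> A * (?q j / (2 * A * real M))" using A q0[of j] by (simp add: less_imp_le)
      qed
      also have "\<dots> = ?q j / 2" using A M by (simp add: field_simps)
      finally have "(\<Sum>k\<le>j. A * (real k + 1) powr - s * W (j - k)) < ?q j" by simp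
      then show False using WQ[OF j(1)] by simp
    qed
    then obtain k where k: "k < M" "k \<le> j" "?q j / (2 * A * real M) \<le> W (j - k)" by blast
    have qd: "?q i - ?q (Suc i) \<le> D / K * ?q j" if "i \<ge> j - k" for i
    proof -
      have "?q i - ?q (Suc i) \<le> s / K * ?q i" using s by (intro power_tail_diff_le K0) auto
      moreover have "?q i \<le> 2 powr s * ?q j"
      proof -
        have "2 powr - s * (K + real i) powr - s = (2 * (K + real i)) powr - s"
          using K0 by (subst powr_mult) auto
        also have "\<dots> \<le> (K + real j) powr - s"
          using K k that s by (intro powr_mono2') auto
        finally have "(2 powr s * K powr s) * (2 powr - s * (K + real i) powr - s) \<le>
           (2 powr s * K powr s) * (K + real j) powr - s" by (intro mult_left_mono) auto
        moreover have "(2 powr s * K powr s) * (2 powr - s * (K + real i) powr - s) =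
            (2 powr s * 2 powr - s) * (K powr s * (K + real i) powr - s)" by (simp only: mult_ac)
        moreover have "2 powr s * 2 powr - s = 1" by (simp flip: powr_add)
        ultimately show ?thesis
          by (simp only: power_tail_altdef[OF K0(1)])
      qed
      then have "s / K * ?q i \<le> s / K * (2 powr s * ?q j)" using s K0 by (intro mult_left_mono) auto
      ultimately show ?thesis unfolding D_def by (simp add: mult_ac)
    qed
    define H where "H = D / K * ?q j"
    have H: "0 \<le> H" using D K0 q0[of j] by (simp add: H_def)
    \<comment> \<open>From the time just found on, each step keeps the fraction c and pays at most
      H.\<close>
    have lower: "c ^ i * W (j - k) - real i * (H) \<le> W (j - k + i)" if "i \<le> k" for i
      using that
    proof (induction i)
      case (Suc i)
      have "c * (c ^ i * W (j - k) - real i * (H)) \<le> c * W (j - k + i)"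
        using Suc c by (intro mult_left_mono) auto
      moreover have "c * (real i * (H)) \<le> real i * (H)"
        using c mult_nonneg_nonneg[OF of_nat_0_le_iff H]
        by (intro mult_left_le_one_le) auto
      moreover have "c * W (j - k + i) - (?q (j - k + i) - ?q (Suc (j - k + i))) \<le> W (Suc (j - k + i))"
        using Suc.prems k j by (intro step) auto
      moreover have "?q (j - k + i) - ?q (Suc (j - k + i)) \<le> H" unfolding H_def by (rule qd) auto
      ultimately show ?case by (simp add: algebra_simps)
    qed simp
    from lower[of k] have "c ^ k * W (j - k) - real k * (H) \<le> W j" using k by simp
    moreover have "c ^ M * (?q j / (2 * A * real M)) \<le> c ^ k * W (j - k)"
      using k c A q0[of j] by (intro mult_mono power_decreasing) auto
    moreover have "real k * (H) \<le> real M * (H)"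
      using k H by (intro mult_right_mono) auto
    ultimately have "c ^ M * (?q j / (2 * A * real M)) - real M * (H) \<le> W j" by linarith
    moreover have "H \<le> e * c * (c ^ M * (?q j / (2 * A * real M)) - real M * (H))"
    proof -
      define G where "G = 2 * A * real M / c ^ M"
      have G: "0 < G" using A M c by (simp add: G_def)
      have "D * (real M + 1 / (e * c)) \<le> K * (1 / G)"
        using K(2) G by (simp add: pos_le_divide_eq flip: G_def)
      then have "D / K * (real M + 1 / (e * c)) \<le> 1 / G"
        using K0 by (simp add: pos_divide_le_eq mult.commute)
      also have "1 / G = c ^ M / (2 * A * real M)" by (simp add: G_def)
      finally have "e * c * ?q j * (D / K * (real M + 1 / (e * c))) \<le> e * c * ?q j * (c ^ M / (2 * A * real M))"
        using e c q0[of j] by (intro mult_left_mono) auto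
      moreover have "e * c * ?q j * (D / K * (real M + 1 / (e * c))) = e * c * (real M * H) + H"
      proof -
        have "e * c * ?q j * (D / K * (real M + 1 / (e * c))) = H * (e * c * (real M + 1 / (e * c)))"
          by (simp only: H_def mult_ac)
        also have "e * c * (real M + 1 / (e * c)) = e * c * real M + 1"
          using e c by (simp add: distrib_left)
        finally show ?thesis by (simp add: distrib_left mult_ac)
      qed
      ultimately have "e * c * (real M * H) + H \<le> e * c * (c ^ M * (?q j / (2 * A * real M)))"
        by (simp add: mult_ac)
      then show ?thesis by (simp add: right_diff_distrib)
    qed
    moreover have "?q j - ?q (Suc j) \<le> H" unfolding H_def by (rule qd) auto
    moreover have "e * c * (c ^ M * (?q j / (2 * A * real M)) - real M * H) \<le> e * c * W j"
      using calculation(1) e c by (intro mult_left_mono) auto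
    ultimately have "?q j - ?q (Suc j) \<le> e * c * W j" by linarith
    then show "?q (n - 1) - ?q n \<le> e * c * W (n - 1)" using j by simp
  qed
qed

section \<open>Symbol sequences\<close>

fun prepend :: "'j list \<Rightarrow> (nat \<Rightarrow> 'j) \<Rightarrow> nat \<Rightarrow> 'j" where
  "prepend [] \<omega> = \<omega>"
| "prepend (j # s) \<omega> = case_nat j (prepend s \<omega>)"

definition word_prob :: "'j pmf \<Rightarrow> 'j list \<Rightarrow> real" where
  "word_prob p s = prod_list (map (pmf p) s)"

lemma word_prob_simps [simp]:
  "word_prob p [] = 1" "word_prob p (j # s) = pmf p j * word_prob p s"
  "word_prob p (s @ t) = word_prob p s * word_prob p t"
  by (simp_all add: word_prob_def)

lemma word_prob_nonneg [simp]: "0 \<le> word_prob p s"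
  by (induction s) auto

definition words :: "nat \<Rightarrow> 'j list set" where
  "words n = {s. length s = n}"

lemma finite_words [simp, intro]: "finite (words n :: 'j::finite list set)"
  using finite_lists_length_eq[of "UNIV :: 'j set" n] by (simp add: words_def)

lemma words_0 [simp]: "words 0 = {[]}"
  by (auto simp: words_def)

lemma sum_words_Cons:
  "(\<Sum>s\<in>words (Suc n). f s) = (\<Sum>j\<in>UNIV. \<Sum>s\<in>words n. f (j # s :: 'j::finite list))"
proof -
  have "words (Suc n) = (\<lambda>(j, s). j # s) ` (UNIV \<times> words n :: ('j \<times> 'j list) set)"
    by (auto simp: words_def length_Suc_conv image_iff)
  moreover have "inj_on (\<lambda>(j, s). j # s) (UNIV \<times> words n :: ('j \<times> 'j list) set)"
    by (auto simp: inj_on_def)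
  ultimately show ?thesis
    by (simp add: sum.reindex sum.cartesian_product case_prod_unfold)
qed

lemma sum_words_snoc:
  "(\<Sum>s\<in>words (Suc n). f s) = (\<Sum>s\<in>words n. \<Sum>j\<in>UNIV. f (s @ [j :: 'j::finite]))"
proof -
  have "words (Suc n) = (\<lambda>(s, j). s @ [j]) ` (words n \<times> UNIV :: ('j list \<times> 'j) set)"
    by (auto simp: words_def length_Suc_conv_rev image_iff)
  moreover have "inj_on (\<lambda>(s, j). s @ [j]) (words n \<times> UNIV :: ('j list \<times> 'j) set)"
    by (auto simp: inj_on_def)
  ultimately show ?thesis
    by (simp add: sum.reindex sum.cartesian_product case_prod_unfold)
qed

lemma sum_word_prob: "(\<Sum>s\<in>words n. word_prob p s) = (1 :: real)"
  for p :: "'j::finite pmf"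
  by (induction n) (simp_all add: sum_words_Cons sum_pmf_eq_1 flip: sum_distrib_left)

lemma prepend_append: "prepend (s @ t) \<omega> = prepend s (prepend t \<omega>)"
  by (induction s) auto

lemma prepend_nth: "i < length s \<Longrightarrow> prepend s \<omega> i = s ! i"
  by (induction s arbitrary: i) (auto split: nat.split)

lemma prepend_nth_add: "prepend s \<omega> (length s + i) = \<omega> i"
  by (induction s) auto

lemma shift_case_nat [simp]: "shift (case_nat j \<omega>) = \<omega>"
  by (simp add: shift_def)

lemma random_map_iterate_Cons:
  "(random_map T ^^ Suc n) (case_nat j \<omega>, x) = (random_map T ^^ n) (\<omega>, T j x)"
  by (simp only: funpow_Suc_right o_apply) (simp add: random_map_def)

section \<open>The Bernoulli measure and integration over its first symbol\<close>

lemma prob_space_bernoulli: "prob_space (bernoulli_measure p)"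
  unfolding bernoulli_measure_def by (intro prob_space_PiM prob_space_measure_pmf)

lemma space_bernoulli [simp]: "space (bernoulli_measure p) = UNIV"
  by (simp add: bernoulli_measure_def space_PiM)

lemma measurable_bernoulli_coord [measurable]:
  "(\<lambda>\<omega>. \<omega> i) \<in> measurable (bernoulli_measure p) (count_space UNIV)"
proof -
  have "(\<lambda>\<omega>. \<omega> i) \<in> measurable (bernoulli_measure p) (measure_pmf p)"
    unfolding bernoulli_measure_def by (rule measurable_component_singleton) simp
  then show ?thesis by simp
qed

lemma measurable_into_bernoulli:
  assumes "\<And>i. (\<lambda>x. f x i) \<in> measurable M (count_space UNIV)"
  shows "f \<in> measurable M (bernoulli_measure p)"
  unfolding bernoulli_measure_def
  by (rule measurable_PiM_single') (use assms in \<open>auto simp: space_PiM\<close>)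

lemma measurable_prepend [measurable]: "prepend s \<in> measurable (bernoulli_measure p) (bernoulli_measure p)"
proof (rule measurable_into_bernoulli)
  fix i
  show "(\<lambda>\<omega>. prepend s \<omega> i) \<in> measurable (bernoulli_measure p) (count_space UNIV)"
  proof (cases "i < length s")
    case True then show ?thesis by (simp add: prepend_nth)
  next
    case False
    then obtain k where "i = length s + k" using le_Suc_ex[of "length s" i] by auto
    then show ?thesis by (simp add: prepend_nth_add measurable_bernoulli_coord)
  qed
qed

lemma measurable_case_nat_bernoulli [measurable]:
  "case_nat j \<in> measurable (bernoulli_measure p) (bernoulli_measure p)"
  using measurable_prepend[of "[j]" p] by (simp add: fun_eq_iff cong: measurable_cong)

lemma measurable_shift [measurable]: "shift \<in> measurable (bernoulli_measure p) (bernoulli_measure p)"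
  by (rule measurable_into_bernoulli) (simp add: shift_def measurable_bernoulli_coord)

text \<open>The first symbol is independent of the rest: \<open>case_nat\<close> carries the product
  of the symbol law and the sequence law to the sequence law, and Fubini's theorem splits the
  integral.\<close>

lemma integral_bernoulli_cons:
  fixes G :: "(nat \<Rightarrow> 'j::finite) \<Rightarrow> real"
  assumes [measurable]: "G \<in> borel_measurable (bernoulli_measure p)" and bound: "\<And>\<omega>. \<bar>G \<omega>\<bar> \<le> C"
  shows "(\<integral>\<omega>. G \<omega> \<partial>bernoulli_measure p) =
    (\<Sum>j\<in>UNIV. pmf p j * (\<integral>\<omega>. G (case_nat j \<omega>) \<partial>bernoulli_measure p))"
proof -
  let ?S = "bernoulli_measure p"
  interpret sequence_space "measure_pmf p" ..
  have iter: "distr (measure_pmf p \<Otimes>\<^sub>M ?S) ?S (\<lambda>(s, \<omega>). case_nat s \<omega>) = ?S"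
    unfolding bernoulli_measure_def by (rule PiM_iter)
  have meas [measurable]: "(\<lambda>(s, \<omega>). case_nat s \<omega>) \<in> measurable (measure_pmf p \<Otimes>\<^sub>M ?S) ?S"
    unfolding bernoulli_measure_def by measurable
  interpret S: prob_space ?S by (rule prob_space_bernoulli)
  interpret pair: pair_prob_space "measure_pmf p" ?S by unfold_locales
  have "(\<integral>\<omega>. G \<omega> \<partial>?S) = (\<integral>z. G (case z of (s, \<omega>) \<Rightarrow> case_nat s \<omega>) \<partial>(measure_pmf p \<Otimes>\<^sub>M ?S))"
    by (subst iter[symmetric], subst integral_distr) auto
  also have "\<dots> = (\<integral>s. (\<integral>\<omega>. G (case_nat s \<omega>) \<partial>?S) \<partial>measure_pmf p)"
  proof (subst pair.integral_fst'[symmetric])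
    show "integrable (measure_pmf p \<Otimes>\<^sub>M ?S) (\<lambda>z. G (case z of (s, \<omega>) \<Rightarrow> case_nat s \<omega>))"
      by (rule pair.integrable_const_bound[of _ C]) (auto simp: bound)
  qed simp
  also have "\<dots> = (\<Sum>j\<in>UNIV. pmf p j * (\<integral>\<omega>. G (case_nat j \<omega>) \<partial>?S))"
    by (subst integral_measure_pmf[of UNIV]) auto
  finally show ?thesis .
qed

lemma integral_bernoulli_pair_cons:
  fixes G :: "(nat \<Rightarrow> 'j::finite) \<times> 'b \<Rightarrow> real"
  assumes V: "prob_space V" and [measurable]: "G \<in> borel_measurable (bernoulli_measure p \<Otimes>\<^sub>M V)"
    and bound: "\<And>z. z \<in> space (bernoulli_measure p \<Otimes>\<^sub>M V) \<Longrightarrow> \<bar>G z\<bar> \<le> C"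
  shows "(\<integral>z. G z \<partial>(bernoulli_measure p \<Otimes>\<^sub>M V)) =
    (\<Sum>j\<in>UNIV. pmf p j * (\<integral>z. G (case_nat j (fst z), snd z) \<partial>(bernoulli_measure p \<Otimes>\<^sub>M V)))"
proof -
  let ?S = "bernoulli_measure p"
  interpret S: prob_space ?S by (rule prob_space_bernoulli)
  interpret V: prob_space V by (rule V)
  interpret pair: pair_prob_space ?S V by unfold_locales
  have int: "integrable (?S \<Otimes>\<^sub>M V) (\<lambda>(\<omega>, y). G (\<omega>, y))"
    by (rule pair.integrable_const_bound[of _ C]) (auto simp: bound space_pair_measure)
  have int': "integrable (?S \<Otimes>\<^sub>M V) (\<lambda>(\<omega>, y). G (case_nat j \<omega>, y))" for j
    by (rule pair.integrable_const_bound[of _ C]) (auto simp: bound space_pair_measure)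
  have "(\<integral>z. G z \<partial>(?S \<Otimes>\<^sub>M V)) = (\<integral>y. (\<integral>\<omega>. G (\<omega>, y) \<partial>?S) \<partial>V)"
    using pair.integral_snd[OF int] by (simp add: case_prod_unfold)
  also have "\<dots> = (\<integral>y. (\<Sum>j\<in>UNIV. pmf p j * (\<integral>\<omega>. G (case_nat j \<omega>, y) \<partial>?S)) \<partial>V)"
    by (intro Bochner_Integration.integral_cong refl integral_bernoulli_cons[of _ _ C]) (auto simp: bound space_pair_measure)
  also have "\<dots> = (\<Sum>j\<in>UNIV. pmf p j * (\<integral>y. (\<integral>\<omega>. G (case_nat j \<omega>, y) \<partial>?S) \<partial>V))"
    using pair.integrable_snd[OF int'] by (subst Bochner_Integration.integral_sum) auto
  also have "\<dots> = (\<Sum>j\<in>UNIV. pmf p j * (\<integral>z. G (case_nat j (fst z), snd z) \<partial>(?S \<Otimes>\<^sub>M V)))"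
    using pair.integral_snd[OF int'] by (simp add: case_prod_unfold)
  finally show ?thesis .
qed

section \<open>Return branches\<close>

lemma two_mult_le_two_powr:
  fixes v :: real
  assumes "v \<le> 1"
  shows "2 * v \<le> 2 powr v"
proof -
  \<comment> \<open>Compares with the tangent of \<open>2 powr (v - 1)\<close> at v = 1, whose slope
    ln 2 is below 1.\<close>
  have "v \<le> 1 + (v - 1) * ln 2"
    using mult_left_mono_neg[of "ln 2" 1 "v - 1"] ln_2_less_1 assms by simp
  also have "\<dots> \<le> exp ((v - 1) * ln 2)" by (rule exp_ge_add_one_self)
  also have "\<dots> = 2 powr (v - 1)" by (simp add: powr_def)
  finally show ?thesis by (simp add: powr_diff)
qed

text \<open>The derivative is \<open>v * a powr v * (1 + y) powr (v - 1)\<close>, hence at most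
  \<open>v * (1 / 2) powr v\<close>, and 2 * v \<le> 2 powr v. The factor 1 / 2 is uniform in v, so
  branches with huge total exponents contract at least as well as affine ones.\<close>

lemma powr_contraction:
  fixes a v y y' :: real
  assumes a: "0 < a" "a \<le> 1 / 2" and v: "0 < v" "v \<le> 1" and y: "0 \<le> y" "0 \<le> y'"
  shows "\<bar>(a * (1 + y)) powr v - (a * (1 + y')) powr v\<bar> \<le> \<bar>y - y'\<bar> / 2"
proof -
  have *: "\<bar>(a * (1 + y)) powr v - (a * (1 + y')) powr v\<bar> \<le> \<bar>y - y'\<bar> / 2" if "0 \<le> y'" "y' < y" for y y'
  proof -
    have "\<exists>z>y'. z < y \<and> (a * (1 + y)) powr v - (a * (1 + y')) powr v =
      (y - y') * (v * (a * (1 + z)) powr (v - 1) * a)"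
      using that a by (intro MVT2) (auto intro!: derivative_eq_intros)
    then obtain z where z: "y' < z" "z < y"
      "(a * (1 + y)) powr v - (a * (1 + y')) powr v = (y - y') * (v * (a * (1 + z)) powr (v - 1) * a)"
      by auto
    have "v * (a * (1 + z)) powr (v - 1) * a = v * a powr v * (1 + z) powr (v - 1)"
      using a z that by (subst powr_mult) (auto simp: powr_diff)
    also have "\<dots> \<le> v * (1 / 2) powr v * 1"
    proof (intro mult_mono)
      show "a powr v \<le> (1 / 2) powr v" using a v by (intro powr_mono2) auto
      have "(1 + z) powr (v - 1) \<le> 1 powr (v - 1)" using z that v by (intro powr_mono2') auto
      then show "(1 + z) powr (v - 1) \<le> 1" by simp
    qed (use v in auto)
    also have "\<dots> \<le> 1 / 2"
      using two_mult_le_two_powr[OF v(2)] by (simp add: powr_divide field_simps)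
    finally have "(y - y') * (v * (a * (1 + z)) powr (v - 1) * a) \<le> (y - y') * (1 / 2)"
      using that by (intro mult_left_mono) auto
    moreover have "0 \<le> (y - y') * (v * (a * (1 + z)) powr (v - 1) * a)"
      using that v a by (intro mult_nonneg_nonneg) auto
    ultimately show ?thesis using z(3) that by simp
  qed
  consider "y < y'" | "y' < y" | "y = y'" by linarith
  then show ?thesis
    using *[of y' y] *[of y y'] y by cases (auto simp: abs_minus_commute)
qed

section \<open>The sequence metric under a common prefix\<close>

lemma seq_dist_nonneg [simp]: "0 \<le> seq_dist \<omega> \<omega>'"
  by (simp add: seq_dist_def)

lemma seq_dist_le_half: "seq_dist \<omega> \<omega>' \<le> 1 / 2"
  using power_le_one[of "1 / 2 :: real"] by (simp add: seq_dist_def)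

lemma seq_dist_case_nat: "seq_dist (case_nat j \<omega>) (case_nat j \<omega>') = seq_dist \<omega> \<omega>' / 2"
proof (cases "\<omega> = \<omega>'")
  case False
  then obtain i where i: "\<omega> i \<noteq> \<omega>' i" by auto
  have "(LEAST i. case_nat j \<omega> i \<noteq> case_nat j \<omega>' i) = Suc (LEAST i. \<omega> i \<noteq> \<omega>' i)"
    using Least_Suc[of "\<lambda>i. case_nat j \<omega> i \<noteq> case_nat j \<omega>' i" "Suc i"] i by simp
  moreover have "case_nat j \<omega> \<noteq> case_nat j \<omega>'"
    using False by (metis shift_case_nat)
  ultimately show ?thesis using False by (simp add: seq_dist_def)
qed (simp add: seq_dist_def)

lemma seq_dist_prepend_le: "seq_dist (prepend s \<omega>) (prepend s \<omega>') \<le> seq_dist \<omega> \<omega>'"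
proof (induction s)
  case (Cons j s)
  then show ?case using seq_dist_nonneg[of \<omega> \<omega>']
    unfolding prepend.simps seq_dist_case_nat by linarith
qed simp

lemma seq_dist_prepend_le_half:
  "s \<noteq> [] \<Longrightarrow> seq_dist (prepend s \<omega>) (prepend s \<omega>') \<le> seq_dist \<omega> \<omega>' / 2"
  using seq_dist_prepend_le by (cases s) (auto simp: seq_dist_case_nat)

text \<open>One exponent function serves good and bad maps alike: in the coordinate y both kinds act
  through \<open>y powr e j\<close>, so exponents can be multiplied along a word.\<close>

locale critical_system =
  fixes T :: "'j::finite \<Rightarrow> real \<Rightarrow> real" and p :: "'j pmf" and e :: "'j \<Rightarrow> real" and bad :: "'j set"
  assumes bad_map_with: "j \<in> bad \<Longrightarrow> bad_map_with (e j) (T j)"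
    and good_map_with: "j \<notin> bad \<Longrightarrow> good_map_with (e j) (T j)"
begin

abbreviation F where "F \<equiv> random_map T"

lemma e_ge_1: "1 \<le> e j"
  using bad_map_with[of j] good_map_with[of j]
  by (cases "j \<in> bad") (auto simp: bad_map_with_def good_map_with_def)

lemma e_pos: "0 < e j" using e_ge_1[of j] by simp

lemma T_left_bad:
  assumes "0 < y" "y \<le> 1" "j \<in> bad"
  shows "T j ((1 - y) / 2) = (1 - y powr e j) / 2"
proof -
  have "(1 - y) / 2 \<in> {0..<1/2}" using assms by auto
  then have "T j ((1 - y) / 2) = 1 / 2 - 2 powr (e j - 1) * (1 / 2 - (1 - y) / 2) powr e j"
    using bad_map_with[OF assms(3)] unfolding bad_map_with_def by blast
  also have "1 / 2 - (1 - y) / 2 = y / 2" by (simp add: field_simps)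
  finally show ?thesis using assms by (simp add: powr_divide powr_diff field_simps)
qed

lemma T_left_good:
  assumes "0 < y" "y \<le> 1" "j \<notin> bad"
  shows "T j ((1 - y) / 2) = 1 - y powr e j"
proof -
  have "(1 - y) / 2 \<in> {0..<1/2}" using assms by auto
  then have "T j ((1 - y) / 2) = 1 - 2 powr e j * (1 / 2 - (1 - y) / 2) powr e j"
    using good_map_with[OF assms(3)] unfolding good_map_with_def by blast
  also have "1 / 2 - (1 - y) / 2 = y / 2" by (simp add: field_simps)
  finally show ?thesis using assms by (simp add: powr_divide)
qed

lemma T_right:
  assumes "1 / 2 \<le> x" "x \<le> 1"
  shows "T j x = 2 * x - 1"
  using bad_map_with[of j] good_map_with[of j] assms
  by (cases "j \<in> bad") (auto simp: bad_map_with_def good_map_with_def)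

lemma T_range:
  assumes "0 \<le> x" "x \<le> 1"
  shows "0 \<le> T j x" "T j x \<le> 1"
proof -
  have "0 \<le> T j x \<and> T j x \<le> 1"
  proof (cases "x < 1 / 2")
    case True
    define y where "y = 1 - 2 * x"
    have y: "0 < y" "y \<le> 1" "x = (1 - y) / 2" using True assms by (auto simp: y_def)
    define P where "P = y powr e j"
    have "0 \<le> P" "P \<le> 1" using y e_ge_1[of j] by (auto simp: P_def intro!: powr_le1)
    then show ?thesis using T_left_bad[OF y(1,2), of j] T_left_good[OF y(1,2), of j]
      unfolding y(3)[symmetric] P_def[symmetric] by (cases "j \<in> bad") auto
  qed (use T_right[of x j] assms in auto)
  then show "0 \<le> T j x" "T j x \<le> 1" by auto
qed

text \<open>Value 0 means that bad maps alone have acted and kept the orbit on the left half. All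
  maps agree on the right half, so of the symbols after the first good one their number is all that
  matters until the return; for the same reason \<open>total_exp\<close> stops at the first good
  symbol.\<close>

definition free :: "'j list \<Rightarrow> nat" where
  "free s = length (dropWhile (\<lambda>j. j \<in> bad) s)"

fun total_exp :: "'j list \<Rightarrow> real" where
  "total_exp [] = 1"
| "total_exp (j # s) = (if j \<in> bad then e j * total_exp s else e j)"

lemma free_simps [simp]:
  "free [] = 0" "free (j # s) = (if j \<in> bad then free s else Suc (length s))"
  by (simp_all add: free_def)

lemma free_snoc: "free (s @ [j]) = (if 0 < free s \<or> j \<notin> bad then Suc (free s) else 0)"
  by (induction s) auto

lemma free_append_ge: "free s \<le> free (s @ t)"
  by (induction s) auto

lemma free_pos_append: "0 < free s \<Longrightarrow> free (s @ t) = free s + length t"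
  by (induction s) (auto split: if_splits)

lemma total_exp_append: "0 < free s \<Longrightarrow> total_exp (s @ t) = total_exp s"
  by (induction s) (auto split: if_splits)

lemma total_exp_ge_1: "1 \<le> total_exp s"
proof (induction s)
  case (Cons j s)
  then show ?case using e_ge_1[of j] mult_mono[of 1 "e j" 1 "total_exp s"] by auto
qed simp

lemma total_exp_pos: "0 < total_exp s"
  using total_exp_ge_1[of s] by simp

lemma total_exp_append_ge: "total_exp s \<le> total_exp (s @ t)"
proof (induction s)
  case Nil
  then show ?case using total_exp_ge_1 by simp
next
  case (Cons j s)
  then show ?case using e_pos[of j] by auto
qed

text \<open>In the coordinate \<open>y = 1 - 2 x\<close> of the left half bad maps act as \<open>y \<mapsto> y powr e\<close>.\<close>

definition embed :: "(nat \<Rightarrow> 'j) \<times> real \<Rightarrow> (nat \<Rightarrow> 'j) \<times> real" where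
  "embed z = (fst z, (1 - snd z) / 2)"

text \<open>The hypothesis bounds the final distance from 1, so the last point may already lie on
  the left half; all earlier distances are at most 1 / 2 because they double at each step.\<close>

lemma right_iterate:
  assumes "0 \<le> z" "2 ^ length s * z \<le> 1"
  shows "(F ^^ length s) (prepend s \<omega>, 1 - z) = (\<omega>, 1 - 2 ^ length s * z)"
  using assms
proof (induction s arbitrary: z)
  case (Cons j s)
  have "2 * z \<le> 2 ^ length (j # s) * z"
    using Cons.prems by (intro mult_right_mono) (auto intro: order_trans[OF _ mult_left_mono[of 1]])
  then have "z \<le> 1 / 2" using Cons.prems by simp
  then have "T j (1 - z) = 1 - 2 * z" using Cons.prems T_right[of "1 - z" j] by simp
  then show ?case using Cons.prems Cons.IH[of "2 * z"]
    by (simp add: random_map_iterate_Cons mult.assoc mult.commute mult.left_commute del: funpow.simps)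
qed simp

lemma left_iterate:
  assumes "0 < y" "y \<le> 1" "free s = 0"
  shows "(F ^^ length s) (prepend s \<omega>, (1 - y) / 2) = (\<omega>, (1 - y powr total_exp s) / 2)"
  using assms
proof (induction s arbitrary: y)
  case (Cons j s)
  then have j: "j \<in> bad" "free s = 0" by (auto split: if_splits)
  have "y powr e j \<le> 1" using Cons.prems e_ge_1[of j] by (intro powr_le1) auto
  then show ?case using Cons.prems j Cons.IH[of "y powr e j"]
    by (simp add: random_map_iterate_Cons T_left_bad powr_powr del: funpow.simps)
qed simp

lemma free_iterate:
  assumes "0 < y" "y \<le> 1" "0 < free s" "2 ^ (free s - 1) * y powr total_exp s \<le> 1"
  shows "(F ^^ length s) (prepend s \<omega>, (1 - y) / 2) = (\<omega>, 1 - 2 ^ (free s - 1) * y powr total_exp s)"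
  using assms
proof (induction s arbitrary: y)
  case (Cons j s)
  show ?case
  proof (cases "j \<in> bad")
    case True
    have "y powr e j \<le> 1" using Cons.prems e_ge_1[of j] by (intro powr_le1) auto
    then show ?thesis using Cons.prems True Cons.IH[of "y powr e j"]
      by (simp add: random_map_iterate_Cons T_left_bad powr_powr del: funpow.simps)
  next
    case False
    then show ?thesis using Cons.prems right_iterate[of "y powr e j" s]
      by (simp add: random_map_iterate_Cons T_left_good del: funpow.simps)
  qed
qed simp

text \<open>
  A word \<open>s\<close> with \<open>0 < free s\<close> consists of bad symbols, one good symbol and \<open>free s - 1\<close> further symbols.
  Its return branch is the inverse of \<open>inv_branch s\<close> and maps \<open>(cut s, inv_branch s 1]\<close> onto \<open>(0, 1]\<close>;
  the points without return during \<open>s\<close> are those with \<open>y \<le> cut s\<close>.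
\<close>

definition cut :: "'j list \<Rightarrow> real" where
  "cut s = 2 powr - (real (free s) / total_exp s)"

definition inv_branch :: "'j list \<Rightarrow> real \<Rightarrow> real" where
  "inv_branch s y = (2 powr - real (free s) * (1 + y)) powr (1 / total_exp s)"

definition jac :: "'j list \<Rightarrow> real \<Rightarrow> real" where
  "jac s y = cut s / total_exp s * (1 + y) powr (1 / total_exp s - 1)"

definition branch :: "'j list \<Rightarrow> (nat \<Rightarrow> 'j) \<times> real \<Rightarrow> (nat \<Rightarrow> 'j) \<times> real" where
  "branch s z = (prepend s (fst z), inv_branch s (snd z))"

lemma cut_pos: "0 < cut s" by (simp add: cut_def)

lemma cut_le_1: "cut s \<le> 1"
  using total_exp_pos[of s] by (simp add: cut_def powr_minus_divide ge_one_powr_ge_zero)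

lemma jac_pos: "0 \<le> y \<Longrightarrow> 0 < jac s y"
  using total_exp_pos[of s] cut_pos[of s] by (simp add: jac_def)

lemma jac_le_1:
  assumes "0 \<le> y" shows "jac s y \<le> 1"
proof -
  have "(1 + y) powr (1 / total_exp s - 1) \<le> 1 powr (1 / total_exp s - 1)"
    using assms total_exp_ge_1[of s] by (intro powr_mono2') auto
  moreover have "cut s / total_exp s \<le> 1" using cut_le_1[of s] total_exp_ge_1[of s] by simp
  ultimately show ?thesis
    using mult_mono[of "cut s / total_exp s" 1 "(1 + y) powr (1 / total_exp s - 1)" 1] total_exp_pos[of s] cut_pos[of s]
    by (simp add: jac_def)
qed

lemma inv_branch_0: "inv_branch s 0 = cut s"
  by (simp add: inv_branch_def cut_def powr_powr)

lemma inv_branch_1: "0 < free s \<Longrightarrow> inv_branch s 1 = 2 powr - (real (free s - 1) / total_exp s)"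
proof -
  assume "0 < free s"
  then have "2 powr - real (free s) * (1 + 1) = 2 powr - real (free s - 1)"
    by (cases "free s") (auto simp: powr_diff powr_minus_divide)
  then show ?thesis by (simp only: inv_branch_def powr_powr) simp
qed

lemma inv_branch_pos: "0 \<le> y \<Longrightarrow> 0 < inv_branch s y"
  by (simp add: inv_branch_def)

lemma inv_branch_mono: "0 \<le> y \<Longrightarrow> y \<le> y' \<Longrightarrow> inv_branch s y \<le> inv_branch s y'"
  unfolding inv_branch_def using total_exp_pos[of s] by (intro powr_mono2) auto

lemma inv_branch_le_1:
  assumes "0 < free s" "0 \<le> y" "y \<le> 1"
  shows "inv_branch s y \<le> 1"
proof -
  have "inv_branch s y \<le> inv_branch s 1" using assms by (intro inv_branch_mono)
  also have "\<dots> \<le> 1"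
    using assms total_exp_pos[of s] by (simp add: inv_branch_1 powr_minus_divide ge_one_powr_ge_zero)
  finally show ?thesis .
qed

lemma inv_branch_powr:
  assumes "0 \<le> y"
  shows "inv_branch s y powr r = (2 powr - real (free s) * (1 + y)) powr (r / total_exp s)"
  by (simp add: inv_branch_def powr_powr)

lemma inv_branch_deriv:
  assumes "0 \<le> y"
  shows "(inv_branch s has_real_derivative jac s y) (at y)"
proof -
  let ?r = "total_exp s" and ?a = "2 powr - real (free s)"
  have "((\<lambda>y. (?a * (1 + y)) powr (1 / ?r)) has_real_derivative
      1 / ?r * (?a * (1 + y)) powr (1 / ?r - 1) * ?a) (at y)"
    using assms by (auto intro!: derivative_eq_intros)
  moreover have "1 / ?r * (?a * (1 + y)) powr (1 / ?r - 1) * ?a = jac s y"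
  proof -
    have "(?a * (1 + y)) powr (1 / ?r - 1) * ?a = ?a powr (1 / ?r) * (1 + y) powr (1 / ?r - 1)"
      using assms by (subst powr_mult) (auto simp: powr_diff)
    moreover have "?a powr (1 / ?r) = cut s" by (simp add: cut_def powr_powr)
    ultimately show ?thesis by (simp add: jac_def)
  qed
  ultimately show ?thesis unfolding inv_branch_def[abs_def] by simp
qed

lemma inv_branch_contraction:
  assumes "0 < free s" "0 \<le> y" "0 \<le> y'"
  shows "\<bar>inv_branch s y - inv_branch s y'\<bar> \<le> \<bar>y - y'\<bar> / 2"
  unfolding inv_branch_def
proof (rule powr_contraction)
  have "2 powr - real (free s) \<le> 2 powr - 1" using assms by (intro powr_mono) auto
  then show "2 powr - real (free s) \<le> (1 / 2 :: real)" by (simp add: powr_minus)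
qed (use assms total_exp_ge_1[of s] total_exp_pos[of s] in auto)

lemma branch_contraction:
  assumes "0 < free s" "0 \<le> snd z" "0 \<le> snd z'"
  shows "skew_dist (branch s z) (branch s z') \<le> skew_dist z z' / 2"
proof -
  have "s \<noteq> []" using assms by auto
  then show ?thesis
    using seq_dist_prepend_le_half[of s "fst z" "fst z'"] inv_branch_contraction[OF assms]
    by (simp add: skew_dist_def branch_def case_prod_unfold)
qed

text \<open>The distortion is uniformly bounded since the exponent \<open>1 / total_exp s - 1\<close> lies in \<open>(-1, 0]\<close>.\<close>

lemma jac_distortion:
  assumes "0 \<le> y" "0 \<le> y'"
  shows "jac s y \<le> exp \<bar>y - y'\<bar> * jac s y'"
proof -
  define v where "v = 1 - 1 / total_exp s"
  have v: "0 \<le> v" "v \<le> 1" using total_exp_ge_1[of s] by (auto simp: v_def)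
  have "(1 + y') powr v \<le> (exp \<bar>y - y'\<bar> * (1 + y)) powr v"
  proof (rule powr_mono2)
    have "1 + y' \<le> (1 + y) + \<bar>y - y'\<bar> * (1 + y)"
      using mult_nonneg_nonneg[OF abs_ge_zero[of "y - y'"] assms(1)] unfolding distrib_left mult_1_right by linarith
    also have "\<dots> = (1 + \<bar>y - y'\<bar>) * (1 + y)" by (simp add: algebra_simps)
    also have "\<dots> \<le> exp \<bar>y - y'\<bar> * (1 + y)"
      using assms by (intro mult_right_mono exp_ge_add_one_self) auto
    finally show "1 + y' \<le> exp \<bar>y - y'\<bar> * (1 + y)" .
  qed (use v assms in auto)
  also have "\<dots> = exp (\<bar>y - y'\<bar> * v) * (1 + y) powr v"
    using assms by (simp add: powr_mult exp_powr_real mult.commute)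
  also have "\<dots> \<le> exp \<bar>y - y'\<bar> * (1 + y) powr v"
    using v mult_left_le[of v "\<bar>y - y'\<bar>"] by (intro mult_right_mono) auto
  finally have "(1 + y) powr - v \<le> exp \<bar>y - y'\<bar> * (1 + y') powr - v"
    using assms by (simp add: powr_minus field_simps)
  then have "cut s / total_exp s * (1 + y) powr - v \<le> cut s / total_exp s * (exp \<bar>y - y'\<bar> * (1 + y') powr - v)"
    using cut_pos[of s] total_exp_pos[of s] by (intro mult_left_mono) auto
  then show ?thesis by (simp add: jac_def v_def mult_ac)
qed

text \<open>The position in the middle of an excursion, expressed through the coordinate y at which
  the excursion will end. Before the first good symbol it is a power with exponent ratio at most 1;
  afterwards it is affine in y.\<close>

lemma iterate_branch_prefix:
  assumes s: "0 < free (u @ v)" and y: "0 < y" "y \<le> 1"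
  shows "(F ^^ length u) (embed (branch (u @ v) (\<omega>, y))) = (prepend v \<omega>,
    if free u = 0 then (1 - (2 powr - real (free (u @ v)) * (1 + y)) powr (total_exp u / total_exp (u @ v))) / 2
    else 1 - 2 ^ (free u - 1) * (2 powr - real (free (u @ v)) * (1 + y)))"
proof -
  let ?y = "inv_branch (u @ v) y"
  have iy: "0 < ?y" "?y \<le> 1" using inv_branch_pos inv_branch_le_1[OF s] y by auto
  have pw: "?y powr total_exp u = (2 powr - real (free (u @ v)) * (1 + y)) powr (total_exp u / total_exp (u @ v))"
    using y by (simp add: inv_branch_powr)
  show ?thesis
  proof (cases "free u = 0")
    case True
    then show ?thesis using left_iterate[OF iy True, of "prepend v \<omega>"] pw
      by (simp add: embed_def branch_def prepend_append)
  next
    case False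
    then have eq: "total_exp (u @ v) = total_exp u" "free (u @ v) = free u + length v"
      by (auto intro: total_exp_append free_pos_append)
    have pw': "?y powr total_exp u = 2 powr - real (free (u @ v)) * (1 + y)"
      using pw total_exp_pos[of u] y by (simp add: eq(1))
    have "2 ^ (free u - 1) * (2 powr - real (free (u @ v)) * (1 + y)) \<le> 2 ^ (free u - 1) * (2 powr - real (free u) * 2)"
      using y eq by (intro mult_left_mono mult_mono powr_mono) auto
    also have "\<dots> = 2 ^ free u * 2 powr - real (free u)"
      using False by (cases "free u") auto
    also have "\<dots> = 1" by (simp add: powr_minus powr_realpow)
    finally show ?thesis using free_iterate[OF iy, of u "prepend v \<omega>"] pw' False
      by (simp add: embed_def branch_def prepend_append)
  qed
qed

lemma iterate_branch:
  assumes "0 < free s" "0 < y" "y \<le> 1"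
  shows "(F ^^ length s) (embed (branch s (\<omega>, y))) = embed (\<omega>, y)"
proof -
  have "2 ^ (free s - 1) * 2 powr - real (free s) = (1 / 2 :: real)"
    using assms powr_realpow[of 2 "free s"]
    by (cases "free s") (auto simp: powr_minus_divide simp del: of_nat_Suc)
  then have "2 ^ (free s - 1) * (2 powr - real (free s) * (1 + y)) = (1 + y) / 2"
    by (metis (no_types, opaque_lifting) mult.assoc mult.commute times_divide_eq_right mult_1_right)
  then show ?thesis using iterate_branch_prefix[of s "[]" y \<omega>] assms
    by (simp add: embed_def field_simps)
qed

text \<open>Excursions are read backwards from their end point. Both formulas of
  \<open>iterate_branch_prefix\<close> have slope at most 1 in y: by \<open>powr_contraction\<close>
  before the good symbol, and because \<open>2 powr - free (u @ v)\<close> outweighs the doublings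
  afterwards. This makes an observable evaluated in mid-excursion a regular function of the end
  point.\<close>

lemma iterate_branch_nonexpanding:
  assumes s: "0 < free s" and i: "i \<le> length s" and z: "snd z \<in> {0<..1}" "snd z' \<in> {0<..1}"
  shows "skew_dist ((F ^^ i) (embed (branch s z))) ((F ^^ i) (embed (branch s z'))) \<le> skew_dist z z'"
proof -
  define u v where "u = take i s" and "v = drop i s"
  have uv: "s = u @ v" "i = length u" using i by (auto simp: u_def v_def)
  obtain \<omega> y where z1: "z = (\<omega>, y)" by (cases z)
  obtain \<omega>' y' where z2: "z' = (\<omega>', y')" by (cases z')
  have y: "0 < y" "y \<le> 1" "0 < y'" "y' \<le> 1" using z by (auto simp: z1 z2)
  let ?a = "2 powr - real (free (u @ v))"
  have a: "?a \<le> 1 / 2"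
  proof -
    have "?a \<le> 2 powr - 1" using s uv by (intro powr_mono) auto
    then show ?thesis by (simp add: powr_minus)
  qed
  have "\<bar>snd ((F ^^ i) (embed (branch s z))) - snd ((F ^^ i) (embed (branch s z')))\<bar> \<le> \<bar>y - y'\<bar>"
  proof (cases "free u = 0")
    case True
    have "\<bar>(?a * (1 + y)) powr (total_exp u / total_exp (u @ v)) - (?a * (1 + y')) powr (total_exp u / total_exp (u @ v))\<bar>
        \<le> \<bar>y - y'\<bar> / 2"
      using y a total_exp_append_ge[of u v] total_exp_pos by (intro powr_contraction) auto
    then have "\<bar>(1 - (?a * (1 + y)) powr (total_exp u / total_exp (u @ v))) / 2 -
        (1 - (?a * (1 + y')) powr (total_exp u / total_exp (u @ v))) / 2\<bar> \<le> \<bar>y - y'\<bar>"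
      by argo
    then show ?thesis using True s y
      by (simp add: uv z1 z2 iterate_branch_prefix)
  next
    case False
    have "2 ^ (free u - 1) * ?a \<le> 2 ^ free u * 2 powr - real (free u)"
      using free_append_ge[of u v] by (intro mult_mono power_increasing powr_mono) auto
    also have "\<dots> = 1" by (simp add: powr_minus powr_realpow)
    finally have le: "2 ^ (free u - 1) * ?a \<le> 1" .
    have "\<bar>2 ^ (free u - 1) * (?a * (1 + y')) - 2 ^ (free u - 1) * (?a * (1 + y))\<bar> = (2 ^ (free u - 1) * ?a) * \<bar>y - y'\<bar>"
    proof -
      have "2 ^ (free u - 1) * (?a * (1 + y')) - 2 ^ (free u - 1) * (?a * (1 + y)) = (2 ^ (free u - 1) * ?a) * (y' - y)"
        by (simp add: algebra_simps)
      then show ?thesis by (simp add: abs_mult abs_minus_commute)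
    qed
    also have "\<dots> \<le> \<bar>y - y'\<bar>" using mult_right_mono[OF le, of "\<bar>y - y'\<bar>"] by simp
    finally show ?thesis using False s y
      by (simp add: uv z1 z2 iterate_branch_prefix)
  qed
  moreover have "fst ((F ^^ i) (embed (branch s z))) = prepend v \<omega>" "fst ((F ^^ i) (embed (branch s z'))) = prepend v \<omega>'"
    using s y by (simp_all add: uv z1 z2 iterate_branch_prefix)
  ultimately show ?thesis using seq_dist_prepend_le[of v \<omega> \<omega>']
    by (simp add: skew_dist_def z1 z2 case_prod_unfold)
qed

end

section \<open>Transfer operators on the left half\<close>

text \<open>The bound holds at every point and not just almost everywhere, so the class is stable
  under composition with any measurable map, whatever it does to null sets.\<close>

definition bounded_measurable :: "'a measure \<Rightarrow> ('a \<Rightarrow> real) set" where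
  "bounded_measurable M = {f \<in> borel_measurable M. \<exists>C. \<forall>z\<in>space M. \<bar>f z\<bar> \<le> C}"

lemma bounded_measurableI:
  "f \<in> borel_measurable M \<Longrightarrow> (\<And>z. z \<in> space M \<Longrightarrow> \<bar>f z\<bar> \<le> C) \<Longrightarrow> f \<in> bounded_measurable M"
  by (auto simp: bounded_measurable_def)

lemma bounded_measurable_measurable [measurable_dest]:
  "f \<in> bounded_measurable M \<Longrightarrow> f \<in> borel_measurable M"
  by (simp add: bounded_measurable_def)

lemma bounded_measurable_const: "(\<lambda>_. c) \<in> bounded_measurable M"
  by (rule bounded_measurableI[of _ _ "\<bar>c\<bar>"]) auto

lemma bounded_measurable_mult:
  assumes "f \<in> bounded_measurable M" "g \<in> bounded_measurable M"
  shows "(\<lambda>z. f z * g z) \<in> bounded_measurable M"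
proof -
  obtain C D where "\<And>z. z \<in> space M \<Longrightarrow> \<bar>f z\<bar> \<le> C" "\<And>z. z \<in> space M \<Longrightarrow> \<bar>g z\<bar> \<le> D"
    using assms by (auto simp: bounded_measurable_def)
  then show ?thesis using assms
    by (intro bounded_measurableI[of _ _ "C * D"]) (auto simp: abs_mult intro!: mult_mono order_trans[OF abs_ge_zero])
qed

lemma bounded_measurable_add:
  assumes "f \<in> bounded_measurable M" "g \<in> bounded_measurable M"
  shows "(\<lambda>z. f z + g z) \<in> bounded_measurable M"
proof -
  obtain C D where "\<And>z. z \<in> space M \<Longrightarrow> \<bar>f z\<bar> \<le> C" "\<And>z. z \<in> space M \<Longrightarrow> \<bar>g z\<bar> \<le> D"
    using assms by (auto simp: bounded_measurable_def)
  then show ?thesis using assms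
    by (intro bounded_measurableI[of _ _ "C + D"]) (auto intro!: order_trans[OF abs_triangle_ineq] add_mono)
qed

lemma bounded_measurable_diff:
  assumes "f \<in> bounded_measurable M" "g \<in> bounded_measurable M"
  shows "(\<lambda>z. f z - g z) \<in> bounded_measurable M"
  using bounded_measurable_add[OF assms(1) bounded_measurable_mult[OF bounded_measurable_const[of "-1"] assms(2)]]
  by simp

lemma bounded_measurable_sum:
  assumes "\<And>i. i \<in> I \<Longrightarrow> f i \<in> bounded_measurable M"
  shows "(\<lambda>z. \<Sum>i\<in>I. f i z) \<in> bounded_measurable M"
  using assms
  by (induction I rule: infinite_finite_induct)
     (auto intro: bounded_measurable_const bounded_measurable_add)

lemma bounded_measurable_compose:
  assumes "f \<in> bounded_measurable N" "g \<in> measurable M N"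
  shows "(\<lambda>z. f (g z)) \<in> bounded_measurable M"
proof -
  obtain C where "\<And>z. z \<in> space N \<Longrightarrow> \<bar>f z\<bar> \<le> C" using assms by (auto simp: bounded_measurable_def)
  moreover have "g z \<in> space N" if "z \<in> space M" for z using assms(2) that by (rule measurable_space)
  moreover have "(\<lambda>z. f (g z)) \<in> borel_measurable M"
    using assms by (auto simp: bounded_measurable_def)
  ultimately show ?thesis by (intro bounded_measurableI[of _ _ C]) auto
qed

lemma bounded_measurable_sets_cong:
  "sets M = sets N \<Longrightarrow> bounded_measurable M = bounded_measurable N"
  using sets_eq_imp_space_eq[of M N] by (auto simp: bounded_measurable_def cong: measurable_cong_sets)

lemma (in prob_space) integrable_bounded_measurable:
  assumes "f \<in> bounded_measurable M"
  shows "integrable M f"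
proof -
  obtain C where "f \<in> borel_measurable M" "\<And>z. z \<in> space M \<Longrightarrow> \<bar>f z\<bar> \<le> C"
    using assms by (auto simp: bounded_measurable_def)
  then show ?thesis by (intro integrable_const_bound[of _ C]) auto
qed

lemma (in prob_space) abs_integral_le:
  fixes f :: "'a \<Rightarrow> real"
  assumes "integrable M f" "\<And>z. z \<in> space M \<Longrightarrow> \<bar>f z\<bar> \<le> C"
  shows "\<bar>\<integral>z. f z \<partial>M\<bar> \<le> C"
proof -
  have "\<bar>\<integral>z. f z \<partial>M\<bar> \<le> (\<integral>z. \<bar>f z\<bar> \<partial>M)" by (rule integral_abs_bound)
  also have "\<dots> \<le> (\<integral>z. C \<partial>M)" using assms by (intro integral_mono) auto
  finally show ?thesis by (simp add: prob_space)
qed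

section \<open>The left half and the phase space as measurable spaces\<close>

abbreviation unit_interval :: "real measure" where
  "unit_interval \<equiv> restrict_space lborel {0<..1}"

lemma space_unit_interval [simp]: "space unit_interval = {0<..1}"
  by (simp add: space_restrict_space)

lemma prob_space_unit_interval: "prob_space unit_interval"
  by (rule prob_spaceI) (simp add: emeasure_restrict_space space_restrict_space)

lemma integral_unit_interval_atMost:
  assumes "0 \<le> c" "c \<le> 1"
  shows "(\<integral>y. indicator {..c} y \<partial>unit_interval) = c"
proof -
  have "(\<integral>y. indicator {..c} y \<partial>unit_interval) = measure unit_interval ({..c} \<inter> {0<..1})"
    by simp
  also have "{..c} \<inter> {0<..1} = {0<..c}" using assms by auto
  also have "measure unit_interval {0<..c} = measure lborel {0<..c}"
    using assms by (intro measure_restrict_space) auto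
  finally show ?thesis using assms by simp
qed

text \<open>Symbols times Lebesgue probability on the left half in the coordinate y. The interval is
  open at 0 because y = 0 is the point x = 1 / 2, which belongs to the right half.\<close>

definition base :: "'j pmf \<Rightarrow> ((nat \<Rightarrow> 'j) \<times> real) measure" where
  "base p = bernoulli_measure p \<Otimes>\<^sub>M unit_interval"

text \<open>Serves as the sigma-algebra of the whole space, on which observables live; measures on
  it are introduced separately.\<close>

definition phase :: "'j pmf \<Rightarrow> ((nat \<Rightarrow> 'j) \<times> real) measure" where
  "phase p = bernoulli_measure p \<Otimes>\<^sub>M restrict_space borel {0..1}"

lemma space_base [simp]: "space (base p) = UNIV \<times> {0<..1}"
  by (simp add: base_def space_pair_measure)

lemma space_phase [simp]: "space (phase p) = UNIV \<times> {0..1}"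
  by (simp add: phase_def space_pair_measure space_restrict_space)

lemma prob_space_base: "prob_space (base p)"
proof -
  interpret S: prob_space "bernoulli_measure p" by (rule prob_space_bernoulli)
  interpret U: prob_space unit_interval by (rule prob_space_unit_interval)
  interpret pair_prob_space "bernoulli_measure p" unit_interval by unfold_locales
  show ?thesis unfolding base_def by unfold_locales
qed

lemma measurable_fst_base [measurable]: "fst \<in> measurable (base p) (bernoulli_measure p)"
  by (simp add: base_def)

lemma measurable_snd_base' [measurable]: "snd \<in> measurable (base p) unit_interval"
  by (simp add: base_def)

lemma measurable_unit_interval_borel: "f \<in> borel_measurable borel \<Longrightarrow> f \<in> borel_measurable unit_interval"
  by (rule measurable_restrict_space1) simp

lemma measurable_snd_base [measurable]: "snd \<in> borel_measurable (base p)"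
  using measurable_compose[OF measurable_snd_base' measurable_unit_interval_borel[OF measurable_ident]] by simp

lemma measurable_into_base:
  assumes "(\<lambda>x. fst (f x)) \<in> measurable M (bernoulli_measure p)" "(\<lambda>x. snd (f x)) \<in> borel_measurable M"
    and "\<And>x. x \<in> space M \<Longrightarrow> snd (f x) \<in> {0<..1}"
  shows "f \<in> measurable M (base p)"
proof -
  have "(\<lambda>x. snd (f x)) \<in> measurable M unit_interval"
    using assms by (intro measurable_restrict_space2) auto
  then have "(\<lambda>x. (fst (f x), snd (f x))) \<in> measurable M (base p)"
    unfolding base_def using assms by (intro measurable_Pair)
  then show ?thesis by simp
qed

lemma measurable_fst_phase [measurable]: "fst \<in> measurable (phase p) (bernoulli_measure p)"
  by (simp add: phase_def)

lemma measurable_snd_phase [measurable]: "snd \<in> measurable (phase p) (restrict_space borel {0..1})"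
  by (simp add: phase_def)

lemma measurable_into_phase:
  assumes "(\<lambda>x. fst (f x)) \<in> measurable M (bernoulli_measure p)" "(\<lambda>x. snd (f x)) \<in> borel_measurable M"
    and "\<And>x. x \<in> space M \<Longrightarrow> snd (f x) \<in> {0..1}"
  shows "f \<in> measurable M (phase p)"
proof -
  have "(\<lambda>x. snd (f x)) \<in> measurable M (restrict_space borel {0..1})"
    using assms by (intro measurable_restrict_space2) auto
  then have "(\<lambda>x. (fst (f x), snd (f x))) \<in> measurable M (phase p)"
    unfolding phase_def using assms by (intro measurable_Pair)
  then show ?thesis by simp
qed

context critical_system
begin

lemma measurable_T: "T j \<in> borel_measurable (restrict_space borel {0..1})"
proof -
  have "T j x = (if x < 1 / 2 then
      (if j \<in> bad then 1 / 2 - 2 powr (e j - 1) * (1 / 2 - x) powr e j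
       else 1 - 2 powr e j * (1 / 2 - x) powr e j) else 2 * x - 1)" if "x \<in> {0..1}" for x
    using bad_map_with[of j] good_map_with[of j] that
    by (cases "j \<in> bad") (auto simp: bad_map_with_def good_map_with_def)
  then have "(T j \<in> borel_measurable (restrict_space borel {0..1})) \<longleftrightarrow>
    ((\<lambda>x. if x < 1 / 2 then
      (if j \<in> bad then 1 / 2 - 2 powr (e j - 1) * (1 / 2 - x) powr e j
       else 1 - 2 powr e j * (1 / 2 - x) powr e j) else 2 * x - 1)
      \<in> borel_measurable (restrict_space borel {0..1}))"
    by (intro measurable_cong) (auto simp: space_restrict_space)
  also have "\<dots>" by (intro measurable_restrict_space1) measurable
  finally show ?thesis .
qed

lemma measurable_F [measurable]: "F \<in> measurable (phase p) (phase p)"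
proof (rule measurable_into_phase)
  show "(\<lambda>z. fst (F z)) \<in> measurable (phase p) (bernoulli_measure p)"
    using measurable_compose[OF measurable_fst_phase measurable_shift]
    by (simp add: random_map_def case_prod_unfold)
  have "(\<lambda>z. T (fst z 0) (snd z)) \<in> borel_measurable (phase p)"
  proof (rule measurable_compose_countable)
    show "(\<lambda>z. T j (snd z)) \<in> borel_measurable (phase p)" for j
      by (rule measurable_compose[OF measurable_snd_phase measurable_T])
    show "(\<lambda>z. fst z 0) \<in> measurable (phase p) (count_space UNIV)"
      by measurable
  qed
  then show "(\<lambda>z. snd (F z)) \<in> borel_measurable (phase p)"
    by (simp add: random_map_def case_prod_unfold)
  show "snd (F z) \<in> {0..1}" if "z \<in> space (phase p)" for z
    using that T_range by (auto simp: random_map_def)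
qed

lemma measurable_F_iterate [measurable]: "(F ^^ n) \<in> measurable (phase p) (phase p)"
  by (induction n) (auto intro: measurable_comp measurable_F simp: id_def)

lemma measurable_embed [measurable]: "embed \<in> measurable (base p) (phase p)"
  by (rule measurable_into_phase) (auto simp: embed_def)

lemma measurable_branch:
  assumes "0 < free s"
  shows "branch s \<in> measurable (base p) (base p)"
proof (rule measurable_into_base)
  show "(\<lambda>x. fst (branch s x)) \<in> measurable (base p) (bernoulli_measure p)"
    by (simp add: branch_def)
  show "(\<lambda>x. snd (branch s x)) \<in> borel_measurable (base p)"
    by (simp add: branch_def inv_branch_def)
  show "snd (branch s z) \<in> {0<..1}" if "z \<in> space (base p)" for z
    using that inv_branch_pos[of "snd z" s] inv_branch_le_1[OF assms, of "snd z"]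
    by (auto simp: branch_def)
qed

lemma measurable_jac [measurable]: "(\<lambda>z. jac s (snd z)) \<in> borel_measurable (base p)"
  by (simp add: jac_def)

lemma bounded_measurable_jac: "(\<lambda>z. jac s (snd z)) \<in> bounded_measurable (base p)"
proof (rule bounded_measurableI)
  show "\<bar>jac s (snd z)\<bar> \<le> 1" if "z \<in> space (base p)" for z
    using that jac_pos[of "snd z" s] jac_le_1[of "snd z" s] by auto
qed measurable

lemma measurable_prepend_base [measurable]: "(\<lambda>z. (prepend s (fst z), snd z)) \<in> measurable (base p) (base p)"
  by (rule measurable_into_base) auto

lemma bounded_measurable_iterate:
  "\<phi> \<in> bounded_measurable (phase p) \<Longrightarrow> (\<lambda>z. \<phi> ((F ^^ n) (embed z))) \<in> bounded_measurable (base p)"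
  by (rule bounded_measurable_compose[OF _ measurable_compose[OF measurable_embed measurable_F_iterate]])

lemma inv_branch_substitution:
  fixes G :: "real \<Rightarrow> real"
  assumes G: "G \<in> borel_measurable unit_interval" and C: "\<And>y. y \<in> {0<..1} \<Longrightarrow> \<bar>G y\<bar> \<le> C" and s: "0 < free s"
  shows "(\<integral>y. G y * indicator {cut s<..inv_branch s 1} y \<partial>unit_interval) =
    (\<integral>y. G (inv_branch s y) * jac s y \<partial>unit_interval)"
proof -
  \<comment> \<open>G is measurable on (0, 1] alone; extended by 0 it can be substituted on the
    line. The half-open and closed intervals differ by null sets.\<close>
  define H where "H y = indicator {0<..1} y *\<^sub>R G y" for y
  have H: "H \<in> borel_measurable borel"
    using G unfolding H_def[abs_def] by (subst (asm) borel_measurable_restrict_space_iff) (auto simp: mult.commute)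
  have le: "inv_branch s 0 \<le> inv_branch s 1" by (intro inv_branch_mono) auto
  have sub: "{inv_branch s 0..inv_branch s 1} \<subseteq> {0<..1}"
    using inv_branch_pos[of 0 s] inv_branch_le_1[OF s, of 1] by auto
  have C0: "0 \<le> C" using C[of 1] by auto
  have int: "set_integrable lborel {inv_branch s 0..inv_branch s 1} H"
    unfolding set_integrable_def
  proof (rule Bochner_Integration.integrable_bound[where f = "\<lambda>y. C * indicator {inv_branch s 0..inv_branch s 1} y"])
    show "integrable lborel (\<lambda>y. C * indicator {inv_branch s 0..inv_branch s 1} y)"
      using le by (intro integrable_mult_right) (auto simp: integrable_indicator_iff)
    show "AE y in lborel. norm (indicator {inv_branch s 0..inv_branch s 1} y *\<^sub>R H y) \<le>
        norm (C * indicator {inv_branch s 0..inv_branch s 1} y)"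
      using C sub C0 by (auto simp: H_def indicator_def)
  qed (use H in auto)
  have "(\<integral>y. G y * indicator {cut s<..inv_branch s 1} y \<partial>unit_interval) =
      (\<integral>y. indicator {0<..1} y *\<^sub>R (G y * indicator {cut s<..inv_branch s 1} y) \<partial>lborel)"
    by (subst integral_restrict_space) auto
  also have "\<dots> = (\<integral>y. H y * indicator {inv_branch s 0..inv_branch s 1} y \<partial>lborel)"
  proof (rule integral_cong_AE)
    have "AE y in lborel. y \<noteq> cut s" by (rule AE_lborel_singleton)
    then show "AE y in lborel. indicator {0<..1} y *\<^sub>R (G y * indicator {cut s<..inv_branch s 1} y) =
        H y * indicator {inv_branch s 0..inv_branch s 1} y"
      by eventually_elim (auto simp: H_def inv_branch_0 indicator_def)
    have "(\<lambda>y. indicator {0<..1} y *\<^sub>R (G y * indicator {cut s<..inv_branch s 1} y)) =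
        (\<lambda>y. H y * indicator {cut s<..inv_branch s 1} y)" by (auto simp: H_def)
    then show "(\<lambda>y. indicator {0<..1} y *\<^sub>R (G y * indicator {cut s<..inv_branch s 1} y)) \<in> borel_measurable lborel"
      using H by simp
  qed (use H in simp)
  also have "\<dots> = (\<integral>y. H (inv_branch s y) * jac s y * indicator {0..1} y \<partial>lborel)"
  proof (rule integral_substitution(2)[where g = "inv_branch s" and g' = "jac s", OF int])
    show "continuous_on {0..1} (jac s)" unfolding jac_def using total_exp_pos[of s] by (auto intro!: continuous_intros)
  qed (auto intro: inv_branch_deriv less_imp_le[OF jac_pos])
  also have "\<dots> = (\<integral>y. indicator {0<..1} y *\<^sub>R (G (inv_branch s y) * jac s y) \<partial>lborel)"
  proof (rule integral_cong_AE)
    have "AE y in lborel. y \<noteq> (0::real)" by (rule AE_lborel_singleton)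
    then show "AE y in lborel. H (inv_branch s y) * jac s y * indicator {0..1} y =
        indicator {0<..1} y *\<^sub>R (G (inv_branch s y) * jac s y)"
    proof eventually_elim
      case (elim y)
      then show ?case using inv_branch_pos[of y s] inv_branch_le_1[OF s, of y]
        by (auto simp: H_def indicator_def)
    qed
    have [measurable]: "inv_branch s \<in> borel_measurable borel" "jac s \<in> borel_measurable borel"
      unfolding inv_branch_def[abs_def] jac_def[abs_def] by measurable
    show "(\<lambda>y. H (inv_branch s y) * jac s y * indicator {0..1} y) \<in> borel_measurable lborel"
      using H by measurable
    have "(\<lambda>y. indicator {0<..1} y *\<^sub>R (G (inv_branch s y) * jac s y)) =
        (\<lambda>y. indicator {0<..1} y *\<^sub>R (H (inv_branch s y) * jac s y))"
      using inv_branch_pos[of _ s] inv_branch_le_1[OF s] by (auto simp: H_def indicator_def fun_eq_iff)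
    then show "(\<lambda>y. indicator {0<..1} y *\<^sub>R (G (inv_branch s y) * jac s y)) \<in> borel_measurable lborel"
      using H by simp
  qed
  also have "\<dots> = (\<integral>y. G (inv_branch s y) * jac s y \<partial>unit_interval)"
    by (subst integral_restrict_space) auto
  finally show ?thesis .
qed

text \<open>Applied to a density g, it gives the density, at the moment of return, of the mass whose
  return takes exactly n steps. A return presupposes a good symbol; steps inside the left half under
  bad maps belong to the excursion.\<close>

definition transfer :: "nat \<Rightarrow> ((nat \<Rightarrow> 'j) \<times> real \<Rightarrow> real) \<Rightarrow> (nat \<Rightarrow> 'j) \<times> real \<Rightarrow> real" where
  "transfer n g z = (\<Sum>s\<in>{s \<in> words n. 0 < free s}. word_prob p s * (g (branch s z) * jac s (snd z)))"

text \<open>The part of the integral carried by the points without return within \<open>n\<close> steps.\<close>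

definition survivor :: "nat \<Rightarrow> ((nat \<Rightarrow> 'j) \<times> real \<Rightarrow> real) \<Rightarrow> real" where
  "survivor n g = (\<Sum>s\<in>words n. word_prob p s *
     (\<integral>z. g (prepend s (fst z), snd z) * indicator {..cut s} (snd z) \<partial>base p))"

lemma bounded_measurable_branch_jac:
  assumes "g \<in> bounded_measurable (base p)" "0 < free s"
  shows "(\<lambda>z. g (branch s z) * jac s (snd z)) \<in> bounded_measurable (base p)"
  by (intro bounded_measurable_mult bounded_measurable_jac bounded_measurable_compose[OF assms(1) measurable_branch[OF assms(2)]])

lemma bounded_measurable_prepend_indicator:
  assumes "g \<in> bounded_measurable (base p)" and "A \<in> sets borel"
  shows "(\<lambda>z. g (prepend s (fst z), snd z) * indicator A (snd z)) \<in> bounded_measurable (base p)"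
  by (intro bounded_measurable_mult bounded_measurable_compose[OF assms(1) measurable_prepend_base]
        bounded_measurableI[of "\<lambda>z. indicator A (snd z)" _ 1])
     (use assms(2) in \<open>auto simp: indicator_def\<close>)

lemma bounded_measurable_transfer:
  assumes "g \<in> bounded_measurable (base p)"
  shows "transfer n g \<in> bounded_measurable (base p)"
  unfolding transfer_def[abs_def]
  by (intro bounded_measurable_sum bounded_measurable_mult[OF bounded_measurable_const] bounded_measurable_branch_jac assms) auto

lemma integral_transfer:
  assumes "g \<in> bounded_measurable (base p)"
  shows "(\<integral>z. transfer n g z \<partial>base p) =
    (\<Sum>s\<in>{s \<in> words n. 0 < free s}. word_prob p s * (\<integral>z. g (branch s z) * jac s (snd z) \<partial>base p))"
proof -
  interpret prob_space "base p" by (rule prob_space_base)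
  show ?thesis unfolding transfer_def
    using integrable_bounded_measurable[OF bounded_measurable_branch_jac[OF assms]]
    by (subst Bochner_Integration.integral_sum) auto
qed

lemma survivor_0: "survivor 0 g = (\<integral>z. g z \<partial>base p)"
  by (auto simp: survivor_def cut_def indicator_def intro!: Bochner_Integration.integral_cong)

lemma branch_integral:
  assumes g: "g \<in> bounded_measurable (base p)" and s: "0 < free s"
  shows "(\<integral>z. g (prepend s (fst z), snd z) * indicator {cut s<..inv_branch s 1} (snd z) \<partial>base p) =
    (\<integral>z. g (branch s z) * jac s (snd z) \<partial>base p)"
proof -
  interpret S: prob_space "bernoulli_measure p" by (rule prob_space_bernoulli)
  interpret U: prob_space unit_interval by (rule prob_space_unit_interval)
  interpret pair: pair_prob_space "bernoulli_measure p" unit_interval by unfold_locales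
  interpret B: prob_space "base p" by (rule prob_space_base)
  obtain C where C: "\<And>z. z \<in> space (base p) \<Longrightarrow> \<bar>g z\<bar> \<le> C" using g by (auto simp: bounded_measurable_def)
  have int1: "integrable (bernoulli_measure p \<Otimes>\<^sub>M unit_interval)
      (\<lambda>z. g (prepend s (fst z), snd z) * indicator {cut s<..inv_branch s 1} (snd z))"
    using B.integrable_bounded_measurable[OF bounded_measurable_prepend_indicator[OF g, of "{cut s<..inv_branch s 1}"]]
    by (simp add: base_def)
  have int2: "integrable (bernoulli_measure p \<Otimes>\<^sub>M unit_interval) (\<lambda>z. g (branch s z) * jac s (snd z))"
    using B.integrable_bounded_measurable[OF bounded_measurable_branch_jac[OF g s]]
    by (simp add: base_def)
  have "(\<integral>y. g (prepend s \<omega>, y) * indicator {cut s<..inv_branch s 1} y \<partial>unit_interval) =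
      (\<integral>y. g (branch s (\<omega>, y)) * jac s y \<partial>unit_interval)" for \<omega>
  proof -
    have "(\<lambda>y. g (prepend s \<omega>, y)) \<in> borel_measurable unit_interval"
      using bounded_measurable_measurable[OF g] unfolding base_def
      by (rule measurable_compose[rotated]) (auto intro!: measurable_Pair)
    then show ?thesis
      using inv_branch_substitution[of "\<lambda>y. g (prepend s \<omega>, y)" C s] C s by (simp add: branch_def)
  qed
  then show ?thesis unfolding base_def
    using pair.integral_fst'[OF int1] pair.integral_fst'[OF int2] by simp
qed

text \<open>Among the survivors of a word, one more symbol lets exactly those above the new cut
  return.\<close>

lemma survivor_Suc:
  assumes g: "g \<in> bounded_measurable (base p)"
  shows "survivor n g = (\<integral>z. transfer (Suc n) g z \<partial>base p) + survivor (Suc n) g"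
proof -
  interpret B: prob_space "base p" by (rule prob_space_base)
  have split: "(\<integral>z. g (prepend (s @ [j]) (fst z), snd z) * indicator {..cut s} (snd z) \<partial>base p) =
     (if 0 < free (s @ [j]) then \<integral>z. g (branch (s @ [j]) z) * jac (s @ [j]) (snd z) \<partial>base p else 0) +
     (\<integral>z. g (prepend (s @ [j]) (fst z), snd z) * indicator {..cut (s @ [j])} (snd z) \<partial>base p)" for s j
  proof (cases "0 < free (s @ [j])")
    case True
    let ?t = "s @ [j]"
    \<comment> \<open>The branch of s @ [j] occupies the upper part of the survivors of s, from the
      new cut up to \<open>cut s\<close>. If j is the first good symbol, both \<open>cut s\<close>
      and the upper end are 1.\<close>
    have top: "inv_branch ?t 1 = cut s"
      using True by (cases "0 < free s") (auto simp: inv_branch_1 cut_def free_snoc total_exp_append)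
    have "cut ?t \<le> cut s"
      using inv_branch_mono[of 0 1 ?t] top by (simp add: inv_branch_0)
    then have "indicator {..cut s} y = (indicator {cut ?t<..cut s} y + indicator {..cut ?t} y :: real)" for y
      by (auto simp: indicator_def)
    then have "(\<integral>z. g (prepend ?t (fst z), snd z) * indicator {..cut s} (snd z) \<partial>base p) =
        (\<integral>z. g (prepend ?t (fst z), snd z) * indicator {cut ?t<..cut s} (snd z) +
             g (prepend ?t (fst z), snd z) * indicator {..cut ?t} (snd z) \<partial>base p)"
      by (simp add: distrib_left)
    also have "\<dots> = (\<integral>z. g (prepend ?t (fst z), snd z) * indicator {cut ?t<..cut s} (snd z) \<partial>base p) +
         (\<integral>z. g (prepend ?t (fst z), snd z) * indicator {..cut ?t} (snd z) \<partial>base p)"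
      by (intro Bochner_Integration.integral_add B.integrable_bounded_measurable bounded_measurable_prepend_indicator g) auto
    also have "(\<integral>z. g (prepend ?t (fst z), snd z) * indicator {cut ?t<..cut s} (snd z) \<partial>base p) =
        (\<integral>z. g (branch ?t z) * jac ?t (snd z) \<partial>base p)"
      using branch_integral[OF g True] by (simp only: top)
    finally show ?thesis using True by simp
  next
    case False
    then have "cut (s @ [j]) = cut s" by (auto simp: cut_def free_snoc split: if_splits)
    then show ?thesis using False by simp
  qed
  \<comment> \<open>The symbol following s is drawn as the first symbol of the remaining
    sequence.\<close>
  have "survivor n g = (\<Sum>s\<in>words n. word_prob p s * (\<Sum>j\<in>UNIV. pmf p j *
      (\<integral>z. g (prepend (s @ [j]) (fst z), snd z) * indicator {..cut s} (snd z) \<partial>base p)))"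
  proof -
    have "(\<integral>z. g (prepend s (fst z), snd z) * indicator {..cut s} (snd z) \<partial>base p) =
       (\<Sum>j\<in>UNIV. pmf p j * (\<integral>z. g (prepend (s @ [j]) (fst z), snd z) * indicator {..cut s} (snd z) \<partial>base p))" for s
    proof -
      have bm: "(\<lambda>z. g (prepend s (fst z), snd z) * indicator {..cut s} (snd z)) \<in> bounded_measurable (base p)"
        by (rule bounded_measurable_prepend_indicator[OF g]) auto
      then obtain C where "\<And>z. z \<in> space (base p) \<Longrightarrow> \<bar>g (prepend s (fst z), snd z) * indicator {..cut s} (snd z)\<bar> \<le> C"
        unfolding bounded_measurable_def by blast
      then show ?thesis
        using integral_bernoulli_pair_cons[OF prob_space_unit_interval, of "\<lambda>z. g (prepend s (fst z), snd z) * indicator {..cut s} (snd z)" p C]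
          bounded_measurable_measurable[OF bm] by (simp add: base_def prepend_append)
    qed
    then show ?thesis unfolding survivor_def by simp
  qed
  also have "\<dots> = (\<Sum>t\<in>words (Suc n). word_prob p t *
      ((if 0 < free t then \<integral>z. g (branch t z) * jac t (snd z) \<partial>base p else 0) +
     (\<integral>z. g (prepend t (fst z), snd z) * indicator {..cut t} (snd z) \<partial>base p)))"
    unfolding split sum_words_snoc by (simp add: sum_distrib_left mult.assoc)
  also have "\<dots> = (\<integral>z. transfer (Suc n) g z \<partial>base p) + survivor (Suc n) g"
    unfolding integral_transfer[OF g] survivor_def
    unfolding distrib_left sum.distrib by (simp add: sum.inter_filter[symmetric] if_distrib[of "(*) _"] cong: if_cong)
  finally show ?thesis .
qed

lemma survivor_decomposition:
  assumes g: "g \<in> bounded_measurable (base p)" and "m \<le> n"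
  shows "survivor m g = (\<Sum>i\<in>{m<..n}. \<integral>z. transfer i g z \<partial>base p) + survivor n g"
  using assms(2)
proof (induction n rule: dec_induct)
  case (step n)
  have "{m<..Suc n} = insert (Suc n) {m<..n}" using step by auto
  then show ?case using step survivor_Suc[OF g, of n] by simp
qed simp

text \<open>By duality, the integral of \<phi> against the image after n steps of the measure with
  density g on the left half; \<open>excursion\<close> is the contribution of points that have not
  returned by time n.\<close>

definition pairing :: "((nat \<Rightarrow> 'j) \<times> real \<Rightarrow> real) \<Rightarrow> nat \<Rightarrow> ((nat \<Rightarrow> 'j) \<times> real \<Rightarrow> real) \<Rightarrow> real" where
  "pairing \<phi> n g = (\<integral>z. \<phi> ((F ^^ n) (embed z)) * g z \<partial>base p)"

definition excursion :: "((nat \<Rightarrow> 'j) \<times> real \<Rightarrow> real) \<Rightarrow> nat \<Rightarrow> ((nat \<Rightarrow> 'j) \<times> real \<Rightarrow> real) \<Rightarrow> real" where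
  "excursion \<phi> n g = survivor n (\<lambda>z. \<phi> ((F ^^ n) (embed z)) * g z)"

lemma iterate_branch':
  assumes "0 < free s" "z \<in> space (base p)" "length s \<le> n"
  shows "(F ^^ n) (embed (branch s z)) = (F ^^ (n - length s)) (embed z)"
proof -
  have "(F ^^ n) (embed (branch s z)) = (F ^^ (n - length s)) ((F ^^ length s) (embed (branch s z)))"
    using funpow_add[of "n - length s" "length s" F] assms(3) by simp
  then show ?thesis using iterate_branch[OF assms(1), of "snd z" "fst z"] assms(2) by auto
qed

text \<open>Splits the mass by the time of its first return. At the end of a branch of length i the
  orbit restarts on the base, and n - i steps are left.\<close>

lemma pairing_renewal:
  assumes \<phi>: "\<phi> \<in> bounded_measurable (phase p)" and g: "g \<in> bounded_measurable (base p)"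
  shows "pairing \<phi> n g = (\<Sum>m<n. pairing \<phi> m (transfer (n - m) g)) + excursion \<phi> n g"
proof -
  let ?G = "\<lambda>z. \<phi> ((F ^^ n) (embed z)) * g z"
  have G: "?G \<in> bounded_measurable (base p)"
    by (intro bounded_measurable_mult bounded_measurable_iterate \<phi> g)
  have "pairing \<phi> n g = survivor 0 ?G" by (simp add: survivor_0 pairing_def)
  also have "\<dots> = (\<Sum>i\<in>{0<..n}. \<integral>z. transfer i ?G z \<partial>base p) + survivor n ?G"
    by (rule survivor_decomposition[OF G]) simp
  also have "(\<Sum>i\<in>{0<..n}. \<integral>z. transfer i ?G z \<partial>base p) = (\<Sum>i\<in>{0<..n}. pairing \<phi> (n - i) (transfer i g))"
  proof (intro sum.cong refl)
    fix i assume i: "i \<in> {0<..n}"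
    show "(\<integral>z. transfer i ?G z \<partial>base p) = pairing \<phi> (n - i) (transfer i g)"
      unfolding pairing_def
    proof (intro Bochner_Integration.integral_cong refl)
      fix z assume z: "z \<in> space (base p)"
      then show "transfer i ?G z = \<phi> ((F ^^ (n - i)) (embed z)) * transfer i g z"
        unfolding transfer_def sum_distrib_left using i
        by (intro sum.cong refl) (auto simp: iterate_branch' words_def)
    qed
  qed
  also have "\<dots> = (\<Sum>m<n. pairing \<phi> m (transfer (n - m) g))"
    by (rule sum.reindex_bij_witness[of _ "\<lambda>m. n - m" "\<lambda>i. n - i"]) auto
  finally show ?thesis by (simp add: excursion_def)
qed

end

section \<open>Return times and cones of densities\<close>

lemma two_powr_minus_le:
  fixes x s :: real
  assumes "0 < x" "0 < s"
  shows "2 powr - x \<le> (s / ln 2) powr s * x powr - s"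
proof -
  \<comment> \<open>An exponential beats any power: u \<le> exp u at u = x * ln 2 / s, raised to the
    power s.\<close>
  have "x * ln 2 / s \<le> exp (x * ln 2 / s)" using exp_ge_add_one_self[of "x * ln 2 / s"] by linarith
  then have "(x * ln 2 / s) powr s \<le> exp (x * ln 2 / s) powr s"
    using assms by (intro powr_mono2) auto
  also have "\<dots> = 2 powr x" using assms by (simp add: exp_powr_real powr_def)
  finally have "(x * ln 2 / s) powr s \<le> 2 powr x" .
  moreover have "(x * ln 2 / s) powr s = x powr s / (s / ln 2) powr s"
    using assms by (simp add: powr_divide powr_mult)
  ultimately show ?thesis using assms
    by (simp add: powr_minus field_simps)
qed

lemma powr_minus_scale:
  fixes a b c s :: real
  assumes "0 < a" "0 < b" "0 < c" "0 \<le> s" "c \<le> a * b"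
  shows "b powr - s \<le> a powr s * c powr - s"
proof -
  have "a powr - s * b powr - s = (a * b) powr - s" by (simp only: powr_mult)
  also have "\<dots> \<le> c powr - s" using assms by (intro powr_mono2') auto
  finally have "a powr s * (a powr - s * b powr - s) \<le> a powr s * c powr - s"
    by (intro mult_left_mono) auto
  moreover have "a powr s * a powr - s = 1" using assms by (simp flip: powr_add)
  ultimately show ?thesis by (simp flip: mult.assoc)
qed

text \<open>Here \<alpha> is a Hoelder exponent and \<beta> will be - \<gamma>. The moment condition
  says that a bad step shrinks the moment of order 1 + \<beta> of the accumulated exponent, weighted
  by probability.\<close>

locale polynomial_system = critical_system +
  fixes \<alpha> \<beta> :: real
  assumes \<alpha>: "0 < \<alpha>" "\<alpha> < 1" and \<beta>: "0 < \<beta>"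
    and moment: "(\<Sum>j\<in>bad. pmf p j * e j powr (1 + \<beta>)) < 1"
    and good_exists: "\<exists>j. j \<notin> bad \<and> 0 < pmf p j"
begin

definition tail :: "nat \<Rightarrow> real" where
  "tail n = (\<Sum>s\<in>words n. word_prob p s * cut s)"

text \<open>The moment argument takes the form of an induction over words. Passing to
  \<open>t r n\<close>, with exponents multiplied by r, closes the recursion: a bad first symbol
  replaces r by r * e j, and the ansatz \<open>A * r powr s * (n + K) powr - s\<close>, with s = 1 +
  \<beta>, reproduces the moment sum as a factor.\<close>

lemma tail_bound:
  obtains A where "0 < A" "\<And>n. tail n \<le> A * (real n + 1) powr - (1 + \<beta>)"
proof -
  let ?s = "1 + \<beta>"
  define t where "t r n = (\<Sum>s\<in>words n. word_prob p s * 2 powr - (real (free s) / (r * total_exp s)))" for r n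
  define x where "x = (\<Sum>j\<in>bad. pmf p j * e j powr ?s)"
  define y where "y = (1 + x) / 2"
  have xy: "x < y" "y < 1" using moment by (auto simp: x_def y_def)
  \<comment> \<open>K absorbs the step from n to n + 1, which costs at most (1 + 1 / K) powr s; the
    moment sum x leaves room for this below y < 1.\<close>
  have "((\<lambda>K. (1 + 1 / K) powr ?s * x) \<longlongrightarrow> (1 + 0) powr ?s * x) at_top"
    by (intro tendsto_intros tendsto_divide_0[OF tendsto_const] filterlim_at_top_imp_at_infinity filterlim_ident) auto
  then have "eventually (\<lambda>K. (1 + 1 / K) powr ?s * x < y) at_top"
    using xy by (intro order_tendstoD(2)) auto
  then have "eventually (\<lambda>K. (1 + 1 / K) powr ?s * x < y \<and> 1 \<le> K) at_top"
    by (intro eventually_conj eventually_ge_at_top)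
  then obtain K where K: "(1 + 1 / K) powr ?s * x < y" "1 \<le> K"
    by (auto simp: eventually_at_top_linorder)
  define G where "G = (\<Sum>j\<in>-bad. pmf p j * ((?s / ln 2) powr ?s * e j powr ?s * (K + 1) powr ?s))"
  have G: "0 \<le> G" unfolding G_def by (intro sum_nonneg) auto
  \<comment> \<open>The first entry serves n = 0; the second gives A * y + G \<le> A, where G
    collects the words that begin with a good symbol.\<close>
  define A where "A = max (K powr ?s) (G / (1 - y))"
  have A: "K powr ?s \<le> A" "G / (1 - y) \<le> A" by (auto simp: A_def)
  then have A0: "0 < A" using K by (smt (verit) powr_gt_zero)
  have t: "t r n \<le> A * r powr ?s * (real n + K) powr - ?s" if "1 \<le> r" for r n
    using that
  proof (induction n arbitrary: r)
    case 0
    have "1 = K powr ?s * 1 * K powr - ?s" using K by (simp flip: powr_add)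
    also have "\<dots> \<le> A * r powr ?s * K powr - ?s"
      using A A0 0 \<beta> by (intro mult_mono ge_one_powr_ge_zero) auto
    finally show ?case by (simp add: t_def)
  next
    case (Suc n)
    let ?N = "real (Suc n) + K"
    have bad: "t (r * e j) n \<le> A * r powr ?s * e j powr ?s * ((1 + 1 / K) powr ?s * ?N powr - ?s)" for j
    proof -
      have "1 \<le> r * e j" using mult_mono[of 1 r 1 "e j"] Suc.prems e_ge_1[of j] by auto
      then have "t (r * e j) n \<le> A * (r * e j) powr ?s * (real n + K) powr - ?s" by (rule Suc.IH)
      also have "(r * e j) powr ?s = r powr ?s * e j powr ?s" by (rule powr_mult)
      also have "(real n + K) powr - ?s \<le> (1 + 1 / K) powr ?s * ?N powr - ?s"
      proof -
        have "?N \<le> (1 + 1 / K) * (real n + K)" using K by (simp add: field_simps)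
        then show ?thesis using K \<beta> by (intro powr_minus_scale) (auto intro: add_pos_pos)
      qed
      finally show ?thesis using A0 by (simp add: mult.assoc mult_left_mono)
    qed
    have good: "2 powr - (real (Suc n) / (r * e j)) \<le>
        r powr ?s * ((?s / ln 2) powr ?s * e j powr ?s * (K + 1) powr ?s) * ?N powr - ?s" for j
    proof -
      have "2 powr - (real (Suc n) / (r * e j)) \<le> (?s / ln 2) powr ?s * (real (Suc n) / (r * e j)) powr - ?s"
        using \<beta> Suc.prems e_pos[of j] by (intro two_powr_minus_le) auto
      also have "(real (Suc n) / (r * e j)) powr - ?s = real (Suc n) powr - ?s * (r powr ?s * e j powr ?s)"
      proof -
        have "(real (Suc n) / (r * e j)) powr - ?s = real (Suc n) powr - ?s / (r * e j) powr - ?s"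
          by (rule powr_divide)
        also have "\<dots> = real (Suc n) powr - ?s * (r * e j) powr ?s"
          by (simp only: powr_minus_divide[of "r * e j"]) simp
        finally show ?thesis by (simp only: powr_mult)
      qed
      also have "(?s / ln 2) powr ?s * \<dots> \<le>
          (?s / ln 2) powr ?s * ((K + 1) powr ?s * ?N powr - ?s * (r powr ?s * e j powr ?s))"
      proof (intro mult_left_mono mult_right_mono)
        have "?N \<le> (K + 1) * real (Suc n)" using K mult_left_mono[of 1 "real (Suc n)" K] by (simp add: distrib_right)
        then show "real (Suc n) powr - ?s \<le> (K + 1) powr ?s * ?N powr - ?s"
          using K \<beta> by (intro powr_minus_scale) auto
      qed auto
      finally show ?thesis by (simp add: mult_ac)
    qed
    have "t r (Suc n) = (\<Sum>j\<in>UNIV. pmf p j * (if j \<in> bad then t (r * e j) n else 2 powr - (real (Suc n) / (r * e j))))"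
    proof -
      have "(\<Sum>s\<in>words n. word_prob p (j # s) * 2 powr - (real (free (j # s)) / (r * total_exp (j # s)))) =
         pmf p j * (if j \<in> bad then t (r * e j) n else 2 powr - (real (Suc n) / (r * e j)))" for j
      proof (cases "j \<in> bad")
        case True
        then show ?thesis by (simp add: t_def sum_distrib_left mult.assoc)
      next
        case False
        have "(\<Sum>s\<in>words n. word_prob p (j # s) * 2 powr - (real (free (j # s)) / (r * total_exp (j # s)))) =
            (\<Sum>s\<in>words n. word_prob p s * (pmf p j * 2 powr - (real (Suc n) / (r * e j))))"
          using False by (intro sum.cong) (auto simp: words_def)
        also have "\<dots> = pmf p j * 2 powr - (real (Suc n) / (r * e j))"
          by (simp add: sum_word_prob flip: sum_distrib_right)
        finally show ?thesis using False by simp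
      qed
      then show ?thesis unfolding t_def by (simp only: sum_words_Cons)
    qed
    also have "\<dots> = (\<Sum>j\<in>bad. pmf p j * t (r * e j) n) + (\<Sum>j\<in>-bad. pmf p j * 2 powr - (real (Suc n) / (r * e j)))"
    proof -
      have "sum f UNIV = sum f bad + sum f (- bad)" for f :: "'a \<Rightarrow> real"
        using sum.subset_diff[of bad UNIV f] by (simp add: Compl_eq_Diff_UNIV add.commute)
      then show ?thesis by simp
    qed
    also have "\<dots> \<le> (\<Sum>j\<in>bad. pmf p j * (A * r powr ?s * e j powr ?s * ((1 + 1 / K) powr ?s * ?N powr - ?s))) +
       (\<Sum>j\<in>-bad. pmf p j * (r powr ?s * ((?s / ln 2) powr ?s * e j powr ?s * (K + 1) powr ?s) * ?N powr - ?s))"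
      by (intro add_mono sum_mono mult_left_mono bad good) auto
    also have "\<dots> = (A * ((1 + 1 / K) powr ?s * x) + G) * r powr ?s * ?N powr - ?s"
      unfolding x_def G_def
      by (simp only: sum_distrib_left sum_distrib_right distrib_right) (simp only: mult_ac)
    also have "\<dots> \<le> A * r powr ?s * ?N powr - ?s"
    proof (intro mult_right_mono)
      have "A * ((1 + 1 / K) powr ?s * x) \<le> A * y" using K A0 by (intro mult_left_mono) auto
      moreover have "G \<le> A * (1 - y)" using A(2) xy by (simp add: pos_divide_le_eq)
      ultimately show "A * ((1 + 1 / K) powr ?s * x) + G \<le> A" by (simp add: right_diff_distrib)
    qed auto
    finally show ?case .
  qed
  show thesis
  proof (rule that[OF A0])
    fix n
    have "tail n = t 1 n" by (simp add: tail_def t_def cut_def)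
    also have "\<dots> \<le> A * (real n + K) powr - ?s" using t[of 1 n] by simp
    also have "\<dots> \<le> A * (real n + 1) powr - ?s"
      using K A0 \<beta> by (intro mult_left_mono powr_mono2') auto
    finally show "tail n \<le> A * (real n + 1) powr - ?s" .
  qed
qed

text \<open>A good symbol has positive probability and returns some points after a single step, so a
  fixed fraction of the mass comes back at once.\<close>

lemma tail_1_less_1: "tail 1 < 1"
proof -
  obtain g where g: "g \<notin> bad" "0 < pmf p g" using good_exists by auto
  have "tail 1 = (\<Sum>j\<in>UNIV. pmf p j * cut [j])"
    unfolding tail_def One_nat_def sum_words_Cons by simp
  also have "\<dots> < (\<Sum>j\<in>UNIV. pmf p j * 1)"
  proof (rule sum_strict_mono_ex1)
    show "\<forall>j\<in>UNIV. pmf p j * cut [j] \<le> pmf p j * 1" by (intro ballI mult_left_mono cut_le_1) simp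
    have "cut [g] < 1" using g e_pos[of g] by (simp add: cut_def powr_minus_divide)
    then show "\<exists>j\<in>UNIV. pmf p j * cut [j] < pmf p j * 1" using g by (intro bexI[of _ g]) auto
  qed simp
  finally show ?thesis by (simp add: sum_pmf_eq_1)
qed

section \<open>Cones of log-Hoelder densities\<close>

definition hdist :: "(nat \<Rightarrow> 'a) \<times> real \<Rightarrow> (nat \<Rightarrow> 'a) \<times> real \<Rightarrow> real" where
  "hdist z z' = skew_dist z z' powr \<alpha>"

lemma skew_dist_nonneg [simp]: "0 \<le> skew_dist z z'"
  by (simp add: skew_dist_def case_prod_unfold)

lemma hdist_nonneg [simp]: "0 \<le> hdist z z'" by (simp add: hdist_def)

lemma hdist_mono: "skew_dist z z' \<le> skew_dist w w' \<Longrightarrow> hdist z z' \<le> hdist w w'"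
  unfolding hdist_def using \<alpha> by (intro powr_mono2) auto

lemma hdist_le_2:
  assumes "z \<in> space (base p)" "z' \<in> space (base p)"
  shows "hdist z z' \<le> 2"
proof -
  have "skew_dist z z' \<le> 2"
    using assms seq_dist_le_half[of "fst z" "fst z'"] by (auto simp: skew_dist_def case_prod_unfold)
  then have "hdist z z' \<le> 2 powr \<alpha>" unfolding hdist_def using \<alpha> by (intro powr_mono2) auto
  also have "\<dots> \<le> 2 powr 1" using \<alpha> by (intro powr_mono) auto
  finally show ?thesis by simp
qed

lemma abs_diff_le_hdist:
  assumes "z \<in> space (base p)" "z' \<in> space (base p)"
  shows "\<bar>snd z - snd z'\<bar> \<le> hdist z z'"
proof -
  have "\<bar>snd z - snd z'\<bar> \<le> 1" using assms by auto
  then have "\<bar>snd z - snd z'\<bar> powr 1 \<le> \<bar>snd z - snd z'\<bar> powr \<alpha>" using \<alpha> by (intro powr_mono') auto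
  also have "\<dots> \<le> hdist z z'" unfolding hdist_def using \<alpha>
    by (intro powr_mono2) (auto simp: skew_dist_def case_prod_unfold)
  finally show ?thesis by simp
qed

lemma hdist_branch:
  assumes "0 < free s" "z \<in> space (base p)" "z' \<in> space (base p)"
  shows "hdist (branch s z) (branch s z') \<le> (1 / 2) powr \<alpha> * hdist z z'"
proof -
  have "hdist (branch s z) (branch s z') \<le> (1 / 2 * skew_dist z z') powr \<alpha>"
    unfolding hdist_def using branch_contraction[OF assms(1), of z z'] assms \<alpha>
    by (intro powr_mono2) auto
  also have "\<dots> = (1 / 2) powr \<alpha> * hdist z z'" unfolding hdist_def by (rule powr_mult)
  finally show ?thesis .
qed

definition cone :: "real \<Rightarrow> ((nat \<Rightarrow> 'a) \<times> real \<Rightarrow> real) set" where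
  "cone D = {g \<in> borel_measurable (base p). (\<forall>z\<in>space (base p). 0 \<le> g z) \<and>
     (\<forall>z\<in>space (base p). \<forall>z'\<in>space (base p). g z \<le> exp (D * hdist z z') * g z')}"

abbreviation mass :: "((nat \<Rightarrow> 'a) \<times> real \<Rightarrow> real) \<Rightarrow> real" where
  "mass g \<equiv> (\<integral>z. g z \<partial>base p)"

lemma coneI:
  assumes "g \<in> borel_measurable (base p)" "\<And>z. z \<in> space (base p) \<Longrightarrow> 0 \<le> g z"
    and "\<And>z z'. z \<in> space (base p) \<Longrightarrow> z' \<in> space (base p) \<Longrightarrow> g z \<le> exp (D * hdist z z') * g z'"
  shows "g \<in> cone D"
  using assms unfolding cone_def by blast

lemma cone_measurable: "g \<in> cone D \<Longrightarrow> g \<in> borel_measurable (base p)"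
  and cone_nonneg: "g \<in> cone D \<Longrightarrow> z \<in> space (base p) \<Longrightarrow> 0 \<le> g z"
  and cone_hdist: "g \<in> cone D \<Longrightarrow> z \<in> space (base p) \<Longrightarrow> z' \<in> space (base p) \<Longrightarrow> g z \<le> exp (D * hdist z z') * g z'"
  unfolding cone_def by blast+

lemma cone_mono:
  assumes "D \<le> D'" "g \<in> cone D"
  shows "g \<in> cone D'"
proof (rule coneI)
  fix z z' assume z: "z \<in> space (base p)" "z' \<in> space (base p)"
  have "g z \<le> exp (D * hdist z z') * g z'" by (rule cone_hdist[OF assms(2) z])
  also have "\<dots> \<le> exp (D' * hdist z z') * g z'"
    using assms(1) cone_nonneg[OF assms(2) z(2)] by (intro mult_right_mono) (auto intro: mult_right_mono)
  finally show "g z \<le> exp (D' * hdist z z') * g z'" .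
qed (use cone_measurable[OF assms(2)] cone_nonneg[OF assms(2)] in auto)

lemma cone_le:
  assumes "0 \<le> D" "g \<in> cone D" "z \<in> space (base p)" "z' \<in> space (base p)"
  shows "g z \<le> exp (2 * D) * g z'"
proof -
  have "g z \<le> exp (D * hdist z z') * g z'" by (rule cone_hdist[OF assms(2-4)])
  also have "\<dots> \<le> exp (2 * D) * g z'"
    using hdist_le_2[OF assms(3,4)] assms(1) cone_nonneg[OF assms(2,4)] mult_left_mono[of "hdist z z'" 2 D]
    by (intro mult_right_mono) auto
  finally show ?thesis .
qed

lemma base_point: "(undefined, 1) \<in> space (base p)" by simp

lemma cone_bounded_measurable:
  assumes "0 \<le> D" "g \<in> cone D"
  shows "g \<in> bounded_measurable (base p)"
  using cone_le[OF assms _ base_point] cone_nonneg[OF assms(2)] cone_measurable[OF assms(2)]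
  by (intro bounded_measurableI) auto

lemma cone_const: "0 \<le> c \<Longrightarrow> 0 \<le> D \<Longrightarrow> (\<lambda>_. c) \<in> cone D"
  by (rule coneI) (auto intro!: mult_left_le_one_le simp: mult_le_cancel_right1)

lemma cone_mult:
  assumes "g \<in> cone D" "h \<in> cone D'"
  shows "(\<lambda>z. g z * h z) \<in> cone (D + D')"
proof (rule coneI)
  fix z z' assume z: "z \<in> space (base p)" "z' \<in> space (base p)"
  have "g z * h z \<le> (exp (D * hdist z z') * g z') * (exp (D' * hdist z z') * h z')"
    using z cone_nonneg assms by (intro mult_mono cone_hdist) auto
  then show "g z * h z \<le> exp ((D + D') * hdist z z') * (g z' * h z')"
    by (simp add: distrib_right exp_add mult_ac)
qed (use cone_measurable cone_nonneg assms in auto)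

lemma cone_scale:
  assumes "0 \<le> c" "g \<in> cone D"
  shows "(\<lambda>z. c * g z) \<in> cone D"
  using cone_mult[OF cone_const[OF assms(1), of 0] assms(2)] by simp

lemma cone_sum:
  assumes "\<And>i. i \<in> I \<Longrightarrow> g i \<in> cone D" "0 \<le> D"
  shows "(\<lambda>z. \<Sum>i\<in>I. g i z) \<in> cone D"
proof (rule coneI)
  fix z z' assume z: "z \<in> space (base p)" "z' \<in> space (base p)"
  show "(\<Sum>i\<in>I. g i z) \<le> exp (D * hdist z z') * (\<Sum>i\<in>I. g i z')"
    unfolding sum_distrib_left using z by (intro sum_mono cone_hdist assms)
next
  show "0 \<le> (\<Sum>i\<in>I. g i z)" if "z \<in> space (base p)" for z
    using cone_nonneg[OF assms(1) that] by (rule sum_nonneg)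
qed (use cone_measurable[OF assms(1)] in simp)

lemma integrable_cone: "0 \<le> D \<Longrightarrow> g \<in> cone D \<Longrightarrow> integrable (base p) g"
  using prob_space.integrable_bounded_measurable[OF prob_space_base cone_bounded_measurable] .

lemma mass_nonneg: "g \<in> cone D \<Longrightarrow> 0 \<le> mass g"
  using cone_nonneg by (intro Bochner_Integration.integral_nonneg) auto

lemma cone_le_mass:
  assumes "0 \<le> D" "g \<in> cone D" "z \<in> space (base p)"
  shows "g z \<le> exp (2 * D) * mass g"
proof -
  interpret prob_space "base p" by (rule prob_space_base)
  have "g z * exp (- (2 * D)) \<le> g z'" if "z' \<in> space (base p)" for z'
    using cone_le[OF assms that] by (simp add: exp_minus field_simps)
  then have "(\<integral>z'. g z * exp (- (2 * D)) \<partial>base p) \<le> mass g"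
    by (intro integral_mono integrable_cone[OF assms(1,2)]) auto
  then show ?thesis by (simp add: prob_space[simplified] exp_minus field_simps)
qed

lemma mass_le_cone:
  assumes "0 \<le> D" "g \<in> cone D" "z \<in> space (base p)"
  shows "exp (- (2 * D)) * mass g \<le> g z"
proof -
  interpret prob_space "base p" by (rule prob_space_base)
  have "mass g \<le> (\<integral>z'. exp (2 * D) * g z \<partial>base p)"
    using assms cone_le[OF assms(1,2) _ assms(3)] by (intro integral_mono integrable_cone[OF assms(1,2)]) auto
  then show ?thesis by (simp add: prob_space[simplified] exp_minus field_simps)
qed

lemma jac_cone: "(\<lambda>z. jac s (snd z)) \<in> cone 1"
proof (rule coneI)
  fix z z' assume z: "z \<in> space (base p)" "z' \<in> space (base p)"
  have "jac s (snd z) \<le> exp \<bar>snd z - snd z'\<bar> * jac s (snd z')" using z by (intro jac_distortion) auto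
  also have "\<dots> \<le> exp (1 * hdist z z') * jac s (snd z')"
    using z abs_diff_le_hdist[OF z] jac_pos[of "snd z'" s] by (intro mult_right_mono) auto
  finally show "jac s (snd z) \<le> exp (1 * hdist z z') * jac s (snd z')" .
qed (use jac_pos in \<open>auto intro: less_imp_le\<close>)

text \<open>Contraction of the branches by 1 / 2 scales the Hoelder constant by (1 / 2) powr
  \<alpha>, and the distortion of the Jacobian adds 1.\<close>

lemma branch_cone:
  assumes "0 \<le> D" "g \<in> cone D" "0 < free s"
  shows "(\<lambda>z. g (branch s z) * jac s (snd z)) \<in> cone ((1 / 2) powr \<alpha> * D + 1)"
proof (rule cone_mult[OF _ jac_cone], rule coneI)
  have b: "branch s z \<in> space (base p)" if "z \<in> space (base p)" for z
    using measurable_branch[OF assms(3)] that by (rule measurable_space)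
  show "(\<lambda>z. g (branch s z)) \<in> borel_measurable (base p)"
    using measurable_branch[OF assms(3)] cone_measurable[OF assms(2)] by (rule measurable_compose)
  show "0 \<le> g (branch s z)" if "z \<in> space (base p)" for z
    using cone_nonneg[OF assms(2) b[OF that]] .
  fix z z' assume z: "z \<in> space (base p)" "z' \<in> space (base p)"
  have "g (branch s z) \<le> exp (D * hdist (branch s z) (branch s z')) * g (branch s z')"
    by (intro cone_hdist[OF assms(2)] b z)
  also have "\<dots> \<le> exp ((1 / 2) powr \<alpha> * D * hdist z z') * g (branch s z')"
    using mult_left_mono[OF hdist_branch[OF assms(3) z] assms(1)] cone_nonneg[OF assms(2) b[OF z(2)]]
    by (intro mult_right_mono) (auto simp: mult_ac)
  finally show "g (branch s z) \<le> exp ((1 / 2) powr \<alpha> * D * hdist z z') * g (branch s z')" .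
qed

lemma transfer_cone:
  assumes "0 \<le> D" "g \<in> cone D"
  shows "transfer n g \<in> cone ((1 / 2) powr \<alpha> * D + 1)"
  unfolding transfer_def[abs_def] using assms
  by (intro cone_sum cone_scale branch_cone[OF assms]) auto

text \<open>The room between D' and D pays for the subtraction. By convexity, exp (D' * d) is at
  most (1 - D' / D) + (D' / D) * exp (D * d), so the fraction 1 - D' / D of g may be spent; the mass
  bounds it from below.\<close>

lemma cone_subtract_const:
  assumes D: "0 \<le> D'" "D' < D" and g: "g \<in> cone D'"
    and q: "0 \<le> q" "q \<le> (1 - D' / D) * exp (- (2 * D')) * mass g"
  shows "(\<lambda>z. g z - q) \<in> cone D"
proof (rule coneI)
  let ?\<eta> = "1 - D' / D"
  have \<eta>: "0 \<le> ?\<eta>" "?\<eta> \<le> 1" using D by (auto simp: field_simps)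
  have q_le: "q \<le> ?\<eta> * g z" if "z \<in> space (base p)" for z
  proof -
    have "?\<eta> * (exp (- (2 * D')) * mass g) \<le> ?\<eta> * g z"
      using mass_le_cone[OF D(1) g that] \<eta> by (intro mult_left_mono) auto
    then show ?thesis using q(2) by (simp add: mult.assoc)
  qed
  show "0 \<le> g z - q" if "z \<in> space (base p)" for z
  proof -
    have "?\<eta> * g z \<le> g z" using \<eta> cone_nonneg[OF g that] by (intro mult_left_le_one_le) auto
    then show ?thesis using q_le[OF that] by simp
  qed
  fix z z' assume z: "z \<in> space (base p)" "z' \<in> space (base p)"
  let ?d = "hdist z z'"
  have "exp (?\<eta> * 0 + (D' / D) * (D * ?d)) \<le> ?\<eta> * exp 0 + (D' / D) * exp (D * ?d)"
    using convex_onD[OF exp_convex, of "D' / D" 0 "D * ?d"] D by (auto simp: field_simps)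
  then have conv: "exp (D' * ?d) \<le> ?\<eta> + (D' / D) * exp (D * ?d)" using D by simp
  have E: "1 \<le> exp (D * ?d)" using D by simp
  have "g z \<le> exp (D' * ?d) * g z'" by (rule cone_hdist[OF g z])
  also have "\<dots> \<le> (?\<eta> + (D' / D) * exp (D * ?d)) * g z'"
    using conv cone_nonneg[OF g z(2)] by (intro mult_right_mono) auto
  also have "\<dots> = exp (D * ?d) * g z' - (exp (D * ?d) - 1) * (?\<eta> * g z')" by (simp add: algebra_simps)
  also have "\<dots> \<le> exp (D * ?d) * g z' - (exp (D * ?d) - 1) * q"
    using E q_le[OF z(2)] by (intro diff_left_mono mult_left_mono) auto
  finally show "g z - q \<le> exp (D * ?d) * (g z' - q)" by (simp add: algebra_simps)
qed (use cone_measurable[OF g] in simp)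

section \<open>Survival and immediate return of cone densities\<close>

lemma survivor_nonneg:
  assumes "g \<in> cone D"
  shows "0 \<le> survivor n g"
  unfolding survivor_def using cone_nonneg[OF assms]
  by (intro sum_nonneg mult_nonneg_nonneg Bochner_Integration.integral_nonneg) (auto simp: indicator_def)

text \<open>A cone density is at most exp (2 * D) times its mass, so its survival is compared with
  that of the uniform density, which is \<open>tail\<close>.\<close>

lemma survivor_le_tail:
  assumes "0 \<le> D" "g \<in> cone D"
  shows "survivor n g \<le> exp (2 * D) * mass g * tail n"
proof -
  interpret U: prob_space unit_interval by (rule prob_space_unit_interval)
  interpret S: prob_space "bernoulli_measure p" by (rule prob_space_bernoulli)
  interpret B: prob_space "base p" by (rule prob_space_base)
  interpret pair: pair_prob_space "bernoulli_measure p" unit_interval by unfold_locales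
  have ind: "(\<lambda>z. indicator {..cut s} (snd z) :: real) \<in> bounded_measurable (base p)" for s
    by (rule bounded_measurableI[of _ _ 1]) (auto simp: indicator_def)
  have cut: "(\<integral>z. indicator {..cut s} (snd z) \<partial>base p) = cut s" for s
    using pair.integral_fst'[of "\<lambda>z. indicator {..cut s} (snd z) :: real"] B.integrable_bounded_measurable[OF ind[of s]]
      integral_unit_interval_atMost[of "cut s"] cut_pos[of s] cut_le_1[of s]
    by (simp add: base_def S.prob_space[simplified])
  have "(\<integral>z. g (prepend s (fst z), snd z) * indicator {..cut s} (snd z) \<partial>base p) \<le> exp (2 * D) * mass g * cut s" for s
  proof -
    have "(\<integral>z. g (prepend s (fst z), snd z) * indicator {..cut s} (snd z) \<partial>base p) \<le>
      (\<integral>z. exp (2 * D) * mass g * indicator {..cut s} (snd z) \<partial>base p)"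
      using assms cone_le_mass[OF assms]
      by (intro integral_mono mult_right_mono B.integrable_bounded_measurable bounded_measurable_prepend_indicator
          bounded_measurable_mult[OF bounded_measurable_const ind] cone_bounded_measurable[OF assms]) auto
    then show ?thesis by (simp add: cut)
  qed
  then have "survivor n g \<le> (\<Sum>s\<in>words n. word_prob p s * (exp (2 * D) * mass g * cut s))"
    unfolding survivor_def by (intro sum_mono mult_left_mono) auto
  then show ?thesis unfolding tail_def by (simp add: sum_distrib_left mult_ac)
qed

lemma survivor_mult_le:
  assumes v: "v \<in> bounded_measurable (base p)" and C: "\<And>z. z \<in> space (base p) \<Longrightarrow> \<bar>v z\<bar> \<le> C"
    and D: "0 \<le> D" and g: "g \<in> cone D"
  shows "\<bar>survivor n (\<lambda>z. v z * g z)\<bar> \<le> C * survivor n g"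
proof -
  interpret B: prob_space "base p" by (rule prob_space_base)
  have gb: "g \<in> bounded_measurable (base p)" by (rule cone_bounded_measurable[OF D g])
  let ?G = "\<lambda>z. v z * g z"
  have Gb: "?G \<in> bounded_measurable (base p)"
    by (intro bounded_measurable_mult v gb)
  have "\<bar>\<integral>z. ?G (prepend s (fst z), snd z) * indicator {..cut s} (snd z) \<partial>base p\<bar> \<le>
      C * (\<integral>z. g (prepend s (fst z), snd z) * indicator {..cut s} (snd z) \<partial>base p)" for s
  proof -
    have "\<bar>\<integral>z. ?G (prepend s (fst z), snd z) * indicator {..cut s} (snd z) \<partial>base p\<bar> \<le>
      (\<integral>z. \<bar>?G (prepend s (fst z), snd z) * indicator {..cut s} (snd z)\<bar> \<partial>base p)"
      by (rule integral_abs_bound)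
    also have "\<dots> \<le> (\<integral>z. C * (g (prepend s (fst z), snd z) * indicator {..cut s} (snd z)) \<partial>base p)"
    proof (rule integral_mono)
      show "integrable (base p) (\<lambda>z. \<bar>?G (prepend s (fst z), snd z) * indicator {..cut s} (snd z)\<bar>)"
        by (intro integrable_abs B.integrable_bounded_measurable bounded_measurable_prepend_indicator[OF Gb]) auto
      show "integrable (base p) (\<lambda>z. C * (g (prepend s (fst z), snd z) * indicator {..cut s} (snd z)))"
        by (intro integrable_mult_right B.integrable_bounded_measurable bounded_measurable_prepend_indicator[OF gb]) auto
      fix z assume z: "z \<in> space (base p)"
      then have sp: "(prepend s (fst z), snd z) \<in> space (base p)" by auto
      show "\<bar>?G (prepend s (fst z), snd z) * indicator {..cut s} (snd z)\<bar> \<le>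
          C * (g (prepend s (fst z), snd z) * indicator {..cut s} (snd z))"
        using C[OF sp] cone_nonneg[OF g sp] by (auto simp: abs_mult indicator_def intro!: mult_right_mono)
    qed
    finally show ?thesis by simp
  qed
  then have "\<bar>survivor n ?G\<bar> \<le> (\<Sum>s\<in>words n. word_prob p s * (C * (\<integral>z. g (prepend s (fst z), snd z) * indicator {..cut s} (snd z) \<partial>base p)))"
    unfolding survivor_def
    by (intro order_trans[OF sum_abs] sum_mono) (auto simp: abs_mult intro!: mult_left_mono)
  then show ?thesis unfolding survivor_def by (simp add: sum_distrib_left mult_ac)
qed

lemma iterate_embed_space: "z \<in> space (base p) \<Longrightarrow> (F ^^ n) (embed z) \<in> space (phase p)"
  using measurable_space[OF measurable_compose[OF measurable_embed measurable_F_iterate]] .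

lemma excursion_le_survivor:
  assumes \<phi>: "\<phi> \<in> bounded_measurable (phase p)" and C: "\<And>z. z \<in> space (phase p) \<Longrightarrow> \<bar>\<phi> z\<bar> \<le> C"
    and D: "0 \<le> D" and g: "g \<in> cone D"
  shows "\<bar>excursion \<phi> n g\<bar> \<le> C * survivor n g"
  unfolding excursion_def
  by (rule survivor_mult_le[OF bounded_measurable_iterate[OF \<phi>] C[OF iterate_embed_space] D g])

text \<open>Compares g from below with a constant density, of which the fraction 1 - tail 1 surely
  returns after one step.\<close>

lemma mass_transfer_1_ge:
  assumes "0 \<le> D" "g \<in> cone D"
  shows "exp (- (2 * D)) * (1 - tail 1) * mass g \<le> mass (transfer 1 g)"
proof -
  interpret B: prob_space "base p" by (rule prob_space_base)
  have one: "(\<lambda>_. 1) \<in> cone 0" by (rule cone_const) auto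
  have "1 - tail 1 \<le> mass (transfer 1 (\<lambda>_. 1))"
    using survivor_Suc[OF cone_bounded_measurable[OF order_refl one], of 0] survivor_le_tail[OF order_refl one, of 1]
    by (simp add: survivor_0 B.prob_space[simplified])
  then have "exp (- (2 * D)) * mass g * (1 - tail 1) \<le> exp (- (2 * D)) * mass g * mass (transfer 1 (\<lambda>_. 1))"
    using mass_nonneg[OF assms(2)] by (intro mult_left_mono) auto
  also have "\<dots> = (\<integral>z. exp (- (2 * D)) * mass g * transfer 1 (\<lambda>_. 1) z \<partial>base p)" by simp
  also have "\<dots> \<le> mass (transfer 1 g)"
  proof (rule integral_mono)
    show "integrable (base p) (\<lambda>z. exp (- (2 * D)) * mass g * transfer 1 (\<lambda>_. 1) z)"
      by (intro integrable_mult_right integrable_cone[OF _ transfer_cone[OF order_refl one]]) auto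
    show "integrable (base p) (transfer 1 g)"
      using assms by (intro integrable_cone[OF _ transfer_cone[OF assms]]) auto
    fix z assume z: "z \<in> space (base p)"
    show "exp (- (2 * D)) * mass g * transfer 1 (\<lambda>_. 1) z \<le> transfer 1 g z"
      unfolding transfer_def sum_distrib_left
    proof (intro sum_mono)
      fix s assume "s \<in> {s \<in> words 1. 0 < free s}"
      then have "branch s z \<in> space (base p)" using measurable_space[OF measurable_branch z] by blast
      from mass_le_cone[OF assms this]
      have "word_prob p s * jac s (snd z) * (exp (- (2 * D)) * mass g) \<le> word_prob p s * jac s (snd z) * g (branch s z)"
        using jac_pos[of "snd z" s] z by (intro mult_left_mono) auto
      then show "exp (- (2 * D)) * mass g * (word_prob p s * (1 * jac s (snd z))) \<le> word_prob p s * (g (branch s z) * jac s (snd z))"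
        by (simp add: mult_ac)
    qed
  qed
  finally show ?thesis by (simp add: mult_ac)
qed

end

section \<open>Regeneration\<close>

context polynomial_system
begin

lemma pairing_linear:
  fixes q :: real
  assumes \<phi>: "\<phi> \<in> bounded_measurable (phase p)"
    and g: "\<And>i. i \<in> I \<Longrightarrow> g i \<in> bounded_measurable (base p)"
  shows "pairing \<phi> n (\<lambda>z. (\<Sum>i\<in>I. g i z) - q) = (\<Sum>i\<in>I. pairing \<phi> n (g i)) - q * pairing \<phi> n (\<lambda>_. 1)"
proof -
  interpret B: prob_space "base p" by (rule prob_space_base)
  note \<phi>' = bounded_measurable_iterate[OF \<phi>, of n]
  have int: "integrable (base p) (\<lambda>z. \<phi> ((F ^^ n) (embed z)) * g i z)" if "i \<in> I" for i
    by (intro B.integrable_bounded_measurable bounded_measurable_mult \<phi>' g that)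
  have "pairing \<phi> n (\<lambda>z. (\<Sum>i\<in>I. g i z) - q) =
      (\<integral>z. (\<Sum>i\<in>I. \<phi> ((F ^^ n) (embed z)) * g i z) - q * \<phi> ((F ^^ n) (embed z)) \<partial>base p)"
    unfolding pairing_def by (simp add: right_diff_distrib sum_distrib_left mult.commute[of _ q])
  also have "\<dots> = (\<integral>z. (\<Sum>i\<in>I. \<phi> ((F ^^ n) (embed z)) * g i z) \<partial>base p) - (\<integral>z. q * \<phi> ((F ^^ n) (embed z)) \<partial>base p)"
    by (intro Bochner_Integration.integral_diff Bochner_Integration.integrable_sum int integrable_mult_right
        B.integrable_bounded_measurable \<phi>')
  also have "(\<integral>z. (\<Sum>i\<in>I. \<phi> ((F ^^ n) (embed z)) * g i z) \<partial>base p) = (\<Sum>i\<in>I. pairing \<phi> n (g i))"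
    unfolding pairing_def by (intro Bochner_Integration.integral_sum int)
  finally show ?thesis by (simp add: pairing_def)
qed

text \<open>Here \<open>w m\<close> is the density left on the base at time m after the constant
  \<open>q m\<close>, a multiple of Lebesgue measure, has been split off. What was split off at time
  m then evolves like Lebesgue measure for n - m steps; what was never split off is, at time n, in
  an excursion begun at some m. The identity sums \<open>pairing_renewal\<close> over all
  \<open>w m\<close> and exchanges the order of summation.\<close>

lemma renewal_telescope:
  assumes \<phi>: "\<phi> \<in> bounded_measurable (phase p)"
    and w: "\<And>m. m \<le> n \<Longrightarrow> w m \<in> bounded_measurable (base p)"
    and rec: "\<And>m. 0 < m \<Longrightarrow> m \<le> n \<Longrightarrow> w m = (\<lambda>z. (\<Sum>i<m. transfer (m - i) (w i) z) - q m)"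
  shows "pairing \<phi> n (w 0) =
    (\<Sum>m<n. q (n - m) * pairing \<phi> m (\<lambda>_. 1)) + (\<Sum>m\<le>n. excursion \<phi> (n - m) (w m))"
proof -
  have exc: "excursion \<phi> (n - m) (w m) = pairing \<phi> (n - m) (w m) -
      (\<Sum>j\<in>{m<..n}. pairing \<phi> (n - j) (transfer (j - m) (w m)))" if "m \<le> n" for m
  proof -
    have "(\<Sum>i<n - m. pairing \<phi> i (transfer (n - m - i) (w m))) =
        (\<Sum>j\<in>{m<..n}. pairing \<phi> (n - j) (transfer (j - m) (w m)))"
      using that by (intro sum.reindex_bij_witness[of _ "\<lambda>j. n - j" "\<lambda>i. n - i"]) (auto simp: add.commute)
    then show ?thesis using pairing_renewal[OF \<phi> w[OF that], of "n - m"] by simp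
  qed
  have "(\<Sum>m\<le>n. \<Sum>j\<in>{m<..n}. pairing \<phi> (n - j) (transfer (j - m) (w m))) =
      (\<Sum>m\<le>n. \<Sum>j\<in>{j. j \<in> {..n} \<and> m < j}. pairing \<phi> (n - j) (transfer (j - m) (w m)))"
    by (intro sum.cong) auto
  also have "\<dots> = (\<Sum>j\<le>n. \<Sum>m\<in>{m. m \<in> {..n} \<and> m < j}. pairing \<phi> (n - j) (transfer (j - m) (w m)))"
    by (rule sum.swap_restrict) auto
  also have "\<dots> = (\<Sum>j\<le>n. \<Sum>m<j. pairing \<phi> (n - j) (transfer (j - m) (w m)))"
    by (intro sum.cong) auto
  also have "\<dots> = (\<Sum>j\<in>{0<..n}. \<Sum>m<j. pairing \<phi> (n - j) (transfer (j - m) (w m)))"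
    by (rule sum.mono_neutral_right) auto
  also have "\<dots> = (\<Sum>j\<in>{0<..n}. pairing \<phi> (n - j) (w j) + q j * pairing \<phi> (n - j) (\<lambda>_. 1))"
  proof (intro sum.cong refl)
    fix j assume j: "j \<in> {0<..n}"
    have "pairing \<phi> (n - j) (w j) = pairing \<phi> (n - j) (\<lambda>z. (\<Sum>i<j. transfer (j - i) (w i) z) - q j)"
      using rec[of j] j by simp
    also have "\<dots> = (\<Sum>m<j. pairing \<phi> (n - j) (transfer (j - m) (w m))) - q j * pairing \<phi> (n - j) (\<lambda>_. 1)"
      using j by (intro pairing_linear \<phi> bounded_measurable_transfer w) auto
    finally show "(\<Sum>m<j. pairing \<phi> (n - j) (transfer (j - m) (w m))) =
        pairing \<phi> (n - j) (w j) + q j * pairing \<phi> (n - j) (\<lambda>_. 1)" by simp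
  qed
  finally have swap: "(\<Sum>m\<le>n. \<Sum>j\<in>{m<..n}. pairing \<phi> (n - j) (transfer (j - m) (w m))) =
      (\<Sum>j\<in>{0<..n}. pairing \<phi> (n - j) (w j)) + (\<Sum>j\<in>{0<..n}. q j * pairing \<phi> (n - j) (\<lambda>_. 1))"
    by (simp add: sum.distrib)
  have "(\<Sum>m\<le>n. excursion \<phi> (n - m) (w m)) = (\<Sum>m\<le>n. pairing \<phi> (n - m) (w m)) -
      (\<Sum>m\<le>n. \<Sum>j\<in>{m<..n}. pairing \<phi> (n - j) (transfer (j - m) (w m)))"
    by (simp add: exc flip: sum_subtractf)
  also have "(\<Sum>m\<le>n. pairing \<phi> (n - m) (w m)) = pairing \<phi> n (w 0) + (\<Sum>j\<in>{0<..n}. pairing \<phi> (n - j) (w j))"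
  proof -
    have "{..n} = insert 0 {0<..n}" by auto
    then show ?thesis by simp
  qed
  finally have "pairing \<phi> n (w 0) = (\<Sum>j\<in>{0<..n}. q j * pairing \<phi> (n - j) (\<lambda>_. 1)) + (\<Sum>m\<le>n. excursion \<phi> (n - m) (w m))"
    by (simp add: swap)
  also have "(\<Sum>j\<in>{0<..n}. q j * pairing \<phi> (n - j) (\<lambda>_. 1)) = (\<Sum>m<n. q (n - m) * pairing \<phi> m (\<lambda>_. 1))"
    by (rule sum.reindex_bij_witness[of _ "\<lambda>m. n - m" "\<lambda>j. n - j"]) auto
  finally show ?thesis .
qed

lemma pairing_one: "pairing (\<lambda>_. 1) n g = mass g"
  by (simp add: pairing_def)

lemma excursion_one: "excursion (\<lambda>_. 1) n g = survivor n g"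
  by (simp add: excursion_def)

lemma mass_one: "mass (\<lambda>_. 1) = 1"
  using prob_space.prob_space[OF prob_space_base] by simp

lemma mass_telescope:
  assumes w: "\<And>m. m \<le> n \<Longrightarrow> w m \<in> bounded_measurable (base p)"
    and rec: "\<And>m. 0 < m \<Longrightarrow> m \<le> n \<Longrightarrow> w m = (\<lambda>z. (\<Sum>i<m. transfer (m - i) (w i) z) - q m)"
  shows "mass (w 0) = (\<Sum>m<n. q (n - m)) + (\<Sum>m\<le>n. survivor (n - m) (w m))"
  using renewal_telescope[OF bounded_measurable_const[of 1] w rec]
  unfolding pairing_one excursion_one mass_one by simp

text \<open>The amounts q are fixed in advance and do not depend on g; that the results stay
  nonnegative is the content of \<open>regeneration_scheme\<close>. With q = 0 these are the
  densities of visits to the base.\<close>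

fun regeneration :: "(nat \<Rightarrow> real) \<Rightarrow> ((nat \<Rightarrow> 'a) \<times> real \<Rightarrow> real) \<Rightarrow> nat \<Rightarrow> (nat \<Rightarrow> 'a) \<times> real \<Rightarrow> real" where
  "regeneration q g n = (if n = 0 then g else (\<lambda>z. (\<Sum>m<n. transfer (n - m) (regeneration q g m) z) - q n))"

declare regeneration.simps [simp del]

text \<open>Chosen so that a transfer step, even after multiplication by a weight in \<open>cone 1\<close>, lands
  strictly inside the cone.\<close>

definition aperture :: real where
  "aperture = 4 / (1 - (1 / 2) powr \<alpha>)"

lemma aperture_pos: "0 < aperture" and aperture_ge_4: "4 \<le> aperture"
  and aperture_eq: "(1 / 2) powr \<alpha> * aperture = aperture - 4"
proof -
  have \<kappa>: "0 < (1 / 2 :: real) powr \<alpha>" "(1 / 2 :: real) powr \<alpha> < 1"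
    using \<alpha> powr_less_mono2[of \<alpha> "1 / 2" 1] by auto
  then show "0 < aperture" "4 \<le> aperture" by (auto simp: aperture_def field_simps)
  have "1 - (1 / 2) powr \<alpha> \<noteq> (0 :: real)" using \<kappa>(2) by linarith
  then have "aperture * (1 - (1 / 2) powr \<alpha>) = 4"
    unfolding aperture_def times_divide_eq_left by (rule nonzero_mult_div_cancel_right)
  then show "(1 / 2) powr \<alpha> * aperture = aperture - 4" by (simp add: algebra_simps)
qed

lemma transfer_cone':
  assumes "g \<in> cone aperture"
  shows "transfer n g \<in> cone (aperture - 3)"
  using transfer_cone[OF less_imp_le[OF aperture_pos] assms] by (simp add: aperture_eq)

lemma survivor_bound:
  obtains A where "0 < A"
    and "\<And>g n. g \<in> cone aperture \<Longrightarrow> survivor n g \<le> A * (real n + 1) powr - (1 + \<beta>) * mass g"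
proof -
  let ?D = "aperture" and ?s = "1 + \<beta>"
  have D0: "0 \<le> ?D" using aperture_pos by simp
  obtain A0 where A0: "0 < A0" "\<And>n. tail n \<le> A0 * (real n + 1) powr - ?s" by (rule tail_bound) (rule that)
  show thesis
  proof (rule that[of "exp (2 * ?D) * A0"])
    fix g n assume g: "g \<in> cone ?D"
    have "survivor n g \<le> exp (2 * ?D) * mass g * tail n" by (rule survivor_le_tail[OF D0 g])
    also have "\<dots> \<le> exp (2 * ?D) * mass g * (A0 * (real n + 1) powr - ?s)"
      using mass_nonneg[OF g] by (intro mult_left_mono A0) auto
    finally show "survivor n g \<le> exp (2 * ?D) * A0 * (real n + 1) powr - ?s * mass g" by (simp add: mult_ac)
  qed (use A0 in simp)
qed

text \<open>Mass is regenerated according to a fixed law with polynomial tail, independent of the initial density.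
  At each time the mass that has returned to the base suffices, because excursions of length \<open>n\<close>
  are rarer than that law allows and its hazard rate is small.\<close>

lemma regeneration_scheme:
  obtains K where "1 \<le> K"
    and "\<And>g n. g \<in> cone aperture \<Longrightarrow> mass g = 1 \<Longrightarrow>
      regeneration (\<lambda>n. power_tail (1 + \<beta>) K (n - 1) - power_tail (1 + \<beta>) K n) g n \<in> cone aperture"
    and "\<And>g n. g \<in> cone aperture \<Longrightarrow> mass g = 1 \<Longrightarrow>
      (\<Sum>m\<le>n. survivor (n - m) (regeneration (\<lambda>n. power_tail (1 + \<beta>) K (n - 1) - power_tail (1 + \<beta>) K n) g m)) =
      power_tail (1 + \<beta>) K n"
proof -
  let ?D = "aperture" and ?s = "1 + \<beta>"
  have D0: "0 \<le> ?D" using aperture_pos by simp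
  obtain A where A: "0 < A"
    and surv: "\<And>g n. g \<in> cone ?D \<Longrightarrow> survivor n g \<le> A * (real n + 1) powr - ?s * mass g"
    by (rule survivor_bound) (rule that)
  define c where "c = exp (- (2 * ?D)) * (1 - tail 1)"
  have tail0: "0 \<le> tail 1" unfolding tail_def using cut_pos by (intro sum_nonneg mult_nonneg_nonneg) (auto intro: less_imp_le)
  have c: "0 < c" "c \<le> 1"
    using tail_1_less_1 tail0 aperture_pos mult_mono[of "exp (- (2 * ?D))" 1 "1 - tail 1" 1] by (auto simp: c_def)
  have R1: "c * mass g \<le> mass (transfer 1 g)" if "g \<in> cone ?D" for g
    using mass_transfer_1_ge[OF D0 that] by (simp add: c_def)
  \<comment> \<open>The fraction of the mass of a density in the smaller cone that
    \<open>cone_subtract_const\<close> allows to remove.\<close>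
  define \<epsilon> where "\<epsilon> = (1 - (?D - 3) / ?D) * exp (- (2 * (?D - 3)))"
  have \<epsilon>: "0 < \<epsilon>" using aperture_pos by (simp add: \<epsilon>_def field_simps)
  have s1: "1 < ?s" using \<beta> by simp
  show thesis
  proof (rule regeneration_pool[OF s1 A c \<epsilon>])
    fix K assume K: "1 \<le> K" and pool: "\<And>n W. \<lbrakk> 0 < n;
      \<And>j. j < n \<Longrightarrow> 0 \<le> W j; \<And>j. j < n \<Longrightarrow> W j \<le> power_tail ?s K j;
      \<And>j. j < n \<Longrightarrow> power_tail ?s K j \<le> (\<Sum>k\<le>j. A * (real k + 1) powr - ?s * W (j - k));
      \<And>j. Suc j < n \<Longrightarrow> c * W j - (power_tail ?s K j - power_tail ?s K (Suc j)) \<le> W (Suc j) \<rbrakk>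
    \<Longrightarrow> power_tail ?s K (n - 1) - power_tail ?s K n \<le> \<epsilon> * c * W (n - 1)"
    define q where "q n = power_tail ?s K (n - 1) - power_tail ?s K n" for n
    have q0: "0 \<le> q n" for n
      unfolding q_def using K \<beta> power_tail_antimono[of K ?s "n - 1" n] by simp
    have q_sum: "(\<Sum>m<n. q (n - m)) = 1 - power_tail ?s K n" for n
    proof -
      have "(\<Sum>m<n. q (n - m)) = (\<Sum>m<n. power_tail ?s K m - power_tail ?s K (Suc m))"
        by (rule sum.reindex_bij_witness[of _ "\<lambda>m. n - Suc m" "\<lambda>m. n - Suc m"]) (auto simp: q_def Suc_diff_Suc)
      also have "\<dots> = 1 - power_tail ?s K n" by (induction n) auto
      finally show ?thesis .
    qed
    show thesis
    proof (rule that[OF K])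
      fix g assume g: "g \<in> cone ?D" "mass g = 1"
      define w where "w = regeneration q g"
      have w0: "w 0 = g" by (simp add: w_def regeneration.simps)
      have rec: "w m = (\<lambda>z. (\<Sum>i<m. transfer (m - i) (w i) z) - q m)" if "0 < m" for m
        unfolding w_def using that by (subst regeneration.simps) simp
      \<comment> \<open>Mass balance: what is not regenerated by time n sits in excursions begun at
        times m \<le> n, and by choice of q it amounts to the prescribed tail.\<close>
      have surv_sum: "(\<Sum>m\<le>n. survivor (n - m) (w m)) = power_tail ?s K n" if "\<And>m. m \<le> n \<Longrightarrow> w m \<in> cone ?D" for n
        using mass_telescope[of n w q] cone_bounded_measurable[OF D0 that] rec q_sum[of n] g w0 by simp
      have cone: "w n \<in> cone ?D" for n
      proof (induction n rule: less_induct)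
        case (less n)
        show ?case
        proof (cases "n = 0")
          case False
          then have n: "0 < n" by simp
          let ?v = "\<lambda>m z. \<Sum>i<m. transfer (m - i) (w i) z"
          have v_cone: "?v m \<in> cone (?D - 3)" if "m \<le> n" for m
            using that less aperture_ge_4 by (intro cone_sum transfer_cone') auto
          have v_mass: "mass (?v m) = (\<Sum>i<m. mass (transfer (m - i) (w i)))" if "m \<le> n" for m
            using that less aperture_ge_4 by (intro Bochner_Integration.integral_sum integrable_cone[OF _ transfer_cone']) auto
          have v_ge: "c * mass (w j) \<le> mass (?v (Suc j))" if "Suc j \<le> n" for j
          proof -
            have wj: "w i \<in> cone ?D" if "i < Suc j" for i using less that \<open>Suc j \<le> n\<close> by auto
            have "c * mass (w j) \<le> mass (transfer (Suc j - j) (w j))" using R1[OF wj[of j]] by simp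
            also have "\<dots> \<le> (\<Sum>i<Suc j. mass (transfer (Suc j - i) (w i)))"
              using wj by (intro member_le_sum mass_nonneg[OF transfer_cone']) auto
            finally show ?thesis using v_mass[OF that] by simp
          qed
          \<comment> \<open>The payment at time n is controlled by the masses at earlier times,
            whose densities the induction has already placed in the cone.\<close>
          have "q n \<le> \<epsilon> * c * mass (w (n - 1))"
            unfolding q_def
          proof (rule pool[OF n])
            fix j assume j: "j < n"
            then have wj: "w i \<in> cone ?D" if "i \<le> j" for i using less that by auto
            show "0 \<le> mass (w j)" by (rule mass_nonneg[OF wj[OF order_refl]])
            have "mass (w j) = survivor (j - j) (w j)" by (simp add: survivor_0)
            also have "\<dots> \<le> (\<Sum>m\<le>j. survivor (j - m) (w m))"
              by (rule member_le_sum) (auto intro!: survivor_nonneg[OF wj])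
            finally show "mass (w j) \<le> power_tail ?s K j" using surv_sum[OF wj] by simp
            have "power_tail ?s K j = (\<Sum>m\<le>j. survivor (j - m) (w m))" using surv_sum[OF wj] by simp
            also have "\<dots> \<le> (\<Sum>m\<le>j. A * (real (j - m) + 1) powr - ?s * mass (w m))"
              using wj by (intro sum_mono surv) auto
            also have "\<dots> = (\<Sum>k\<le>j. A * (real k + 1) powr - ?s * mass (w (j - k)))"
              by (rule sum.reindex_bij_witness[of _ "\<lambda>k. j - k" "\<lambda>k. j - k"]) auto
            finally show "power_tail ?s K j \<le> (\<Sum>k\<le>j. A * (real k + 1) powr - ?s * mass (w (j - k)))" .
          next
            fix j assume j: "Suc j < n"
            interpret B: prob_space "base p" by (rule prob_space_base)
            have "mass (w (Suc j)) = mass (\<lambda>z. ?v (Suc j) z - q (Suc j))" using rec[of "Suc j"] by simp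
            also have "\<dots> = mass (?v (Suc j)) - q (Suc j)"
              using integrable_cone[OF _ v_cone[of "Suc j"]] aperture_ge_4 j
              by (subst Bochner_Integration.integral_diff) (auto simp: B.prob_space[simplified])
            finally show "c * mass (w j) - (power_tail ?s K j - power_tail ?s K (Suc j)) \<le> mass (w (Suc j))"
              using v_ge[of j] j by (simp add: q_def)
          qed
          also have "\<dots> = \<epsilon> * (c * mass (w (n - 1)))" by simp
          also have "\<dots> \<le> \<epsilon> * mass (?v n)" using v_ge[of "n - 1"] \<epsilon> n by (intro mult_left_mono) auto
          finally have "(\<lambda>z. ?v n z - q n) \<in> cone ?D"
            unfolding \<epsilon>_def using aperture_ge_4 q0 by (intro cone_subtract_const[OF _ _ v_cone]) auto
          then show ?thesis using rec[OF n] by simp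
        qed (use g w0 in simp)
      qed
      show "regeneration (\<lambda>n. power_tail ?s K (n - 1) - power_tail ?s K n) g n \<in> cone ?D" for n
        using cone[of n] by (simp add: w_def q_def[abs_def])
      show "(\<Sum>m\<le>n. survivor (n - m) (regeneration (\<lambda>n. power_tail ?s K (n - 1) - power_tail ?s K n) g m)) = power_tail ?s K n" for n
        using surv_sum[OF cone, of n] by (simp add: w_def q_def[abs_def])
    qed
  qed
qed

text \<open>The split-off parts evolve alike for every initial density of mass 1, so two such
  densities differ by their unregenerated parts, of the order of the tail. For the density 1 the
  same identity is a renewal equation with the prescribed law, whose solution converges at order
  \<beta>. The limit L depends on \<phi> alone, and R on neither \<phi> nor g.\<close>

lemma pairing_rate:
  obtains R where "0 \<le> R"
    and "\<And>\<phi> C. \<phi> \<in> bounded_measurable (phase p) \<Longrightarrow> (\<And>z. z \<in> space (phase p) \<Longrightarrow> \<bar>\<phi> z\<bar> \<le> C) \<Longrightarrow>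
      \<exists>L. \<forall>g\<in>cone aperture. \<forall>n. \<bar>pairing \<phi> n g - L * mass g\<bar> \<le> R * C * mass g * (real n + 1) powr - \<beta>"
proof -
  let ?D = "aperture" and ?s = "1 + \<beta>"
  have D0: "0 \<le> ?D" using aperture_pos by simp
  show thesis
  proof (rule regeneration_scheme)
    fix K assume K: "1 \<le> K"
    and w_cone: "\<And>g n. g \<in> cone aperture \<Longrightarrow> mass g = 1 \<Longrightarrow>
      regeneration (\<lambda>n. power_tail ?s K (n - 1) - power_tail ?s K n) g n \<in> cone aperture"
    and w_surv: "\<And>g n. g \<in> cone aperture \<Longrightarrow> mass g = 1 \<Longrightarrow>
      (\<Sum>m\<le>n. survivor (n - m) (regeneration (\<lambda>n. power_tail ?s K (n - 1) - power_tail ?s K n) g m)) = power_tail ?s K n"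
    define q where "q n = power_tail ?s K (n - 1) - power_tail ?s K n" for n
    define R1 where "R1 = 2 * 2 powr ?s * (1 + K / \<beta>) * (K / \<beta>)"
    define R where "R = (R1 + 2) * K powr \<beta>"
    have R1: "0 \<le> R1" using K \<beta> by (simp add: R1_def)
    have R: "0 \<le> R" using R1 by (simp add: R_def)
    show thesis
    proof (rule that[OF R])
      fix \<phi> C assume \<phi>: "\<phi> \<in> bounded_measurable (phase p)" and C: "\<And>z. z \<in> space (phase p) \<Longrightarrow> \<bar>\<phi> z\<bar> \<le> C"
      have C0: "0 \<le> C" using C[of "(undefined, 0)"] by simp
      define E where "E g n = pairing \<phi> n g - (\<Sum>m<n. q (n - m) * pairing \<phi> m (\<lambda>_. 1))" for g n
      have E: "\<bar>E g n\<bar> \<le> C * power_tail ?s K n" if g: "g \<in> cone ?D" "mass g = 1" for g n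
      proof -
        define w where "w = regeneration q g"
        have w0: "w 0 = g" by (simp add: w_def regeneration.simps)
        have rec: "w m = (\<lambda>z. (\<Sum>i<m. transfer (m - i) (w i) z) - q m)" if "0 < m" for m
          unfolding w_def using that by (subst regeneration.simps) simp
        have wc: "w m \<in> cone ?D" for m using w_cone[OF g, of m] by (simp add: w_def q_def[abs_def])
        have "E g n = (\<Sum>m\<le>n. excursion \<phi> (n - m) (w m))"
          using renewal_telescope[OF \<phi>, of n w q] cone_bounded_measurable[OF D0 wc] rec w0 by (simp add: E_def)
        also have "\<bar>\<dots>\<bar> \<le> (\<Sum>m\<le>n. C * survivor (n - m) (w m))"
          by (rule order_trans[OF sum_abs sum_mono]) (rule excursion_le_survivor[OF \<phi> C D0 wc])
        also have "\<dots> = C * power_tail ?s K n"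
          using w_surv[OF g, of n] by (simp add: w_def q_def[abs_def] flip: sum_distrib_left)
        finally show ?thesis .
      qed
      have one: "(\<lambda>_. 1) \<in> cone ?D" by (rule cone_const) (use D0 in auto)
      let ?a = "\<lambda>n. pairing \<phi> n (\<lambda>_. 1)"
      have "?a n = (\<Sum>m<n. (power_tail ?s K (n - m - 1) - power_tail ?s K (n - m)) * ?a m) + E (\<lambda>_. 1) n" for n
        by (simp add: E_def q_def)
      note ren = this
      have K0: "0 < K" using K by simp
      obtain L where "?a \<longlonglongrightarrow> L" and L: "\<And>n. \<bar>?a n - L\<bar> \<le> C * R1 * power_tail \<beta> K n"
        by (rule renewal_power_rate[where a = ?a and E = "E (\<lambda>_. 1)", OF K0 \<beta> C0 ren E[OF one mass_one]])
          (rule that, assumption, unfold R1_def, assumption)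
      have pt: "power_tail \<beta> K n \<le> K powr \<beta> * (real n + 1) powr - \<beta>" for n
      proof -
        have "(K + real n) powr - \<beta> \<le> (real n + 1) powr - \<beta>" using K \<beta> by (intro powr_mono2') auto
        then show ?thesis using K by (simp add: power_tail_altdef mult_left_mono)
      qed
      have pt': "power_tail ?s K n \<le> power_tail \<beta> K n" for n
        unfolding power_tail_def using K \<beta> by (intro powr_mono) auto
      have unit: "\<bar>pairing \<phi> n g - L\<bar> \<le> R * C * (real n + 1) powr - \<beta>" if g: "g \<in> cone ?D" "mass g = 1" for g n
      proof -
        have "\<bar>pairing \<phi> n g - L\<bar> \<le> \<bar>?a n - L\<bar> + \<bar>E g n\<bar> + \<bar>E (\<lambda>_. 1) n\<bar>" by (simp add: E_def)
        also have "\<dots> \<le> C * R1 * power_tail \<beta> K n + C * power_tail ?s K n + C * power_tail ?s K n"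
          by (intro add_mono L E g one mass_one)
        also have "\<dots> \<le> C * R1 * power_tail \<beta> K n + C * power_tail \<beta> K n + C * power_tail \<beta> K n"
          using mult_left_mono[OF pt'[of n] C0] by linarith
        also have "\<dots> = C * (R1 + 2) * power_tail \<beta> K n" by (simp add: algebra_simps)
        also have "\<dots> \<le> C * (R1 + 2) * (K powr \<beta> * (real n + 1) powr - \<beta>)"
          using C0 R1 pt by (intro mult_left_mono) auto
        finally show ?thesis by (simp add: R_def mult_ac)
      qed
      show "\<exists>L. \<forall>g\<in>cone ?D. \<forall>n. \<bar>pairing \<phi> n g - L * mass g\<bar> \<le> R * C * mass g * (real n + 1) powr - \<beta>"
      proof (intro exI[of _ L] ballI allI)
        fix g n assume g: "g \<in> cone ?D"
        show "\<bar>pairing \<phi> n g - L * mass g\<bar> \<le> R * C * mass g * (real n + 1) powr - \<beta>"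
        proof (cases "mass g = 0")
          case True
          have "g z = 0" if "z \<in> space (base p)" for z
            using cone_le_mass[OF D0 g that] cone_nonneg[OF g that] True by simp
          then have "pairing \<phi> n g = (\<integral>z. 0 \<partial>base p)"
            unfolding pairing_def by (intro Bochner_Integration.integral_cong) auto
          then show ?thesis using True by simp
        next
          case False
          then have m: "0 < mass g" using mass_nonneg[OF g] by simp
          let ?g = "\<lambda>z. 1 / mass g * g z"
          have "\<bar>pairing \<phi> n ?g - L\<bar> \<le> R * C * (real n + 1) powr - \<beta>"
            using m by (intro unit cone_scale g) auto
          moreover have "pairing \<phi> n ?g = pairing \<phi> n g / mass g" by (simp add: pairing_def)
          ultimately have "mass g * \<bar>pairing \<phi> n g / mass g - L\<bar> \<le> mass g * (R * C * (real n + 1) powr - \<beta>)"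
            using m by (intro mult_left_mono) auto
          moreover have "mass g * \<bar>pairing \<phi> n g / mass g - L\<bar> = \<bar>pairing \<phi> n g - L * mass g\<bar>"
          proof -
            have "pairing \<phi> n g - L * mass g = mass g * (pairing \<phi> n g / mass g - L)" using m by (simp add: field_simps)
            then show ?thesis using m by (simp add: abs_mult)
          qed
          ultimately show ?thesis by (simp add: mult_ac)
        qed
      qed
    qed
  qed
qed

end

section \<open>The invariant measure as a limit\<close>

text \<open>Applied to integrals x over the right half, driven by integrals b over the left
  half.\<close>

lemma half_recursion_tendsto_0:
  fixes x b :: "nat \<Rightarrow> real"
  assumes rec: "\<And>n. x (Suc n) = (x n + b n) / 2" and b: "b \<longlonglongrightarrow> 0"
  shows "x \<longlonglongrightarrow> 0"
proof (rule LIMSEQ_I)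
  fix r :: real assume r: "0 < r"
  obtain N where N: "\<And>n. n \<ge> N \<Longrightarrow> \<bar>b n\<bar> < r / 2" using LIMSEQ_D[OF b, of "r / 2"] r by auto
  have bound: "\<bar>x (N + k)\<bar> \<le> \<bar>x N\<bar> * (1 / 2) ^ k + r / 2" for k
  proof (induction k)
    case (Suc k)
    have "\<bar>x (N + Suc k)\<bar> \<le> (\<bar>x (N + k)\<bar> + \<bar>b (N + k)\<bar>) / 2" by (simp add: rec)
    then show ?case using Suc N[of "N + k"] by simp
  qed (use r in auto)
  have "(\<lambda>k. \<bar>x N\<bar> * (1 / 2) ^ k) \<longlonglongrightarrow> \<bar>x N\<bar> * 0"
    by (intro tendsto_intros LIMSEQ_realpow_zero) auto
  then obtain M where M: "\<And>k. k \<ge> M \<Longrightarrow> \<bar>x N\<bar> * (1 / 2) ^ k < r / 2"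
    using LIMSEQ_D[of "\<lambda>k. \<bar>x N\<bar> * (1 / 2) ^ k" 0 "r / 2"] r by auto
  show "\<exists>no. \<forall>n\<ge>no. norm (x n - 0) < r"
  proof (intro exI[of _ "N + M"] allI impI)
    fix n assume "N + M \<le> n"
    then have "N \<le> n" "M \<le> n - N" by auto
    then show "norm (x n - 0) < r" using bound[of "n - N"] M[of "n - N"] by simp
  qed
qed

text \<open>Weak convergence of uniformly bounded functions on [0, 1], set up so that the density of
  \<mu>, of which integrability is all that is at hand, can serve as test function.\<close>

locale bounded_test_sequence =
  fixes u :: "nat \<Rightarrow> real \<Rightarrow> real" and C :: real
  assumes u_measurable [measurable]: "\<And>n. u n \<in> borel_measurable borel"
    and u_bound: "\<And>n x. \<bar>u n x\<bar> \<le> C * indicator {0..1} x"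
begin

definition vanishes :: "(real \<Rightarrow> real) \<Rightarrow> bool" where
  "vanishes g \<longleftrightarrow> (\<lambda>n. \<integral>x. u n x * g x \<partial>lborel) \<longlonglongrightarrow> 0"

lemma C_nonneg: "0 \<le> C"
  using u_bound[of 0 0] by simp

lemma integrable_u_mult:
  assumes [measurable]: "g \<in> borel_measurable borel" and "integrable lborel (\<lambda>x. indicator {0..1} x * g x)"
  shows "integrable lborel (\<lambda>x. u n x * g x)"
proof (rule Bochner_Integration.integrable_bound[where f = "\<lambda>x. C * (indicator {0..1} x * g x)"])
  show "AE x in lborel. norm (u n x * g x) \<le> norm (C * (indicator {0..1} x * g x))"
  proof (intro AE_I2)
    fix x
    show "norm (u n x * g x) \<le> norm (C * (indicator {0..1} x * g x))"
      using mult_right_mono[OF u_bound[of n x] abs_ge_zero[of "g x"]] C_nonneg by (simp add: abs_mult)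
  qed
qed (use assms in auto)

lemma integrable_u_indicator:
  assumes "A \<in> sets borel"
  shows "integrable lborel (\<lambda>x. u n x * indicator A x)"
proof (rule integrable_u_mult)
  have "emeasure lborel ({0..1} \<inter> A) \<le> emeasure lborel {0..1::real}"
    by (rule emeasure_mono) auto
  also have "\<dots> < \<infinity>" by simp
  finally have "integrable lborel (indicator ({0..1} \<inter> A) :: real \<Rightarrow> real)"
    using assms by (intro integrable_real_indicator) auto
  then show "integrable lborel (\<lambda>x. indicator {0..1} x * indicator A x :: real)"
    unfolding indicator_inter_arith[abs_def, of "{0..1}" A, symmetric] .
qed (use assms in auto)

lemma vanishes_diff:
  assumes "A \<in> sets borel" "B \<in> sets borel" "vanishes (indicator A)" "vanishes (indicator B)"
  shows "vanishes (\<lambda>x. indicator A x - indicator B x)"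
  using tendsto_diff[OF assms(3,4)[unfolded vanishes_def]] integrable_u_indicator assms(1,2)
  by (simp add: vanishes_def right_diff_distrib)

lemma vanishes_limit:
  fixes s :: "nat \<Rightarrow> real \<Rightarrow> real"
  assumes [measurable]: "\<And>i. s i \<in> borel_measurable borel" "g \<in> borel_measurable borel"
    and int: "integrable lborel (\<lambda>x. indicator {0..1} x * w x)"
    and lim: "\<And>x. (\<lambda>i. s i x) \<longlonglongrightarrow> g x" and dom: "\<And>i x. \<bar>s i x\<bar> \<le> w x"
    and van: "\<And>i. vanishes (s i)"
  shows "vanishes g"
  unfolding vanishes_def
proof (rule LIMSEQ_I)
  fix r :: real assume r: "0 < r"
  have w0: "0 \<le> w x" for x using dom[of 0 x] by linarith
  have gw: "\<bar>g x\<bar> \<le> w x" for x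
    by (rule LIMSEQ_le_const2[OF tendsto_rabs[OF lim]]) (use dom in blast)
  have ints: "integrable lborel (\<lambda>x. indicator {0..1} x * s i x)" for i
    by (rule Bochner_Integration.integrable_bound[OF int]) (use dom w0 in \<open>auto simp: abs_mult indicator_def\<close>)
  have intg: "integrable lborel (\<lambda>x. indicator {0..1} x * g x)"
    by (rule Bochner_Integration.integrable_bound[OF int]) (use gw w0 in \<open>auto simp: abs_mult indicator_def\<close>)
  have L1: "(\<lambda>i. \<integral>x. C * (indicator {0..1} x * \<bar>s i x - g x\<bar>) \<partial>lborel) \<longlonglongrightarrow> (\<integral>x. 0 \<partial>(lborel :: real measure))"
  proof (rule integral_dominated_convergence[where w = "\<lambda>x. C * (2 * (indicator {0..1} x * w x))"])
    show "integrable lborel (\<lambda>x. C * (2 * (indicator {0..1} x * w x)))" using int by simp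
    show "AE x in lborel. (\<lambda>i. C * (indicator {0..1} x * \<bar>s i x - g x\<bar>)) \<longlonglongrightarrow> 0"
    proof (intro AE_I2)
      fix x
      have "(\<lambda>i. C * (indicator {0..1} x * \<bar>s i x - g x\<bar>)) \<longlonglongrightarrow> C * (indicator {0..1} x * \<bar>g x - g x\<bar>)"
        by (intro tendsto_intros lim)
      then show "(\<lambda>i. C * (indicator {0..1} x * \<bar>s i x - g x\<bar>)) \<longlonglongrightarrow> 0" by simp
    qed
    show "AE x in lborel. norm (C * (indicator {0..1} x * \<bar>s i x - g x\<bar>)) \<le> C * (2 * (indicator {0..1} x * w x))" for i
    proof (intro AE_I2)
      fix x
      have "\<bar>s i x - g x\<bar> \<le> 2 * w x" using dom[of i x] gw[of x] by linarith
      then show "norm (C * (indicator {0..1} x * \<bar>s i x - g x\<bar>)) \<le> C * (2 * (indicator {0..1} x * w x))"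
        using C_nonneg by (auto simp: abs_mult indicator_def intro!: mult_left_mono)
    qed
  qed auto
  have "0 < r / 2" using r by simp
  from LIMSEQ_D[OF L1 this] obtain i
    where "norm ((\<integral>x. C * (indicator {0..1} x * \<bar>s i x - g x\<bar>) \<partial>lborel) - (\<integral>x. 0 \<partial>(lborel :: real measure))) < r / 2"
    by blast
  then have i: "(\<integral>x. C * (indicator {0..1} x * \<bar>s i x - g x\<bar>) \<partial>lborel) < r / 2"
    unfolding Bochner_Integration.integral_zero real_norm_def by linarith
  obtain N where N: "\<And>n. n \<ge> N \<Longrightarrow> \<bar>\<integral>x. u n x * s i x \<partial>lborel\<bar> < r / 2"
    using LIMSEQ_D[OF van[of i, unfolded vanishes_def], of "r / 2"] r by auto
  show "\<exists>no. \<forall>n\<ge>no. norm ((\<integral>x. u n x * g x \<partial>lborel) - 0) < r"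
  proof (intro exI[of _ N] allI impI)
    fix n assume n: "N \<le> n"
    have "(\<integral>x. u n x * g x \<partial>lborel) - (\<integral>x. u n x * s i x \<partial>lborel) = (\<integral>x. u n x * g x - u n x * s i x \<partial>lborel)"
      by (intro Bochner_Integration.integral_diff[symmetric] integrable_u_mult ints intg) auto
    also have "\<bar>\<dots>\<bar> \<le> (\<integral>x. \<bar>u n x * g x - u n x * s i x\<bar> \<partial>lborel)" by (rule integral_abs_bound)
    also have "\<dots> \<le> (\<integral>x. C * (indicator {0..1} x * \<bar>s i x - g x\<bar>) \<partial>lborel)"
    proof (rule integral_mono)
      show "integrable lborel (\<lambda>x. \<bar>u n x * g x - u n x * s i x\<bar>)"
        by (intro integrable_abs Bochner_Integration.integrable_diff integrable_u_mult ints intg) auto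
      have "integrable lborel (\<lambda>x. C * \<bar>indicator {0..1} x * s i x - indicator {0..1} x * g x\<bar>)"
        by (intro integrable_mult_right integrable_abs Bochner_Integration.integrable_diff ints intg)
      moreover have "\<bar>indicator {0..1} x * s i x - indicator {0..1} x * g x\<bar> = indicator {0..1} x * \<bar>s i x - g x\<bar>" for x
        by (simp add: indicator_def)
      ultimately show "integrable lborel (\<lambda>x. C * (indicator {0..1} x * \<bar>s i x - g x\<bar>))" by simp
      fix x
      have "\<bar>u n x * g x - u n x * s i x\<bar> = \<bar>u n x\<bar> * \<bar>s i x - g x\<bar>"
        by (simp add: abs_minus_commute flip: right_diff_distrib abs_mult)
      also have "\<dots> \<le> C * indicator {0..1} x * \<bar>s i x - g x\<bar>" by (intro mult_right_mono u_bound) auto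
      finally show "\<bar>u n x * g x - u n x * s i x\<bar> \<le> C * (indicator {0..1} x * \<bar>s i x - g x\<bar>)" by (simp add: mult.assoc)
    qed
    finally show "norm ((\<integral>x. u n x * g x \<partial>lborel) - 0) < r" using i N[OF n] by simp
  qed
qed

text \<open>Half-lines generate the Borel sets, so Dynkin's lemma reaches all of these; simple
  functions and dominated limits do the rest. The uniform bound on u lets
  \<open>vanishes_limit\<close> interchange the limit in n with the approximation.\<close>

lemma vanishes_integrable:
  assumes gen: "\<And>a. vanishes (indicator {a..})" and g: "integrable lborel g"
  shows "vanishes g"
proof -
  have univ: "vanishes (indicator UNIV)"
  proof -
    have "(\<integral>x. u n x * indicator {0..} x \<partial>lborel) = (\<integral>x. u n x * indicator UNIV x \<partial>lborel)" for n
    proof (intro Bochner_Integration.integral_cong refl)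
      show "u n x * indicator {0..} x = u n x * indicator UNIV x" for x
        using u_bound[of n x] by (auto simp: indicator_def split: if_splits)
    qed
    then show ?thesis using gen[of 0] by (simp add: vanishes_def)
  qed
  have sets: "vanishes (indicator A)" if "A \<in> sets borel" for A
  proof -
    have A: "A \<in> sigma_sets UNIV (range (\<lambda>a::real. {..<a}))"
      using that by (simp add: borel_Iio)
    have int: "Int_stable (range (\<lambda>a::real. {..<a}))"
    proof (rule Int_stableI)
      fix a b :: "real set" assume "a \<in> range lessThan" "b \<in> range lessThan"
      then obtain x y where "a = {..<x}" "b = {..<y}" by auto
      then have "a \<inter> b = {..<min x y}" by auto
      then show "a \<inter> b \<in> range lessThan" by blast
    qed
    have G: "range (\<lambda>a::real. {..<a}) \<subseteq> Pow UNIV" by simp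
    from int G A show ?thesis
    proof (induction rule: sigma_sets_induct_disjoint)
      case (basic A)
      then obtain a where A: "A = {..<a}" by auto
      have "vanishes (\<lambda>x. indicator UNIV x - indicator {a..} x)"
        by (rule vanishes_diff[OF _ _ univ gen]) auto
      moreover have "(\<lambda>x. indicator UNIV x - indicator {a..} x) = (indicator A :: real \<Rightarrow> real)"
        by (auto simp: A indicator_def fun_eq_iff)
      ultimately show ?case by simp
    next
      case empty
      then show ?case by (simp add: vanishes_def)
    next
      case (compl A)
      then have "A \<in> sets borel" by (simp add: borel_Iio)
      then have "vanishes (\<lambda>x. indicator UNIV x - indicator A x)"
        using compl by (intro vanishes_diff univ) auto
      moreover have "(\<lambda>x. indicator UNIV x - indicator A x) = (indicator (UNIV - A) :: real \<Rightarrow> real)"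
        by (auto simp: indicator_def fun_eq_iff)
      ultimately show ?case by simp
    next
      case (union A)
      have A: "A i \<in> sets borel" for i
      proof -
        have "A i \<in> sigma_sets UNIV (range (\<lambda>a::real. {..<a}))" using union by auto
        then show ?thesis by (simp add: borel_Iio)
      qed
      show ?case
      proof (rule vanishes_limit[where s = "\<lambda>N. indicator (\<Union>i<N. A i)" and w = "\<lambda>_. 1"])
        show "(\<lambda>N. indicator (\<Union>i<N. A i) x :: real) \<longlonglongrightarrow> indicator (\<Union>i. A i) x" for x
          by (rule LIMSEQ_indicator_UN)
        show "vanishes (indicator (\<Union>i<N. A i))" for N
        proof -
          have "disjoint_family_on A {..<N}" using union(1) by (auto simp: disjoint_family_on_def)
          then have "indicator (\<Union>i<N. A i) x = (\<Sum>i<N. indicator (A i) x :: real)" for x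
            by (rule indicator_UN_disjoint[OF finite_lessThan])
          then have "(\<integral>x. u n x * indicator (\<Union>i<N. A i) x \<partial>lborel) = (\<integral>x. (\<Sum>i<N. u n x * indicator (A i) x) \<partial>lborel)" for n
            by (simp only: sum_distrib_left)
          then have "(\<integral>x. u n x * indicator (\<Union>i<N. A i) x \<partial>lborel) = (\<Sum>i<N. \<integral>x. u n x * indicator (A i) x \<partial>lborel)" for n
            by (simp only: Bochner_Integration.integral_sum[OF integrable_u_indicator[OF A]])
          moreover have "(\<lambda>n. \<Sum>i<N. \<integral>x. u n x * indicator (A i) x \<partial>lborel) \<longlonglongrightarrow> (\<Sum>i<N. 0)"
            using union(3) by (intro tendsto_sum) (simp add: vanishes_def)
          ultimately show ?thesis by (simp add: vanishes_def)
        qed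
        have "integrable lborel (indicator {0..1} :: real \<Rightarrow> real)" by (intro integrable_real_indicator) auto
        then show "integrable lborel (\<lambda>x::real. indicator {0..1} x * 1 :: real)" by simp
        show "\<bar>indicator (\<Union>i<N. A i) x\<bar> \<le> (1 :: real)" for N x by (simp add: indicator_def)
      qed (use A in auto)
    qed
  qed
  have int01: "integrable lborel (\<lambda>x. indicator {0..1} x * f x)" if "integrable lborel f" for f :: "real \<Rightarrow> real"
    using integrable_mult_indicator[of "{0..1}" lborel f] that by simp
  have meas: "f \<in> borel_measurable borel" if "integrable lborel f" for f :: "real \<Rightarrow> real"
    using borel_measurable_integrable[OF that] by simp
  show ?thesis
    using g
  proof (induct rule: integrable_induct)
    case (base A c)
    then have "vanishes (indicator A)" by (intro sets) simp
    then have "(\<lambda>n. c * (\<integral>x. u n x * indicator A x \<partial>lborel)) \<longlonglongrightarrow> c * 0"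
      unfolding vanishes_def by (intro tendsto_intros)
    moreover have "(\<integral>x. u n x * (indicator A x *\<^sub>R c) \<partial>lborel) = c * (\<integral>x. u n x * indicator A x \<partial>lborel)" for n
      by (simp add: mult_ac flip: integral_mult_right_zero)
    ultimately show ?case by (simp add: vanishes_def)
  next
    case (add f g)
    have "integrable lborel (\<lambda>x. u n x * f x)" "integrable lborel (\<lambda>x. u n x * g x)" for n
      using add(1,3) by (auto intro!: integrable_u_mult int01 meas)
    then have "(\<integral>x. u n x * (f x + g x) \<partial>lborel) = (\<integral>x. u n x * f x \<partial>lborel) + (\<integral>x. u n x * g x \<partial>lborel)" for n
      by (simp add: distrib_left)
    then show ?case using tendsto_add[OF add(2,4)[unfolded vanishes_def]]
      by (simp add: vanishes_def)
  next
    case (lim f s)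
    show ?case
    proof (rule vanishes_limit[where s = s and w = "\<lambda>x. 2 * \<bar>f x\<bar>"])
      show "integrable lborel (\<lambda>x. indicator {0..1} x * (2 * \<bar>f x\<bar>))"
        using lim(5) by (intro int01) simp
      show "s i \<in> borel_measurable borel" for i by (rule meas[OF lim(1)])
      show "f \<in> borel_measurable borel" by (rule meas[OF lim(5)])
      show "vanishes (s i)" for i by (rule lim(2))
      show "(\<lambda>i. s i x) \<longlonglongrightarrow> f x" for x using lim(3)[of x] by simp
      show "\<bar>s i x\<bar> \<le> 2 * \<bar>f x\<bar>" for i x using lim(4)[of x i] by simp
    qed
  qed
qed

end

section \<open>Invariance of the product measure under the random map\<close>

locale acs_system = polynomial_system +
  fixes \<mu> :: "real measure"
  assumes acs: "acs_measure p T \<mu>" and prob_\<mu>: "prob_space \<mu>"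
begin

definition skew_measure :: "((nat \<Rightarrow> 'a) \<times> real) measure" where
  "skew_measure = bernoulli_measure p \<Otimes>\<^sub>M \<mu>"

lemma sets_\<mu>: "sets \<mu> = sets (restrict_space borel {0..1})"
  using acs by (simp add: acs_measure_def)

lemma space_\<mu>: "space \<mu> = {0..1}"
  using sets_eq_imp_space_eq[OF sets_\<mu>] by (simp add: space_restrict_space)

lemma sets_skew_measure: "sets skew_measure = sets (phase p)"
  unfolding skew_measure_def phase_def by (intro sets_pair_measure_cong sets_\<mu> refl)

lemma space_skew_measure [simp]: "space skew_measure = UNIV \<times> {0..1}"
  by (simp add: skew_measure_def space_pair_measure space_\<mu>)

lemma bounded_measurable_skew_measure: "bounded_measurable skew_measure = bounded_measurable (phase p)"
  by (rule bounded_measurable_sets_cong[OF sets_skew_measure])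

lemma prob_space_skew_measure: "prob_space skew_measure"
proof -
  interpret S: prob_space "bernoulli_measure p" by (rule prob_space_bernoulli)
  interpret \<mu>: prob_space \<mu> by (rule prob_\<mu>)
  interpret pair_prob_space "bernoulli_measure p" \<mu> by unfold_locales
  show ?thesis unfolding skew_measure_def by unfold_locales
qed

lemma measurable_T_\<mu>: "T j \<in> measurable \<mu> \<mu>"
proof -
  have "T j \<in> measurable (restrict_space borel {0..1}) (restrict_space borel {0..1})"
    using measurable_T T_range by (intro measurable_restrict_space2) (auto simp: space_restrict_space)
  then show ?thesis by (simp add: measurable_cong_sets[OF sets_\<mu> sets_\<mu>])
qed

text \<open>The defining identity of an acs measure says that \<mu> is the image of p \<times> \<mu>
  under (j, x) \<mapsto> T j x; the rest is transport of integrals and Fubini's theorem.\<close>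

lemma integral_T_invariant:
  assumes g: "g \<in> bounded_measurable \<mu>"
  shows "(\<Sum>j\<in>UNIV. pmf p j * (\<integral>x. g (T j x) \<partial>\<mu>)) = (\<integral>x. g x \<partial>\<mu>)"
proof -
  interpret \<mu>: prob_space \<mu> by (rule prob_\<mu>)
  interpret pr: pair_prob_space "measure_pmf p" \<mu> by unfold_locales
  have meas: "(\<lambda>z. T (fst z) (snd z)) \<in> measurable (measure_pmf p \<Otimes>\<^sub>M \<mu>) \<mu>"
  proof (rule measurable_compose_countable)
    show "(\<lambda>z. T j (snd z)) \<in> measurable (measure_pmf p \<Otimes>\<^sub>M \<mu>) \<mu>" for j
      by (rule measurable_compose[OF measurable_snd measurable_T_\<mu>])
    show "fst \<in> measurable (measure_pmf p \<Otimes>\<^sub>M \<mu>) (count_space UNIV)"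
      using measurable_fst[of "measure_pmf p" \<mu>] by (simp cong: measurable_cong_sets)
  qed
  have distr: "distr (measure_pmf p \<Otimes>\<^sub>M \<mu>) \<mu> (\<lambda>z. T (fst z) (snd z)) = \<mu>"
  proof (rule measure_eqI)
    fix A assume "A \<in> sets (distr (measure_pmf p \<Otimes>\<^sub>M \<mu>) \<mu> (\<lambda>z. T (fst z) (snd z)))"
    then have A: "A \<in> sets \<mu>" by simp
    let ?B = "(\<lambda>z. T (fst z) (snd z)) -` A \<inter> space (measure_pmf p \<Otimes>\<^sub>M \<mu>)"
    have B: "?B \<in> sets (measure_pmf p \<Otimes>\<^sub>M \<mu>)" by (rule measurable_sets[OF meas A])
    have "emeasure (distr (measure_pmf p \<Otimes>\<^sub>M \<mu>) \<mu> (\<lambda>z. T (fst z) (snd z))) A = emeasure (measure_pmf p \<Otimes>\<^sub>M \<mu>) ?B"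
      by (rule emeasure_distr[OF meas A])
    also have "\<dots> = (\<integral>\<^sup>+j. emeasure \<mu> (Pair j -` ?B) \<partial>measure_pmf p)"
      by (rule \<mu>.emeasure_pair_measure_alt[OF B])
    also have "\<dots> = (\<integral>\<^sup>+j. emeasure \<mu> (T j -` A \<inter> {0..1}) \<partial>measure_pmf p)"
      by (intro nn_integral_cong arg_cong[of _ _ "emeasure \<mu>"]) (auto simp: space_pair_measure space_\<mu>)
    also have "\<dots> = (\<Sum>j\<in>UNIV. emeasure \<mu> (T j -` A \<inter> {0..1}) * ennreal (pmf p j))"
      by (rule nn_integral_measure_pmf_support) auto
    also have "\<dots> = emeasure \<mu> A"
      using acs A by (simp add: acs_measure_def mult.commute)
    finally show "emeasure (distr (measure_pmf p \<Otimes>\<^sub>M \<mu>) \<mu> (\<lambda>z. T (fst z) (snd z))) A = emeasure \<mu> A" .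
  qed simp
  have gm: "g \<in> borel_measurable \<mu>" using g by (rule bounded_measurable_measurable)
  have int: "integrable (measure_pmf p \<Otimes>\<^sub>M \<mu>) (\<lambda>z. g (T (fst z) (snd z)))"
    by (rule pr.integrable_bounded_measurable[OF bounded_measurable_compose[OF g meas]])
  have "(\<integral>x. g x \<partial>\<mu>) = (\<integral>x. g x \<partial>distr (measure_pmf p \<Otimes>\<^sub>M \<mu>) \<mu> (\<lambda>z. T (fst z) (snd z)))"
    by (simp only: distr)
  also have "\<dots> = (\<integral>z. g (T (fst z) (snd z)) \<partial>(measure_pmf p \<Otimes>\<^sub>M \<mu>))"
    by (rule integral_distr[OF meas gm])
  also have "\<dots> = (\<integral>j. (\<integral>x. g (T j x) \<partial>\<mu>) \<partial>measure_pmf p)"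
    using pr.integral_fst'[OF int] by simp
  also have "\<dots> = (\<Sum>j\<in>UNIV. pmf p j * (\<integral>x. g (T j x) \<partial>\<mu>))"
    by (subst integral_measure_pmf[of UNIV]) auto
  finally show ?thesis by simp
qed

lemma integral_F_invariant:
  assumes \<phi>: "\<phi> \<in> bounded_measurable (phase p)"
  shows "(\<integral>z. \<phi> (F z) \<partial>skew_measure) = (\<integral>z. \<phi> z \<partial>skew_measure)"
proof -
  interpret S: prob_space "bernoulli_measure p" by (rule prob_space_bernoulli)
  interpret \<mu>: prob_space \<mu> by (rule prob_\<mu>)
  interpret pr: pair_prob_space "bernoulli_measure p" \<mu> by unfold_locales
  have \<phi>N: "\<phi> \<in> bounded_measurable (bernoulli_measure p \<Otimes>\<^sub>M \<mu>)"
    using \<phi> bounded_measurable_skew_measure by (simp add: skew_measure_def)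
  have \<phi>F: "(\<lambda>z. \<phi> (F z)) \<in> bounded_measurable (bernoulli_measure p \<Otimes>\<^sub>M \<mu>)"
    using bounded_measurable_compose[OF \<phi> measurable_F] bounded_measurable_skew_measure by (simp add: skew_measure_def)
  obtain C where C: "\<And>z. z \<in> space (bernoulli_measure p \<Otimes>\<^sub>M \<mu>) \<Longrightarrow> \<bar>\<phi> (F z)\<bar> \<le> C"
    using \<phi>F unfolding bounded_measurable_def by blast
  have Tm: "(\<lambda>z. (fst z, T j (snd z))) \<in> measurable (bernoulli_measure p \<Otimes>\<^sub>M \<mu>) (bernoulli_measure p \<Otimes>\<^sub>M \<mu>)" for j
    by (intro measurable_Pair measurable_fst measurable_compose[OF measurable_snd measurable_T_\<mu>])
  have intT: "integrable (bernoulli_measure p \<Otimes>\<^sub>M \<mu>) (\<lambda>z. \<phi> (fst z, T j (snd z)))" for j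
    by (rule pr.integrable_bounded_measurable[OF bounded_measurable_compose[OF \<phi>N Tm]])
  have int: "integrable (bernoulli_measure p \<Otimes>\<^sub>M \<mu>) \<phi>"
    by (rule pr.integrable_bounded_measurable[OF \<phi>N])
  have sec: "(\<lambda>x. \<phi> (\<omega>, x)) \<in> bounded_measurable \<mu>" for \<omega>
    by (rule bounded_measurable_compose[OF \<phi>N]) simp
  have "(\<integral>z. \<phi> (F z) \<partial>skew_measure) =
      (\<Sum>j\<in>UNIV. pmf p j * (\<integral>z. \<phi> (F (case_nat j (fst z), snd z)) \<partial>(bernoulli_measure p \<Otimes>\<^sub>M \<mu>)))"
    unfolding skew_measure_def
    by (rule integral_bernoulli_pair_cons[OF prob_\<mu> bounded_measurable_measurable[OF \<phi>F] C])
  also have "\<dots> = (\<Sum>j\<in>UNIV. pmf p j * (\<integral>\<omega>. (\<integral>x. \<phi> (\<omega>, T j x) \<partial>\<mu>) \<partial>bernoulli_measure p))"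
    using pr.integral_fst'[OF intT] by (simp add: random_map_def)
  also have "\<dots> = (\<integral>\<omega>. (\<Sum>j\<in>UNIV. pmf p j * (\<integral>x. \<phi> (\<omega>, T j x) \<partial>\<mu>)) \<partial>bernoulli_measure p)"
    using pr.integrable_fst'[OF intT] by (subst Bochner_Integration.integral_sum) auto
  also have "\<dots> = (\<integral>\<omega>. (\<integral>x. \<phi> (\<omega>, x) \<partial>\<mu>) \<partial>bernoulli_measure p)"
    by (simp only: integral_T_invariant[OF sec])
  also have "\<dots> = (\<integral>z. \<phi> z \<partial>skew_measure)"
    unfolding skew_measure_def by (rule pr.integral_fst'[OF int])
  finally show ?thesis .
qed

lemma integral_F_iterate:
  assumes \<phi>: "\<phi> \<in> bounded_measurable (phase p)"
  shows "(\<integral>z. \<phi> ((F ^^ n) z) \<partial>skew_measure) = (\<integral>z. \<phi> z \<partial>skew_measure)"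
proof (induction n)
  case (Suc n)
  have "(\<integral>z. \<phi> ((F ^^ Suc n) z) \<partial>skew_measure) = (\<integral>z. \<phi> ((F ^^ n) (F z)) \<partial>skew_measure)"
    by (simp add: funpow_swap1)
  also have "\<dots> = (\<integral>z. \<phi> ((F ^^ n) z) \<partial>skew_measure)"
    by (rule integral_F_invariant[OF bounded_measurable_compose[OF \<phi> measurable_F_iterate]])
  finally show ?case using Suc by simp
qed simp

text \<open>Integrating out the symbols leaves a function of x, so weak convergence can be studied
  on the interval. The indicator extends it by 0 to the line, where affine substitution is
  available.\<close>

definition averaged :: "((nat \<Rightarrow> 'a) \<times> real \<Rightarrow> real) \<Rightarrow> nat \<Rightarrow> real \<Rightarrow> real" where
  "averaged \<phi> n x = indicator {0..1} x * (\<integral>\<omega>. \<phi> ((F ^^ n) (\<omega>, x)) \<partial>bernoulli_measure p)"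

lemma averaged_measurable:
  assumes \<phi>: "\<phi> \<in> bounded_measurable (phase p)"
  shows "averaged \<phi> n \<in> borel_measurable borel"
proof -
  interpret S: prob_space "bernoulli_measure p" by (rule prob_space_bernoulli)
  have "(\<lambda>z. \<phi> ((F ^^ n) z)) \<in> borel_measurable (phase p)"
    by (rule bounded_measurable_measurable[OF bounded_measurable_compose[OF \<phi> measurable_F_iterate]])
  then have m: "(\<lambda>(x, \<omega>). \<phi> ((F ^^ n) (\<omega>, x))) \<in> borel_measurable (restrict_space borel {0..1} \<Otimes>\<^sub>M bernoulli_measure p)"
    unfolding phase_def by (subst measurable_pair_swap_iff) (simp add: case_prod_unfold)
  have "(\<lambda>x. \<integral>\<omega>. \<phi> ((F ^^ n) (\<omega>, x)) \<partial>bernoulli_measure p) \<in> borel_measurable (restrict_space borel {0..1})"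
    using S.borel_measurable_lebesgue_integral[OF m] by simp
  then show ?thesis
    unfolding averaged_def[abs_def] by (subst (asm) borel_measurable_restrict_space_iff) auto
qed

lemma section_bounded_measurable:
  assumes \<phi>: "\<phi> \<in> bounded_measurable (phase p)" and x: "x \<in> {0..1}"
  shows "(\<lambda>\<omega>. \<phi> ((F ^^ n) (\<omega>, x))) \<in> bounded_measurable (bernoulli_measure p)"
proof (rule bounded_measurable_compose[OF \<phi> measurable_compose[OF _ measurable_F_iterate]])
  show "(\<lambda>\<omega>. (\<omega>, x)) \<in> measurable (bernoulli_measure p) (phase p)"
    using x by (intro measurable_into_phase) auto
qed

lemma averaged_bound:
  assumes \<phi>: "\<phi> \<in> bounded_measurable (phase p)" and C: "\<And>z. z \<in> space (phase p) \<Longrightarrow> \<bar>\<phi> z\<bar> \<le> C"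
  shows "\<bar>averaged \<phi> n x\<bar> \<le> C * indicator {0..1} x"
proof (cases "x \<in> {0..1}")
  case True
  interpret S: prob_space "bernoulli_measure p" by (rule prob_space_bernoulli)
  have "\<bar>\<phi> ((F ^^ n) (\<omega>, x))\<bar> \<le> C" for \<omega>
    using measurable_space[OF measurable_F_iterate, of "(\<omega>, x)"] True by (intro C) auto
  then show ?thesis using True
    S.abs_integral_le[OF S.integrable_bounded_measurable[OF section_bounded_measurable[OF \<phi> True]]]
    by (simp add: averaged_def)
qed (simp add: averaged_def)

text \<open>All maps agree on the right half, so the first symbol drops out there.\<close>

lemma averaged_Suc_right:
  assumes \<phi>: "\<phi> \<in> bounded_measurable (phase p)" and x: "1 / 2 \<le> x" "x \<le> 1"
  shows "averaged \<phi> (Suc n) x = averaged \<phi> n (2 * x - 1)"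
proof -
  have x01: "x \<in> {0..1}" "2 * x - 1 \<in> {0..1}" using x by auto
  obtain C where C: "\<And>\<omega>. \<bar>\<phi> ((F ^^ Suc n) (\<omega>, x))\<bar> \<le> C"
    using section_bounded_measurable[OF \<phi> x01(1), of "Suc n"] by (auto simp: bounded_measurable_def)
  have "(\<integral>\<omega>. \<phi> ((F ^^ Suc n) (\<omega>, x)) \<partial>bernoulli_measure p) =
      (\<Sum>j\<in>UNIV. pmf p j * (\<integral>\<omega>. \<phi> ((F ^^ Suc n) (case_nat j \<omega>, x)) \<partial>bernoulli_measure p))"
    by (rule integral_bernoulli_cons[OF bounded_measurable_measurable[OF section_bounded_measurable[OF \<phi> x01(1)]] C])
  also have "\<dots> = (\<integral>\<omega>. \<phi> ((F ^^ n) (\<omega>, 2 * x - 1)) \<partial>bernoulli_measure p)"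
    by (simp only: random_map_iterate_Cons T_right[OF x]) (simp add: sum_pmf_eq_1 flip: sum_distrib_right)
  finally show ?thesis using x01 by (simp add: averaged_def)
qed

text \<open>Substitutes y = 1 - 2 x; the factor 2 is the density of the uniform law on the left
  half.\<close>

lemma pairing_averaged:
  assumes \<phi>: "\<phi> \<in> bounded_measurable (phase p)" and g: "(\<lambda>z. g (snd z)) \<in> bounded_measurable (base p)"
  shows "pairing \<phi> n (\<lambda>z. g (snd z)) = 2 * (\<integral>x. averaged \<phi> n x * (indicator {0..<1/2} x * g (1 - 2 * x)) \<partial>lborel)"
proof -
  interpret S: prob_space "bernoulli_measure p" by (rule prob_space_bernoulli)
  interpret U: prob_space unit_interval by (rule prob_space_unit_interval)
  interpret pr: pair_prob_space "bernoulli_measure p" unit_interval by unfold_locales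
  interpret B: prob_space "base p" by (rule prob_space_base)
  have int: "integrable (bernoulli_measure p \<Otimes>\<^sub>M unit_interval) (\<lambda>(\<omega>, y). \<phi> ((F ^^ n) (embed (\<omega>, y))) * g y)"
    using B.integrable_bounded_measurable[OF bounded_measurable_mult[OF bounded_measurable_iterate[OF \<phi>] g]]
    by (simp add: base_def case_prod_unfold)
  have "pairing \<phi> n (\<lambda>z. g (snd z)) = (\<integral>y. (\<integral>\<omega>. \<phi> ((F ^^ n) (embed (\<omega>, y))) * g y \<partial>bernoulli_measure p) \<partial>unit_interval)"
    using pr.integral_snd[OF int] by (simp add: pairing_def base_def case_prod_unfold)
  also have "\<dots> = (\<integral>y. averaged \<phi> n ((1 - y) / 2) * g y \<partial>unit_interval)"
    by (intro Bochner_Integration.integral_cong refl) (simp add: averaged_def embed_def)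
  also have "\<dots> = (\<integral>y. indicator {0<..1} y *\<^sub>R (averaged \<phi> n ((1 - y) / 2) * g y) \<partial>lborel)"
    by (subst integral_restrict_space) auto
  also have "\<dots> = \<bar>-2\<bar> *\<^sub>R (\<integral>x. indicator {0<..1} (1 + (-2) * x) *\<^sub>R (averaged \<phi> n ((1 - (1 + (-2) * x)) / 2) * g (1 + (-2) * x)) \<partial>lborel)"
    by (rule lborel_integral_real_affine) simp
  also have "\<dots> = 2 * (\<integral>x. averaged \<phi> n x * (indicator {0..<1/2} x * g (1 - 2 * x)) \<partial>lborel)"
    by (auto simp: indicator_def intro!: Bochner_Integration.integral_cong)
  finally show ?thesis .
qed

end

context acs_system
begin

lemma averaged_one: "averaged (\<lambda>_. 1) n x = indicator {0..1} x"
  using prob_space.prob_space[OF prob_space_bernoulli[of p]] by (simp add: averaged_def)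

lemma bounded_test_sequence_averaged:
  assumes "\<phi> \<in> bounded_measurable (phase p)" "\<And>z. z \<in> space (phase p) \<Longrightarrow> \<bar>\<phi> z\<bar> \<le> C"
  shows "bounded_test_sequence (averaged \<phi>) C"
  by unfold_locales (use averaged_measurable averaged_bound assms in auto)

text \<open>A Lipschitz approximation, for large N, of the indicator of y \<le> b; an indicator that
  jumps inside (0, 1] lies in no cone.\<close>

definition cutoff :: "real \<Rightarrow> nat \<Rightarrow> real \<Rightarrow> real" where
  "cutoff b N y = max 0 (min 1 (1 - real N * (y - b)))"

lemma cutoff_range: "0 \<le> cutoff b N y" "cutoff b N y \<le> 1"
  by (auto simp: cutoff_def)

lemma cutoff_measurable [measurable]: "cutoff b N \<in> borel_measurable borel"
  by (simp add: cutoff_def[abs_def])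

lemma cutoff_Lipschitz: "cutoff b N y \<le> cutoff b N y' + real N * \<bar>y - y'\<bar>"
proof -
  define d d' R where "d = real N * (y - b)" and "d' = real N * (y' - b)" and "R = real N * \<bar>y - y'\<bar>"
  have "real N * (y' - y) \<le> R" unfolding R_def by (intro mult_left_mono) auto
  then have "d' \<le> d + R" by (simp add: d_def d'_def algebra_simps)
  moreover have "0 \<le> R" by (simp add: R_def)
  ultimately have "max 0 (min 1 (1 - d)) \<le> max 0 (min 1 (1 - d')) + R" by linarith
  then show ?thesis by (simp add: cutoff_def d_def d'_def R_def)
qed

lemma cutoff_tendsto: "(\<lambda>N. cutoff b N y) \<longlonglongrightarrow> (if y \<le> b then 1 else 0)"
proof (cases "y \<le> b")
  case True
  then have "cutoff b N y = 1" for N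
    by (simp add: cutoff_def mult_nonneg_nonpos)
  then show ?thesis using True by simp
next
  case False
  then obtain M :: nat where M: "1 < real M * (y - b)" using reals_Archimedean3[of "y - b"] by auto
  have "cutoff b N y = 0" if "N \<ge> M" for N
  proof -
    have "real M * (y - b) \<le> real N * (y - b)" using that False by (intro mult_right_mono) auto
    then show ?thesis using M by (simp add: cutoff_def)
  qed
  then have "eventually (\<lambda>N. cutoff b N y = 0) sequentially" by (auto simp: eventually_sequentially)
  then show ?thesis using False by (simp add: tendsto_eventually)
qed

text \<open>Adding N + 1 makes the Lipschitz constant N smaller than every value, so the function
  becomes log-Lipschitz. Constants are in the cone too, hence linearity removes the addition
  later.\<close>

lemma cutoff_cone: "(\<lambda>z. cutoff b N (snd z) + (real N + 1)) \<in> cone aperture"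
proof (rule cone_mono[of 1], use aperture_ge_4 in simp, rule coneI)
  fix z z' assume z: "z \<in> space (base p)" "z' \<in> space (base p)"
  let ?c = "real N + 1" and ?d = "\<bar>snd z - snd z'\<bar>"
  have "cutoff b N (snd z) + ?c \<le> (cutoff b N (snd z') + ?c) + real N * ?d"
    using cutoff_Lipschitz[of b N "snd z" "snd z'"] by simp
  also have "\<dots> \<le> (cutoff b N (snd z') + ?c) + (cutoff b N (snd z') + ?c) * ?d"
    using cutoff_range(1)[of b N "snd z'"] by (intro add_left_mono mult_right_mono) auto
  also have "\<dots> = (1 + ?d) * (cutoff b N (snd z') + ?c)" by (simp add: algebra_simps)
  also have "\<dots> \<le> exp (1 * hdist z z') * (cutoff b N (snd z') + ?c)"
  proof (rule mult_right_mono)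
    show "1 + ?d \<le> exp (1 * hdist z z')"
      using exp_ge_add_one_self[of "hdist z z'"] abs_diff_le_hdist[OF z] unfolding mult_1 by linarith
    show "0 \<le> cutoff b N (snd z') + ?c" using cutoff_range(1)[of b N "snd z'"] by simp
  qed
  finally show "cutoff b N (snd z) + ?c \<le> exp (1 * hdist z z') * (cutoff b N (snd z') + ?c)" .
next
  show "0 \<le> cutoff b N (snd z) + (real N + 1)" for z :: "(nat \<Rightarrow> 'a) \<times> real"
    using cutoff_range(1)[of b N "snd z"] by simp
qed measurable

text \<open>All densities are attracted to the same limit: first cut-off functions on the left half,
  then intervals reaching up to \<open>1\<close> because the right branch is affine and onto, and finally the density of \<open>\<mu>\<close>.\<close>

lemma integral_eq_pairing_limit:
  assumes \<phi>: "\<phi> \<in> bounded_measurable (phase p)" and C: "\<And>z. z \<in> space (phase p) \<Longrightarrow> \<bar>\<phi> z\<bar> \<le> C"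
    and L: "\<And>g. g \<in> cone aperture \<Longrightarrow> (\<lambda>n. pairing \<phi> n g) \<longlonglongrightarrow> L * mass g"
  shows "(\<integral>z. \<phi> z \<partial>skew_measure) = L"
proof -
  let ?D = aperture
  interpret P: prob_space "base p" by (rule prob_space_base)
  \<comment> \<open>Subtracting L on [0, 1] reduces the claim to weak convergence to 0.\<close>
  define u where "u n x = averaged \<phi> n x - L * indicator {0..1} x" for n x
  interpret A: bounded_test_sequence "averaged \<phi>" C by (rule bounded_test_sequence_averaged[OF \<phi> C])
  have um: "u n \<in> borel_measurable borel" for n
    unfolding u_def[abs_def] using A.u_measurable by measurable
  interpret U: bounded_test_sequence u "C + \<bar>L\<bar>"
  proof
    show "u n \<in> borel_measurable borel" for n by (rule um)
    show "\<bar>u n x\<bar> \<le> (C + \<bar>L\<bar>) * indicator {0..1} x" for n x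
      using A.u_bound[of n x] by (auto simp: u_def indicator_def)
  qed
  have int01: "integrable lborel (\<lambda>x. indicator {0..1} x * g x)"
    if "g \<in> borel_measurable borel" "\<And>x. \<bar>g x\<bar> \<le> G" for g :: "real \<Rightarrow> real" and G
  proof (rule Bochner_Integration.integrable_bound[where f = "\<lambda>x. G * indicator {0..1} x"])
    show "integrable lborel (\<lambda>x::real. G * indicator {0..1} x)"
      by (intro integrable_mult_right integrable_real_indicator) auto
    show "AE x in lborel. norm (indicator {0..1} x * g x) \<le> norm (G * indicator {0..1} x)"
      using that(2) by (auto simp: indicator_def intro!: AE_I2 order_trans[OF _ abs_ge_self])
  qed (use that(1) in measurable)
  have left: "U.vanishes (\<lambda>x. indicator {0..<1/2} x * g (1 - 2 * x))"
    if g [measurable]: "g \<in> borel_measurable borel" and G: "\<And>y. \<bar>g y\<bar> \<le> G"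
      and lim: "(\<lambda>n. pairing \<phi> n (\<lambda>z. g (snd z))) \<longlonglongrightarrow> L * mass (\<lambda>z. g (snd z))" for g :: "real \<Rightarrow> real" and G
  proof -
    let ?g = "\<lambda>x. indicator {0..<1/2} x * g (1 - 2 * x)"
    have gb: "(\<lambda>z. g (snd z)) \<in> bounded_measurable (base p)"
      using G by (intro bounded_measurableI[of _ _ G]) auto
    have G0: "0 \<le> G" using G[of 0] by linarith
    have ib: "integrable lborel (\<lambda>x. indicator {0..1} x * ?g x)"
      using G G0 by (intro int01[of _ G]) (auto simp: indicator_def)
    have "mass (\<lambda>z. g (snd z)) = 2 * (\<integral>x. indicator {0..1} x * ?g x \<partial>lborel)"
      using pairing_averaged[OF bounded_measurable_const[of 1] gb, of 0] by (simp add: pairing_one averaged_one)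
    moreover have "(\<integral>x. u n x * ?g x \<partial>lborel) = (\<integral>x. averaged \<phi> n x * ?g x \<partial>lborel) - L * (\<integral>x. indicator {0..1} x * ?g x \<partial>lborel)" for n
    proof -
      have "(\<integral>x. u n x * ?g x \<partial>lborel) = (\<integral>x. averaged \<phi> n x * ?g x - L * (indicator {0..1} x * ?g x) \<partial>lborel)"
        by (simp add: u_def left_diff_distrib mult.assoc)
      also have "\<dots> = (\<integral>x. averaged \<phi> n x * ?g x \<partial>lborel) - (\<integral>x. L * (indicator {0..1} x * ?g x) \<partial>lborel)"
        by (intro Bochner_Integration.integral_diff A.integrable_u_mult integrable_mult_right ib) measurable
      finally show ?thesis by simp
    qed
    ultimately have eq: "(\<integral>x. u n x * ?g x \<partial>lborel) = (pairing \<phi> n (\<lambda>z. g (snd z)) - L * mass (\<lambda>z. g (snd z))) / 2" for n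
      using pairing_averaged[OF \<phi> gb, of n] by simp
    have "(\<lambda>n. (pairing \<phi> n (\<lambda>z. g (snd z)) - L * mass (\<lambda>z. g (snd z))) / 2) \<longlonglongrightarrow> (L * mass (\<lambda>z. g (snd z)) - L * mass (\<lambda>z. g (snd z))) / 2"
      by (intro tendsto_intros lim) auto
    moreover have "(L * mass (\<lambda>z. g (snd z)) - L * mass (\<lambda>z. g (snd z))) / 2 = 0" by simp
    ultimately show ?thesis unfolding U.vanishes_def eq by (simp only:)
  qed
  have cutoff: "(\<lambda>n. pairing \<phi> n (\<lambda>z. cutoff b N (snd z))) \<longlonglongrightarrow> L * mass (\<lambda>z. cutoff b N (snd z))" for b N
  proof -
    let ?c = "real N + 1" and ?g = "\<lambda>z. cutoff b N (snd z) + (real N + 1)"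
    have gc: "?g \<in> cone ?D" by (rule cutoff_cone)
    have one: "(\<lambda>_. 1) \<in> cone ?D" using aperture_pos by (intro cone_const) auto
    have gi: "integrable (base p) ?g" using aperture_pos by (intro integrable_cone[OF _ gc]) auto
    have eq1: "pairing \<phi> n (\<lambda>z. cutoff b N (snd z)) = pairing \<phi> n ?g - ?c * pairing \<phi> n (\<lambda>_. 1)" for n
      using pairing_linear[OF \<phi>, of "{()}" "\<lambda>_. ?g" n ?c] cone_bounded_measurable[OF _ gc] aperture_pos by simp
    have eq2: "mass (\<lambda>z. cutoff b N (snd z)) = mass ?g - ?c * mass (\<lambda>_. 1)"
      using pairing_linear[OF bounded_measurable_const[of 1], of "{()}" "\<lambda>_. ?g" 0 ?c] cone_bounded_measurable[OF _ gc] aperture_pos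
      by (simp add: pairing_one)
    have eq3: "L * (mass ?g - ?c * mass (\<lambda>_. 1)) = L * mass ?g - ?c * (L * mass (\<lambda>_. 1))"
      by (simp only: right_diff_distrib mult_ac)
    show ?thesis
      unfolding eq1 eq2 eq3 by (intro tendsto_intros L gc one)
  qed
  \<comment> \<open>With y = 1 - 2 x, the condition y \<le> 1 - 2 a means x \<ge> a.\<close>
  have left_interval: "U.vanishes (indicator {a..<1/2})" if a: "0 \<le> a" "a \<le> 1 / 2" for a
  proof (rule U.vanishes_limit[where s = "\<lambda>N x. indicator {0..<1/2} x * cutoff (1 - 2 * a) N (1 - 2 * x)" and w = "\<lambda>_. 1"])
    show "(\<lambda>N. indicator {0..<1/2} x * cutoff (1 - 2 * a) N (1 - 2 * x)) \<longlonglongrightarrow> indicator {a..<1/2} x" for x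
    proof -
      have "(\<lambda>N. indicator {0..<1/2} x * cutoff (1 - 2 * a) N (1 - 2 * x)) \<longlonglongrightarrow>
          indicator {0..<1/2} x * (if 1 - 2 * x \<le> 1 - 2 * a then 1 else 0)"
        by (intro tendsto_intros cutoff_tendsto)
      moreover have "indicator {0..<1/2} x * (if 1 - 2 * x \<le> 1 - 2 * a then 1 else 0) = (indicator {a..<1/2} x :: real)"
        using a by (auto simp: indicator_def)
      ultimately show ?thesis by simp
    qed
    show "U.vanishes (\<lambda>x. indicator {0..<1/2} x * cutoff (1 - 2 * a) N (1 - 2 * x))" for N
      using cutoff_range by (intro left[of _ 1] cutoff) auto
    show "integrable lborel (\<lambda>x::real. indicator {0..1} x * 1 :: real)"
      by (rule int01[of _ 1]) auto
    show "\<bar>indicator {0..<1/2} x * cutoff (1 - 2 * a) N (1 - 2 * x)\<bar> \<le> 1" for N x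
      using cutoff_range[of "1 - 2 * a" N "1 - 2 * x"] by (auto simp: indicator_def)
  qed auto
  \<comment> \<open>Integrals of u n over [a, 1]. The inverse x \<mapsto> (1 + x) / 2 of the right
    branch relates time n + 1 to time n with factor 1 / 2.\<close>
  define K where "K n a = (\<integral>x. u n x * indicator {a..} x \<partial>lborel)" for n a
  have K_Suc: "K (Suc n) a = K n (2 * a - 1) / 2" if a: "1 / 2 \<le> a" for n a
  proof -
    have "K (Suc n) a = \<bar>1 / 2\<bar> *\<^sub>R (\<integral>x. u (Suc n) (1 / 2 + 1 / 2 * x) * indicator {a..} (1 / 2 + 1 / 2 * x) \<partial>lborel)"
      unfolding K_def by (rule lborel_integral_real_affine) simp
    also have "(\<integral>x. u (Suc n) (1 / 2 + 1 / 2 * x) * indicator {a..} (1 / 2 + 1 / 2 * x) \<partial>lborel) = K n (2 * a - 1)"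
      unfolding K_def
    proof (intro Bochner_Integration.integral_cong refl)
      fix x :: real
      have ind: "indicator {a..} (1 / 2 + 1 / 2 * x) = (indicator {2 * a - 1..} x :: real)"
        by (auto simp: indicator_def)
      consider "x < 0" | "0 \<le> x \<and> x \<le> 1" | "1 < x" by linarith
      then show "u (Suc n) (1 / 2 + 1 / 2 * x) * indicator {a..} (1 / 2 + 1 / 2 * x) = u n x * indicator {2 * a - 1..} x"
      proof cases
        case 1
        then show ?thesis using a by (simp add: indicator_def)
      next
        case 2
        then show ?thesis using averaged_Suc_right[OF \<phi>, of "1 / 2 + 1 / 2 * x" n]
          unfolding ind by (simp add: u_def)
      next
        case 3
        then show ?thesis by (simp add: u_def averaged_def)
      qed
    qed
    finally show ?thesis by simp
  qed
  have split: "K n a = (\<integral>x. u n x * indicator {a..<1/2} x \<partial>lborel) + K n (1 / 2)" if "a \<le> 1 / 2" for n a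
  proof -
    have "u n x * indicator {a..} x = u n x * indicator {a..<1/2} x + u n x * indicator {1/2..} x" for x
      using that by (auto simp: indicator_def)
    then show ?thesis unfolding K_def using U.integrable_u_indicator by simp
  qed
  \<comment> \<open>The integral over the right half at time n + 1 is half of the integral over
    [0, 1] at time n, and the part of the latter on the left half is known to vanish in the
    limit.\<close>
  have half: "(\<lambda>n. K n (1 / 2)) \<longlonglongrightarrow> 0"
  proof (rule half_recursion_tendsto_0)
    show "K (Suc n) (1 / 2) = (K n (1 / 2) + (\<integral>x. u n x * indicator {0..<1/2} x \<partial>lborel)) / 2" for n
      using K_Suc[of "1 / 2" n] split[of 0 n] by simp
    show "(\<lambda>n. \<integral>x. u n x * indicator {0..<1/2} x \<partial>lborel) \<longlonglongrightarrow> 0"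
      using left_interval[of 0] by (simp add: U.vanishes_def)
  qed
  have K_left: "(\<lambda>n. K n a) \<longlonglongrightarrow> 0" if "0 \<le> a" "a \<le> 1 / 2" for a
    using tendsto_add[OF left_interval[OF that, unfolded U.vanishes_def] half] split[OF that(2)] by simp
  \<comment> \<open>Induction over the dyadic distance of a from 1, which the right branch
    doubles.\<close>
  have K_right: "(\<lambda>n. K n a) \<longlonglongrightarrow> 0" if "0 \<le> a" "a \<le> 1 - (1 / 2) ^ Suc m" for a m
    using that
  proof (induction m arbitrary: a)
    case (Suc m)
    show ?case
    proof (cases "a \<le> 1 / 2")
      case False
      have "(\<lambda>n. K n (2 * a - 1)) \<longlonglongrightarrow> 0" using Suc False by (intro Suc.IH) auto
      then have "(\<lambda>n. K n (2 * a - 1) / 2) \<longlonglongrightarrow> 0 / 2" by (intro tendsto_intros) auto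
      moreover have eq: "K (Suc n) a = K n (2 * a - 1) / 2" for n by (rule K_Suc) (use False in simp)
      ultimately have "(\<lambda>n. K (Suc n) a) \<longlonglongrightarrow> 0" unfolding eq by simp
      then show ?thesis by (rule LIMSEQ_imp_Suc)
    qed (use K_left Suc in auto)
  qed (use K_left in auto)
  have gen: "U.vanishes (indicator {a..})" for a
  proof -
    consider "a < 0" | "0 \<le> a \<and> a < 1" | "1 \<le> a" by linarith
    then have "(\<lambda>n. K n a) \<longlonglongrightarrow> 0"
    proof cases
      case 1
      have "(\<lambda>x. u n x * indicator {a..} x) = (\<lambda>x. u n x * indicator {0..} x)" for n
      proof
        show "u n x * indicator {a..} x = u n x * indicator {0..} x" for x
          using 1 U.u_bound[of n x] by (auto simp: indicator_def split: if_splits)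
      qed
      then have "K n a = K n 0" for n unfolding K_def by (rule arg_cong)
      then show ?thesis using K_left[of 0] by simp
    next
      case 2
      obtain m where "(1 / 2) ^ m < 1 - a" using real_arch_pow_inv[of "1 - a" "1 / 2"] 2 by auto
      moreover have "0 < (1 / 2 :: real) ^ m" by simp
      ultimately have "a \<le> 1 - (1 / 2) ^ Suc m" unfolding power_Suc by linarith
      then show ?thesis using 2 by (intro K_right) auto
    next
      case 3
      have "K n a = (\<integral>x. 0 \<partial>(lborel :: real measure))" for n
        unfolding K_def
      proof (rule integral_cong_AE)
        show "AE x in lborel. u n x * indicator {a..} x = 0"
          using AE_lborel_singleton[of 1]
        proof eventually_elim
          case (elim x)
          then show ?case using 3 U.u_bound[of n x] by (auto simp: indicator_def split: if_splits)
        qed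
      qed (use U.u_measurable in measurable)
      then show ?thesis by simp
    qed
    then show ?thesis by (simp add: U.vanishes_def K_def)
  qed
  interpret \<mu>: prob_space \<mu> by (rule prob_\<mu>)
  interpret S: prob_space "bernoulli_measure p" by (rule prob_space_bernoulli)
  interpret pr: pair_prob_space "bernoulli_measure p" \<mu> by unfold_locales
  let ?M = "restrict_space lborel {0..1::real}"
  have sf: "sigma_finite_measure ?M" by (intro sigma_finite_measure_restrict_space sigma_finite_lborel) auto
  have ac: "absolutely_continuous ?M \<mu>" using acs by (simp add: acs_measure_def)
  have setsM: "sets \<mu> = sets ?M" unfolding sets_\<mu> by (intro sets_restrict_space_cong) simp
  obtain D where D: "D \<in> borel_measurable ?M" "AE x in ?M. RN_deriv ?M \<mu> x = ennreal (D x)" "\<And>x. 0 \<le> D x"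
    using sigma_finite_measure.real_RN_deriv[OF sf \<mu>.finite_measure_axioms ac setsM] by metis
  have dens: "\<mu> = density ?M (\<lambda>x. ennreal (D x))"
  proof -
    have "\<mu> = density ?M (RN_deriv ?M \<mu>)"
      using sigma_finite_measure.density_RN_deriv[OF sf ac setsM] by simp
    also have "\<dots> = density ?M (\<lambda>x. ennreal (D x))"
      by (rule density_cong[OF _ _ D(2)]) (use D(1) in auto)
    finally show ?thesis .
  qed
  define g where "g x = indicator {0..1} x *\<^sub>R D x" for x
  have integral_g: "(\<integral>x. v x \<partial>\<mu>) = (\<integral>x. v x * g x \<partial>lborel)" if v: "v \<in> borel_measurable borel" for v :: "real \<Rightarrow> real"
  proof -
    have vM: "v \<in> borel_measurable ?M" by (rule measurable_restrict_space1) (use v in simp)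
    have "(\<integral>x. v x \<partial>\<mu>) = (\<integral>x. D x *\<^sub>R v x \<partial>?M)"
      by (subst dens, rule integral_density[OF vM D(1)]) (use D(3) in auto)
    also have "\<dots> = (\<integral>x. indicator {0..1} x *\<^sub>R (D x *\<^sub>R v x) \<partial>lborel)"
      by (rule integral_restrict_space) simp
    finally show ?thesis by (simp add: g_def mult_ac)
  qed
  have g_int: "integrable lborel g"
  proof -
    have "integrable \<mu> (\<lambda>_. 1 :: real)" by simp
    then have "integrable ?M (\<lambda>x. D x *\<^sub>R (1::real))"
      using integrable_density[of "\<lambda>_. 1 :: real" ?M D] D(1,3) by (subst (asm) dens) auto
    then show ?thesis unfolding g_def[abs_def]
      using integrable_restrict_space[of "{0..1}" lborel D] by simp
  qed
  have g1: "(\<integral>x. g x \<partial>lborel) = 1"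
    using integral_g[of "\<lambda>_. 1"] \<mu>.prob_space by simp
  \<comment> \<open>By invariance this integral does not depend on n, so its limit L is its
    value.\<close>
  have "(\<integral>x. averaged \<phi> n x * g x \<partial>lborel) = (\<integral>z. \<phi> z \<partial>skew_measure)" for n
  proof -
    have bm: "(\<lambda>z. \<phi> ((F ^^ n) z)) \<in> bounded_measurable skew_measure"
      unfolding bounded_measurable_skew_measure by (rule bounded_measurable_compose[OF \<phi> measurable_F_iterate])
    have int: "integrable (bernoulli_measure p \<Otimes>\<^sub>M \<mu>) (\<lambda>(\<omega>, x). \<phi> ((F ^^ n) (\<omega>, x)))"
      using prob_space.integrable_bounded_measurable[OF prob_space_skew_measure bm]
      by (simp add: skew_measure_def case_prod_unfold)
    have "(\<integral>z. \<phi> z \<partial>skew_measure) = (\<integral>z. \<phi> ((F ^^ n) z) \<partial>skew_measure)"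
      by (rule integral_F_iterate[OF \<phi>, symmetric])
    also have "\<dots> = (\<integral>x. (\<integral>\<omega>. \<phi> ((F ^^ n) (\<omega>, x)) \<partial>bernoulli_measure p) \<partial>\<mu>)"
      using pr.integral_snd[OF int] by (simp add: skew_measure_def case_prod_unfold)
    also have "\<dots> = (\<integral>x. averaged \<phi> n x \<partial>\<mu>)"
      by (intro Bochner_Integration.integral_cong refl) (simp add: averaged_def space_\<mu>)
    also have "\<dots> = (\<integral>x. averaged \<phi> n x * g x \<partial>lborel)" by (rule integral_g[OF A.u_measurable])
    finally show ?thesis by simp
  qed
  moreover have "(\<integral>x. u n x * g x \<partial>lborel) = (\<integral>x. averaged \<phi> n x * g x \<partial>lborel) - L" for n
  proof -
    have gm: "g \<in> borel_measurable borel" using borel_measurable_integrable[OF g_int] by simp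
    have g01: "indicator {0..1} x * g x = g x" for x by (simp add: g_def indicator_def)
    have "u n x * g x = averaged \<phi> n x * g x - L * g x" for x
      unfolding u_def left_diff_distrib mult.assoc g01 by simp
    then have "(\<integral>x. u n x * g x \<partial>lborel) = (\<integral>x. averaged \<phi> n x * g x \<partial>lborel) - (\<integral>x. L * g x \<partial>lborel)"
      using A.integrable_u_mult[OF gm] g_int g01 by simp
    then show ?thesis using g1 by simp
  qed
  ultimately have "(\<lambda>n. (\<integral>z. \<phi> z \<partial>skew_measure) - L) \<longlonglongrightarrow> 0"
    using U.vanishes_integrable[OF gen g_int] by (simp add: U.vanishes_def)
  then show ?thesis by (simp add: LIMSEQ_const_iff)
qed

end

section \<open>Decay of correlations\<close>

lemma sum_shifted_powr_le:
  fixes \<beta> :: real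
  assumes "0 < \<beta>"
  shows "(\<Sum>j\<le>k. (real (j + m) + 1) powr - (1 + \<beta>)) \<le> (1 + 1 / \<beta>) * (real m + 1) powr - \<beta>"
proof -
  have "(\<Sum>j\<le>k. (real (j + m) + 1) powr - (1 + \<beta>)) =
      (real m + 1) powr - (1 + \<beta>) + (\<Sum>j<k. ((real m + 1) + real j + 1) powr - (1 + \<beta>))"
    by (simp add: sum.atMost_shift algebra_simps)
  also have "(\<Sum>j<k. ((real m + 1) + real j + 1) powr - (1 + \<beta>)) \<le> (real m + 1) powr - \<beta> / \<beta>"
    using assms by (intro sum_powr_tail_le) auto
  also have "(real m + 1) powr - (1 + \<beta>) \<le> (real m + 1) powr - \<beta>"
    using assms by (intro powr_mono) auto
  finally show ?thesis by (simp add: algebra_simps)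
qed

text \<open>Adds the bounds of \<open>excursion_decay\<close> over all starting times. The first
  term already carries the rate and is summable in the length of the excursion; the second sums to a
  tail from n div 2 on.\<close>

lemma sum_excursion_bounds_le:
  fixes \<beta> c :: real
  assumes \<beta>: "0 < \<beta>" and c: "0 \<le> c"
  shows "(\<Sum>m\<le>k. c * (2 powr \<beta> * (real n + 1) powr - \<beta> * (real (k - m) + 1) powr - (1 + \<beta>)
      + (real (k - m + n div 2) + 1) powr - (1 + \<beta>))) \<le> c * (2 * (2 powr \<beta> * (1 + 1 / \<beta>))) * (real n + 1) powr - \<beta>"
proof -
  let ?s = "1 + \<beta>" and ?N = "(real n + 1) powr - \<beta>"
  have "(\<Sum>m\<le>k. c * (2 powr \<beta> * ?N * (real (k - m) + 1) powr - ?s + (real (k - m + n div 2) + 1) powr - ?s)) =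
      (\<Sum>j\<le>k. c * (2 powr \<beta> * ?N * (real (j + 0) + 1) powr - ?s + (real (j + n div 2) + 1) powr - ?s))"
    by (rule sum.reindex_bij_witness[of _ "\<lambda>m. k - m" "\<lambda>m. k - m"]) simp_all
  also have "\<dots> = c * (2 powr \<beta> * ?N * (\<Sum>j\<le>k. (real (j + 0) + 1) powr - ?s) + (\<Sum>j\<le>k. (real (j + n div 2) + 1) powr - ?s))"
    by (simp only: sum.distrib flip: sum_distrib_left)
  also have "\<dots> \<le> c * (2 powr \<beta> * ?N * (1 + 1 / \<beta>) + (1 + 1 / \<beta>) * (2 powr \<beta> * ?N))"
  proof (intro mult_left_mono add_mono)
    show "(\<Sum>j\<le>k. (real (j + 0) + 1) powr - ?s) \<le> 1 + 1 / \<beta>"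
      using sum_shifted_powr_le[OF \<beta>, where m = 0 and k = k] by simp
    have "(real (n div 2) + 1) powr - \<beta> \<le> 2 powr \<beta> * ?N"
    proof (rule powr_minus_scale)
      have "n \<le> 2 * (n div 2) + 1" by simp
      then have "real n \<le> real (2 * (n div 2) + 1)" by (rule of_nat_mono)
      then show "real n + 1 \<le> 2 * (real (n div 2) + 1)" by simp
    qed (use \<beta> in auto)
    then have "(1 + 1 / \<beta>) * (real (n div 2) + 1) powr - \<beta> \<le> (1 + 1 / \<beta>) * (2 powr \<beta> * ?N)"
      using \<beta> by (intro mult_left_mono) auto
    then show "(\<Sum>j\<le>k. (real (j + n div 2) + 1) powr - ?s) \<le> (1 + 1 / \<beta>) * (2 powr \<beta> * ?N)"
      using sum_shifted_powr_le[OF \<beta>, where m = "n div 2" and k = k] by linarith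
  qed (use c in auto)
  also have "\<dots> = c * (2 * (2 powr \<beta> * (1 + 1 / \<beta>))) * ?N"
    by (simp only: mult_2 distrib_left distrib_right mult_ac)
  finally show ?thesis .
qed

lemma shifted_powr_tendsto_0:
  fixes \<beta> :: real
  assumes "0 < \<beta>"
  shows "(\<lambda>n. (real n + 1) powr - \<beta>) \<longlonglongrightarrow> 0"
proof -
  have "filterlim (\<lambda>n. 1 + real n) at_top sequentially"
    by (intro filterlim_tendsto_add_at_top[OF tendsto_const] filterlim_real_sequentially)
  then show ?thesis using assms by (intro tendsto_neg_powr) (simp_all add: add.commute)
qed

context acs_system
begin

text \<open>Names the limit in \<open>pairing_rate\<close>: it is the integral against the invariant
  product measure.\<close>

lemma pairing_integral_rate:
  obtains R where "0 \<le> R"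
    and "\<And>\<phi> C g n. \<phi> \<in> bounded_measurable (phase p) \<Longrightarrow> \<forall>z\<in>space (phase p). \<bar>\<phi> z\<bar> \<le> C \<Longrightarrow> g \<in> cone aperture \<Longrightarrow>
      \<bar>pairing \<phi> n g - (\<integral>z. \<phi> z \<partial>skew_measure) * mass g\<bar> \<le> R * C * mass g * (real n + 1) powr - \<beta>"
proof (rule pairing_rate)
  fix R assume R: "0 \<le> R"
    and rate: "\<And>\<phi> C. \<phi> \<in> bounded_measurable (phase p) \<Longrightarrow> (\<And>z. z \<in> space (phase p) \<Longrightarrow> \<bar>\<phi> z\<bar> \<le> C) \<Longrightarrow>
      \<exists>L. \<forall>g\<in>cone aperture. \<forall>n. \<bar>pairing \<phi> n g - L * mass g\<bar> \<le> R * C * mass g * (real n + 1) powr - \<beta>"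
  show thesis
  proof (rule that[OF R])
    fix \<phi> C g n
    assume \<phi>: "\<phi> \<in> bounded_measurable (phase p)" and C: "\<forall>z\<in>space (phase p). \<bar>\<phi> z\<bar> \<le> C"
      and g: "g \<in> cone aperture"
    have "\<exists>L. \<forall>g\<in>cone aperture. \<forall>n. \<bar>pairing \<phi> n g - L * mass g\<bar> \<le> R * C * mass g * (real n + 1) powr - \<beta>"
      by (rule rate[OF \<phi>]) (use C in blast)
    then obtain L where L: "\<And>g n. g \<in> cone aperture \<Longrightarrow>
        \<bar>pairing \<phi> n g - L * mass g\<bar> \<le> R * C * mass g * (real n + 1) powr - \<beta>" by blast
    have "(\<integral>z. \<phi> z \<partial>skew_measure) = L"
    proof (rule integral_eq_pairing_limit[OF \<phi>])
      show "\<bar>\<phi> z\<bar> \<le> C" if "z \<in> space (phase p)" for z using C that by blast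
      fix g assume g: "g \<in> cone aperture"
      have "(\<lambda>n. R * C * mass g * (real n + 1) powr - \<beta>) \<longlonglongrightarrow> R * C * mass g * 0"
        by (intro tendsto_intros shifted_powr_tendsto_0 \<beta>)
      then have "(\<lambda>n. R * C * mass g * (real n + 1) powr - \<beta>) \<longlonglongrightarrow> 0" by simp
      then have "(\<lambda>n. pairing \<phi> n g - L * mass g) \<longlonglongrightarrow> 0"
        by (rule Lim_null_comparison[rotated]) (use L[OF g] in auto)
      then show "(\<lambda>n. pairing \<phi> n g) \<longlonglongrightarrow> L * mass g" by (simp add: LIM_zero_iff)
    qed
    then show "\<bar>pairing \<phi> n g - (\<integral>z. \<phi> z \<partial>skew_measure) * mass g\<bar> \<le> R * C * mass g * (real n + 1) powr - \<beta>"
      using L[OF g] by simp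
  qed
qed

lemma sum_mass_transfer:
  assumes "g \<in> cone aperture" "a \<le> b"
  shows "(\<Sum>i\<in>{a<..b}. mass (transfer i g)) \<le> survivor a g"
  using survivor_decomposition[OF cone_bounded_measurable[OF _ assms(1)] assms(2)] survivor_nonneg[OF assms(1), of b]
    aperture_pos by simp

text \<open>With nothing split off, the recursion lists the visits to the base of the system started
  from Lebesgue measure on the left half. At each time the mass on the base and the masses in
  excursions add up to 1.\<close>

lemma regeneration_0:
  "regeneration (\<lambda>_. 0) (\<lambda>_. 1) m \<in> cone aperture" "mass (regeneration (\<lambda>_. 0) (\<lambda>_. 1) m) \<le> 1"
proof -
  let ?w = "regeneration (\<lambda>_. 0) (\<lambda>_. 1)"
  have rec: "?w m = (\<lambda>z. (\<Sum>i<m. transfer (m - i) (?w i) z) - (\<lambda>_. 0) m)" if "0 < m" for m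
    using that by (subst regeneration.simps) simp
  have cone: "?w m \<in> cone aperture" for m
  proof (induction m rule: less_induct)
    case (less m)
    show ?case
    proof (cases "m = 0")
      case True
      then show ?thesis using aperture_pos by (simp add: regeneration.simps cone_const)
    next
      case False
      have "(\<lambda>z. \<Sum>i<m. transfer (m - i) (?w i) z) \<in> cone (aperture - 3)"
        using aperture_ge_4 less by (intro cone_sum transfer_cone') auto
      then show ?thesis using rec[of m] False by (simp add: cone_mono[of "aperture - 3"])
    qed
  qed
  then show "?w m \<in> cone aperture" .
  have "mass (?w 0) = (\<Sum>i<m. 0) + (\<Sum>i\<le>m. survivor (m - i) (?w i))"
    by (rule mass_telescope[of m ?w "\<lambda>_. 0"]) (use cone_bounded_measurable[OF _ cone] aperture_pos rec in auto)
  moreover have "mass (?w 0) = 1" using mass_one by (simp add: regeneration.simps)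
  moreover have "survivor (m - m) (?w m) \<le> (\<Sum>i\<le>m. survivor (m - i) (?w i))"
    by (rule member_le_sum) (auto intro: survivor_nonneg[OF cone])
  ultimately show "mass (?w m) \<le> 1" by (simp add: survivor_0)
qed

text \<open>The excursion containing time \<open>j\<close> is followed until its end; along an inverse branch
  \<open>h\<close> evaluated at time \<open>j\<close> is a regular density, so that the rate for pairings applies afterwards.\<close>

lemma excursion_decay:
  assumes f: "f \<in> bounded_measurable (phase p)" and Cf: "\<forall>z\<in>space (phase p). \<bar>f z\<bar> \<le> C"
    and h: "h \<in> bounded_measurable (phase p)" and H: "\<And>z. z \<in> space (phase p) \<Longrightarrow> 0 \<le> h z \<and> h z \<le> H"
    and hh: "\<And>z z'. z \<in> space (phase p) \<Longrightarrow> z' \<in> space (phase p) \<Longrightarrow> h z \<le> exp (skew_dist z z' powr \<alpha>) * h z'"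
    and R: "0 \<le> R" "\<And>\<phi> C g n. \<phi> \<in> bounded_measurable (phase p) \<Longrightarrow> \<forall>z\<in>space (phase p). \<bar>\<phi> z\<bar> \<le> C \<Longrightarrow> g \<in> cone aperture \<Longrightarrow>
      \<bar>pairing \<phi> n g - (\<integral>z. \<phi> z \<partial>skew_measure) * mass g\<bar> \<le> R * C * mass g * (real n + 1) powr - \<beta>"
    and A: "0 < A" "\<And>g n. g \<in> cone aperture \<Longrightarrow> survivor n g \<le> A * (real n + 1) powr - (1 + \<beta>) * mass g"
    and g: "g \<in> cone aperture" "mass g \<le> 1"
  shows "\<bar>excursion (\<lambda>z. (f ((F ^^ n) z) - (\<integral>z. f z \<partial>skew_measure)) * h z) j g\<bar> \<le>
    (R + 2) * C * H * A * (2 powr \<beta> * (real n + 1) powr - \<beta> * (real j + 1) powr - (1 + \<beta>)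
      + (real (j + n div 2) + 1) powr - (1 + \<beta>))"
proof -
  interpret B: prob_space "base p" by (rule prob_space_base)
  interpret N: prob_space skew_measure by (rule prob_space_skew_measure)
  let ?s = "1 + \<beta>" and ?m = "n div 2"
  \<comment> \<open>Half of the n steps are reserved for relaxation after the return.\<close>
  define m where "m = n div 2"
  define c where "c = (\<integral>z. f z \<partial>skew_measure)"
  have D0: "0 \<le> aperture" using aperture_pos by simp
  have "\<bar>f (undefined, 0)\<bar> \<le> C" using bspec[OF Cf, of "(undefined, 0)"] by simp
  then have C0: "0 \<le> C" by linarith
  have H0: "0 \<le> H" using H[of "(undefined, 0)"] by auto
  have c: "\<bar>c\<bar> \<le> C"
    unfolding c_def
  proof (rule N.abs_integral_le[OF N.integrable_bounded_measurable])
    show "f \<in> bounded_measurable skew_measure" using f by (simp only: bounded_measurable_skew_measure)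
    show "\<bar>f z\<bar> \<le> C" if "z \<in> space skew_measure" for z using bspec[OF Cf, of z] that by simp
  qed
  have gb: "g \<in> bounded_measurable (base p)" by (rule cone_bounded_measurable[OF D0 g(1)])
  let ?v = "\<lambda>z. (f ((F ^^ n) ((F ^^ j) (embed z))) - c) * h ((F ^^ j) (embed z))"
  have \<phi>: "(\<lambda>z. (f ((F ^^ n) z) - c) * h z) \<in> bounded_measurable (phase p)"
    by (intro bounded_measurable_mult bounded_measurable_diff bounded_measurable_const h
        bounded_measurable_compose[OF f measurable_F_iterate])
  have v: "?v \<in> bounded_measurable (base p)" by (rule bounded_measurable_iterate[OF \<phi>])
  have v_bound: "\<bar>?v z\<bar> \<le> 2 * C * H" if z: "z \<in> space (base p)" for z
  proof -
    have "\<bar>f ((F ^^ n) ((F ^^ j) (embed z)))\<bar> \<le> C"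
      by (rule bspec[OF Cf measurable_space[OF measurable_F_iterate iterate_embed_space[OF z]]])
    then have "\<bar>f ((F ^^ n) ((F ^^ j) (embed z))) - c\<bar> \<le> 2 * C" using c by linarith
    then show ?thesis using H[OF iterate_embed_space[OF z, of j]] C0 unfolding abs_mult by (intro mult_mono) auto
  qed
  let ?G = "\<lambda>z. ?v z * g z"
  have Gb: "?G \<in> bounded_measurable (base p)" by (intro bounded_measurable_mult v gb)
  have branch: "\<bar>\<integral>z. ?G (branch s z) * jac s (snd z) \<partial>base p\<bar> \<le>
      R * C * H * (real (j + n - length s) + 1) powr - \<beta> * (\<integral>z. g (branch s z) * jac s (snd z) \<partial>base p)"
    if s: "0 < free s" "j < length s" "length s \<le> j + n" for s
  proof -
    let ?k = "j + n - length s"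
    let ?h = "\<lambda>z. h ((F ^^ j) (embed (branch s z)))" and ?g = "\<lambda>z. g (branch s z) * jac s (snd z)"
    have b: "branch s z \<in> space (base p)" if "z \<in> space (base p)" for z
      using measurable_space[OF measurable_branch[OF s(1)] that] .
    have hc: "?h \<in> cone 1"
    proof (rule coneI)
      show "?h \<in> borel_measurable (base p)"
        by (rule measurable_compose[OF measurable_branch[OF s(1)] bounded_measurable_measurable[OF bounded_measurable_iterate[OF h]]])
      show "0 \<le> ?h z" if "z \<in> space (base p)" for z using H[OF iterate_embed_space[OF b[OF that]]] by simp
      fix z z' assume z: "z \<in> space (base p)" "z' \<in> space (base p)"
      have ord: "skew_dist ((F ^^ j) (embed (branch s z))) ((F ^^ j) (embed (branch s z'))) \<le> skew_dist z z'"
        using z s by (intro iterate_branch_nonexpanding) auto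
      have "?h z \<le> exp (hdist ((F ^^ j) (embed (branch s z))) ((F ^^ j) (embed (branch s z')))) * ?h z'"
        unfolding hdist_def by (intro hh iterate_embed_space b z)
      also have "\<dots> \<le> exp (1 * hdist z z') * ?h z'"
        using hdist_mono[OF ord] H[OF iterate_embed_space[OF b[OF z(2)]], of j] by (intro mult_right_mono) auto
      finally show "?h z \<le> exp (1 * hdist z z') * ?h z'" .
    qed
    \<comment> \<open>A branch leaves room 3 below the aperture, which covers the Hoelder constant 1
      contributed by h.\<close>
    have aperture_eq': "(1 / 2) powr \<alpha> * aperture + 1 = aperture - 3" using aperture_eq by linarith
    have gc: "?g \<in> cone (aperture - 3)"
      using branch_cone[OF D0 g(1) s(1)] unfolding aperture_eq' .
    have "1 + (aperture - 3) \<le> aperture" by linarith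
    then have kc: "(\<lambda>z. ?h z * ?g z) \<in> cone aperture"
      by (rule cone_mono) (rule cone_mult[OF hc gc])
    have kb: "(\<lambda>z. ?h z * ?g z) \<in> bounded_measurable (base p)" by (rule cone_bounded_measurable[OF D0 kc])
    have eq1: "(\<integral>z. ?G (branch s z) * jac s (snd z) \<partial>base p) =
        (\<integral>z. f ((F ^^ ?k) (embed z)) * (?h z * ?g z) - c * (?h z * ?g z) \<partial>base p)"
    proof (intro Bochner_Integration.integral_cong refl)
      fix z assume z: "z \<in> space (base p)"
      have "(F ^^ n) ((F ^^ j) (embed (branch s z))) = (F ^^ (j + n)) (embed (branch s z))"
        unfolding add.commute[of j n] funpow_add by simp
      also have "\<dots> = (F ^^ ?k) (embed z)" by (rule iterate_branch'[OF s(1) z s(3)])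
      finally show "?G (branch s z) * jac s (snd z) = f ((F ^^ ?k) (embed z)) * (?h z * ?g z) - c * (?h z * ?g z)"
        by (simp only: left_diff_distrib mult.assoc)
    qed
    have eq2: "(\<integral>z. f ((F ^^ ?k) (embed z)) * (?h z * ?g z) - c * (?h z * ?g z) \<partial>base p) =
        pairing f ?k (\<lambda>z. ?h z * ?g z) - c * mass (\<lambda>z. ?h z * ?g z)"
    proof -
      have i1: "integrable (base p) (\<lambda>z. f ((F ^^ ?k) (embed z)) * (?h z * ?g z))"
        by (rule B.integrable_bounded_measurable[OF bounded_measurable_mult[OF bounded_measurable_iterate[OF f] kb]])
      have i2: "integrable (base p) (\<lambda>z. c * (?h z * ?g z))"
        by (rule integrable_mult_right[OF B.integrable_bounded_measurable[OF kb]])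
      show ?thesis
        unfolding pairing_def Bochner_Integration.integral_diff[OF i1 i2] by (simp only: integral_mult_right_zero)
    qed
    have "\<bar>pairing f ?k (\<lambda>z. ?h z * ?g z) - c * mass (\<lambda>z. ?h z * ?g z)\<bar> \<le>
        R * C * mass (\<lambda>z. ?h z * ?g z) * (real ?k + 1) powr - \<beta>"
      unfolding c_def by (rule R(2)[OF f Cf kc])
    then have "\<bar>\<integral>z. ?G (branch s z) * jac s (snd z) \<partial>base p\<bar> \<le>
        R * C * mass (\<lambda>z. ?h z * ?g z) * (real ?k + 1) powr - \<beta>"
      unfolding eq1 eq2 .
    also have "\<dots> \<le> R * C * (H * mass ?g) * (real ?k + 1) powr - \<beta>"
    proof (intro mult_right_mono mult_left_mono)
      have "mass (\<lambda>z. ?h z * ?g z) \<le> (\<integral>z. H * ?g z \<partial>base p)"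
      proof (rule integral_mono)
        show "integrable (base p) (\<lambda>z. H * ?g z)" by (rule integrable_mult_right, rule integrable_cone[OF _ gc]) (use aperture_ge_4 in linarith)
        show "?h z * ?g z \<le> H * ?g z" if z: "z \<in> space (base p)" for z
          using H[OF iterate_embed_space[OF b[OF z]], of j] cone_nonneg[OF gc z] by (intro mult_right_mono) auto
      qed (rule integrable_cone[OF D0 kc])
      then show "mass (\<lambda>z. ?h z * ?g z) \<le> H * mass ?g" by (simp only: integral_mult_right_zero)
    qed (use R(1) C0 in simp_all)
    also have "\<dots> = R * C * H * (real ?k + 1) powr - \<beta> * mass ?g" by (simp only: mult_ac)
    finally show ?thesis .
  qed
  have step: "\<bar>mass (transfer i ?G)\<bar> \<le> R * C * H * (real (j + n - i) + 1) powr - \<beta> * mass (transfer i g)"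
    if i: "j < i" "i \<le> j + n" for i
  proof -
    have "\<bar>mass (transfer i ?G)\<bar> \<le> (\<Sum>s\<in>{s \<in> words i. 0 < free s}. word_prob p s *
        \<bar>\<integral>z. ?G (branch s z) * jac s (snd z) \<partial>base p\<bar>)"
      unfolding integral_transfer[OF Gb]
      by (rule order_trans[OF sum_abs], rule eq_refl) (simp only: abs_mult abs_of_nonneg[OF word_prob_nonneg])
    also have "\<dots> \<le> (\<Sum>s\<in>{s \<in> words i. 0 < free s}. word_prob p s *
        (R * C * H * (real (j + n - i) + 1) powr - \<beta> * (\<integral>z. g (branch s z) * jac s (snd z) \<partial>base p)))"
    proof (intro sum_mono mult_left_mono)
      fix s assume "s \<in> {s \<in> words i. 0 < free s}"
      then have len: "length s = i" and s: "0 < free s" by (auto simp: words_def)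
      have "j < length s" "length s \<le> j + n" using i len by auto
      from branch[OF s this] show "\<bar>\<integral>z. ?G (branch s z) * jac s (snd z) \<partial>base p\<bar> \<le>
          R * C * H * (real (j + n - i) + 1) powr - \<beta> * (\<integral>z. g (branch s z) * jac s (snd z) \<partial>base p)"
        unfolding len .
    qed simp
    also have "\<dots> = R * C * H * (real (j + n - i) + 1) powr - \<beta> * mass (transfer i g)"
      unfolding integral_transfer[OF gb] sum_distrib_left by (simp only: mult_ac)
    finally show ?thesis .
  qed
  have r0: "0 \<le> mass (transfer i g)" for i by (rule mass_nonneg[OF transfer_cone'[OF g(1)]])
  have surv: "survivor k g \<le> A * (real k + 1) powr - ?s" for k
  proof -
    have "survivor k g \<le> A * (real k + 1) powr - ?s * mass g" by (rule A(2)[OF g(1)])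
    also have "\<dots> \<le> A * (real k + 1) powr - ?s * 1" using A(1) g(2) by (intro mult_left_mono) auto
    finally show ?thesis by simp
  qed
  have m: "m \<le> n" "(real n + 1) / 2 \<le> real (n - m) + 1" by (auto simp: m_def)
  have RCH: "0 \<le> R * C * H" using R(1) C0 H0 by simp
  \<comment> \<open>Returns within m steps after time j leave at least n - m steps for relaxation;
    their mass is at most that of the excursions lasting beyond j.\<close>
  have first: "(\<Sum>i\<in>{j<..j+m}. \<bar>mass (transfer i ?G)\<bar>) \<le>
      R * C * H * (2 powr \<beta> * (real n + 1) powr - \<beta>) * (A * (real j + 1) powr - ?s)"
  proof -
    have "(\<Sum>i\<in>{j<..j+m}. \<bar>mass (transfer i ?G)\<bar>) \<le>
        (\<Sum>i\<in>{j<..j+m}. R * C * H * (2 powr \<beta> * (real n + 1) powr - \<beta>) * mass (transfer i g))"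
    proof (rule sum_mono)
      fix i assume i: "i \<in> {j<..j+m}"
      have "\<bar>mass (transfer i ?G)\<bar> \<le> R * C * H * (real (j + n - i) + 1) powr - \<beta> * mass (transfer i g)"
        using i m by (intro step) auto
      also have "(real (j + n - i) + 1) powr - \<beta> \<le> 2 powr \<beta> * (real n + 1) powr - \<beta>"
      proof (rule powr_minus_scale)
        have "n - m \<le> j + n - i" using i m by auto
        then have "real (n - m) \<le> real (j + n - i)" by (rule of_nat_mono)
        then show "real n + 1 \<le> 2 * (real (j + n - i) + 1)" using m by simp
      qed (use \<beta> in auto)
      finally show "\<bar>mass (transfer i ?G)\<bar> \<le> R * C * H * (2 powr \<beta> * (real n + 1) powr - \<beta>) * mass (transfer i g)"
        using RCH r0[of i] by (simp add: mult_left_mono mult_right_mono)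
    qed
    also have "\<dots> = R * C * H * (2 powr \<beta> * (real n + 1) powr - \<beta>) * (\<Sum>i\<in>{j<..j+m}. mass (transfer i g))"
      by (simp only: sum_distrib_left)
    also have "\<dots> \<le> R * C * H * (2 powr \<beta> * (real n + 1) powr - \<beta>) * (A * (real j + 1) powr - ?s)"
      using order_trans[OF sum_mass_transfer[OF g(1), of j "j + m"] surv] RCH by (intro mult_left_mono) auto
    finally show ?thesis .
  qed
  \<comment> \<open>For later returns the relaxation factor is bounded by 1, but such an excursion
    has outlasted j + m steps, which is rare.\<close>
  have second: "(\<Sum>i\<in>{j+m<..j+n}. \<bar>mass (transfer i ?G)\<bar>) \<le> R * C * H * (A * (real (j + m) + 1) powr - ?s)"
  proof -
    have "(\<Sum>i\<in>{j+m<..j+n}. \<bar>mass (transfer i ?G)\<bar>) \<le> (\<Sum>i\<in>{j+m<..j+n}. R * C * H * mass (transfer i g))"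
    proof (rule sum_mono)
      fix i assume i: "i \<in> {j+m<..j+n}"
      have "\<bar>mass (transfer i ?G)\<bar> \<le> R * C * H * (real (j + n - i) + 1) powr - \<beta> * mass (transfer i g)"
        using i by (intro step) auto
      also have "\<dots> \<le> R * C * H * 1 * mass (transfer i g)"
      proof (intro mult_right_mono mult_left_mono)
        have "(real (j + n - i) + 1) powr - \<beta> \<le> 1 powr - \<beta>" using \<beta> by (intro powr_mono2') auto
        then show "(real (j + n - i) + 1) powr - \<beta> \<le> 1" by simp
      qed (use RCH r0 in auto)
      finally show "\<bar>mass (transfer i ?G)\<bar> \<le> R * C * H * mass (transfer i g)" by simp
    qed
    also have "\<dots> = R * C * H * (\<Sum>i\<in>{j+m<..j+n}. mass (transfer i g))" by (simp only: sum_distrib_left)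
    also have "\<dots> \<le> R * C * H * (A * (real (j + m) + 1) powr - ?s)"
      using order_trans[OF sum_mass_transfer[OF g(1), of "j + m" "j + n"] surv] RCH m by (intro mult_left_mono) auto
    finally show ?thesis .
  qed
  \<comment> \<open>Excursions that outlast even time j + n are estimated by the supremum.\<close>
  have third: "\<bar>survivor (j + n) ?G\<bar> \<le> 2 * C * H * (A * (real (j + m) + 1) powr - ?s)"
  proof -
    have "\<bar>survivor (j + n) ?G\<bar> \<le> 2 * C * H * survivor (j + n) g"
      by (rule survivor_mult_le[OF v v_bound D0 g(1)])
    also have "\<dots> \<le> 2 * C * H * (A * (real (j + m) + 1) powr - ?s)"
    proof (intro mult_left_mono)
      have "survivor (j + n) g \<le> A * (real (j + n) + 1) powr - ?s" by (rule surv)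
      also have "\<dots> \<le> A * (real (j + m) + 1) powr - ?s"
        using A(1) \<beta> m by (intro mult_left_mono powr_mono2') auto
      finally show "survivor (j + n) g \<le> A * (real (j + m) + 1) powr - ?s" .
    qed (use C0 H0 in auto)
    finally show ?thesis .
  qed
  have "excursion (\<lambda>z. (f ((F ^^ n) z) - c) * h z) j g = (\<Sum>i\<in>{j<..j+n}. mass (transfer i ?G)) + survivor (j + n) ?G"
    unfolding excursion_def by (rule survivor_decomposition[OF Gb]) simp
  also have "{j<..j+n} = {j<..j+m} \<union> {j+m<..j+n}" using m by auto
  also have "(\<Sum>i\<in>{j<..j+m} \<union> {j+m<..j+n}. mass (transfer i ?G)) =
      (\<Sum>i\<in>{j<..j+m}. mass (transfer i ?G)) + (\<Sum>i\<in>{j+m<..j+n}. mass (transfer i ?G))"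
    by (rule sum.union_disjoint) auto
  finally have "\<bar>excursion (\<lambda>z. (f ((F ^^ n) z) - c) * h z) j g\<bar> \<le>
      (\<Sum>i\<in>{j<..j+m}. \<bar>mass (transfer i ?G)\<bar>) + (\<Sum>i\<in>{j+m<..j+n}. \<bar>mass (transfer i ?G)\<bar>) + \<bar>survivor (j + n) ?G\<bar>"
    using sum_abs[of "\<lambda>i. mass (transfer i ?G)" "{j<..j+m}"] sum_abs[of "\<lambda>i. mass (transfer i ?G)" "{j+m<..j+n}"]
    by linarith
  also have "\<dots> \<le> R * C * H * (2 powr \<beta> * (real n + 1) powr - \<beta>) * (A * (real j + 1) powr - ?s) +
      R * C * H * (A * (real (j + m) + 1) powr - ?s) + 2 * C * H * (A * (real (j + m) + 1) powr - ?s)"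
    by (intro add_mono first second third)
  also have "\<dots> \<le> (R + 2) * C * H * A * (2 powr \<beta> * (real n + 1) powr - \<beta> * (real j + 1) powr - ?s
      + (real (j + m) + 1) powr - ?s)"
  proof -
    define X Y where "X = 2 powr \<beta> * (real n + 1) powr - \<beta> * (real j + 1) powr - ?s"
      and "Y = (real (j + m) + 1) powr - ?s"
    have "0 \<le> C * H * A * X" using C0 H0 A(1) by (auto simp: X_def)
    then have "R * (C * H * A * X) + (R + 2) * (C * H * A * Y) \<le> (R + 2) * (C * H * A * X) + (R + 2) * (C * H * A * Y)"
      using R(1) by (intro add_right_mono mult_right_mono) auto
    then show ?thesis unfolding X_def[symmetric] Y_def[symmetric]
      by (simp add: X_def Y_def algebra_simps)
  qed
  finally show ?thesis unfolding c_def m_def .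
qed

text \<open>For fixed n the centred observable, composed with n steps and weighted by h, is paired
  with Lebesgue measure on the left half at a time k. Decomposing by the last return up to time k
  gives sums of \<open>excursion_decay\<close>, bounded uniformly in k; as k tends to infinity the
  pairing becomes the integral against the invariant measure.\<close>

lemma weighted_decay:
  assumes f: "f \<in> bounded_measurable (phase p)"
    and h: "h \<in> bounded_measurable (phase p)" and H: "\<And>z. z \<in> space (phase p) \<Longrightarrow> 0 \<le> h z \<and> h z \<le> H"
    and hh: "\<And>z z'. z \<in> space (phase p) \<Longrightarrow> z' \<in> space (phase p) \<Longrightarrow> h z \<le> exp (skew_dist z z' powr \<alpha>) * h z'"
  obtains B where "\<And>n. \<bar>\<integral>z. (f ((F ^^ n) z) - (\<integral>z. f z \<partial>skew_measure)) * h z \<partial>skew_measure\<bar> \<le> B * (real n + 1) powr - \<beta>"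
proof (rule pairing_integral_rate)
  fix R assume R: "0 \<le> R" "\<And>\<phi> C g n. \<phi> \<in> bounded_measurable (phase p) \<Longrightarrow> \<forall>z\<in>space (phase p). \<bar>\<phi> z\<bar> \<le> C \<Longrightarrow> g \<in> cone aperture \<Longrightarrow>
      \<bar>pairing \<phi> n g - (\<integral>z. \<phi> z \<partial>skew_measure) * mass g\<bar> \<le> R * C * mass g * (real n + 1) powr - \<beta>"
  obtain A where A: "0 < A" "\<And>g n. g \<in> cone aperture \<Longrightarrow> survivor n g \<le> A * (real n + 1) powr - (1 + \<beta>) * mass g"
    by (rule survivor_bound) (rule that)
  obtain C where C: "\<forall>z\<in>space (phase p). \<bar>f z\<bar> \<le> C" using f by (auto simp: bounded_measurable_def)
  have "\<bar>f (undefined, 0)\<bar> \<le> C" using bspec[OF C, of "(undefined, 0)"] by simp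
  then have C0: "0 \<le> C" by linarith
  have H0: "0 \<le> H" using H[of "(undefined, 0)"] by auto
  have D0: "0 \<le> aperture" using aperture_pos by simp
  have one: "(\<lambda>_. 1) \<in> cone aperture" by (rule cone_const) (use D0 in auto)
  have nonneg: "0 \<le> (R + 2) * C * H * A" using R(1) C0 H0 A(1) by simp
  define B where "B = (R + 2) * C * H * A * (2 * (2 powr \<beta> * (1 + 1 / \<beta>)))"
  show thesis
  proof (rule that)
    fix n
    define \<phi> where "\<phi> z = (f ((F ^^ n) z) - (\<integral>z. f z \<partial>skew_measure)) * h z" for z
    have \<phi>: "\<phi> \<in> bounded_measurable (phase p)" unfolding \<phi>_def[abs_def]
      by (intro bounded_measurable_mult bounded_measurable_diff bounded_measurable_const h
        bounded_measurable_compose[OF f measurable_F_iterate])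
    let ?w = "regeneration (\<lambda>_. 0) (\<lambda>_. 1)"
    have w0: "?w 0 = (\<lambda>_. 1)" by (subst regeneration.simps) simp
    have exc: "\<bar>excursion \<phi> j (?w m)\<bar> \<le> (R + 2) * C * H * A *
        (2 powr \<beta> * (real n + 1) powr - \<beta> * (real j + 1) powr - (1 + \<beta>) + (real (j + n div 2) + 1) powr - (1 + \<beta>))" for j m
      unfolding \<phi>_def
      by (rule excursion_decay[where f = f and h = h and C = C and H = H and R = R and A = A and g = "?w m"])
         (fact f C h H hh R A regeneration_0)+
    have "\<bar>pairing \<phi> k (\<lambda>_. 1)\<bar> \<le> B * (real n + 1) powr - \<beta>" for k
    proof -
      have rec: "?w m = (\<lambda>z. (\<Sum>i<m. transfer (m - i) (?w i) z) - (\<lambda>_. 0) m)" if "0 < m" for m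
        using that by (subst regeneration.simps) simp
      have wb: "?w m \<in> bounded_measurable (base p)" for m
        by (rule cone_bounded_measurable[OF D0 regeneration_0(1)])
      have "pairing \<phi> k (?w 0) = (\<Sum>m<k. 0 * pairing \<phi> m (\<lambda>_. 1)) + (\<Sum>m\<le>k. excursion \<phi> (k - m) (?w m))"
        using renewal_telescope[where w = ?w and q = "\<lambda>_. 0" and n = k, OF \<phi> wb rec] .
      then have eq: "pairing \<phi> k (\<lambda>_. 1) = (\<Sum>m\<le>k. excursion \<phi> (k - m) (?w m))"
        unfolding w0 mult_zero_left sum.neutral_const add_0_left .
      have "\<bar>pairing \<phi> k (\<lambda>_. 1)\<bar> \<le> (\<Sum>m\<le>k. (R + 2) * C * H * A * (2 powr \<beta> * (real n + 1) powr - \<beta> * (real (k - m) + 1) powr - (1 + \<beta>)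
          + (real ((k - m) + n div 2) + 1) powr - (1 + \<beta>)))"
        unfolding eq by (rule order_trans[OF sum_abs sum_mono]) (rule exc)
      also have "\<dots> \<le> (R + 2) * C * H * A * (2 * (2 powr \<beta> * (1 + 1 / \<beta>))) * (real n + 1) powr - \<beta>"
        by (rule sum_excursion_bounds_le[OF \<beta> nonneg])
      finally show ?thesis unfolding B_def .
    qed
    moreover have "(\<lambda>k. \<bar>pairing \<phi> k (\<lambda>_. 1)\<bar>) \<longlonglongrightarrow> \<bar>\<integral>z. \<phi> z \<partial>skew_measure\<bar>"
    proof -
      obtain C' where C': "\<forall>z\<in>space (phase p). \<bar>\<phi> z\<bar> \<le> C'" using \<phi> by (auto simp: bounded_measurable_def)
      have "(\<lambda>k. R * C' * (real k + 1) powr - \<beta>) \<longlonglongrightarrow> R * C' * 0"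
        by (intro tendsto_intros shifted_powr_tendsto_0 \<beta>)
      then have "(\<lambda>k. R * C' * (real k + 1) powr - \<beta>) \<longlonglongrightarrow> 0" by simp
      then have "(\<lambda>k. pairing \<phi> k (\<lambda>_. 1) - (\<integral>z. \<phi> z \<partial>skew_measure)) \<longlonglongrightarrow> 0"
      proof (rule Lim_null_comparison[rotated], intro always_eventually allI)
        fix k
        show "norm (pairing \<phi> k (\<lambda>_. 1) - (\<integral>z. \<phi> z \<partial>skew_measure)) \<le> R * C' * (real k + 1) powr - \<beta>"
          using R(2)[OF \<phi> C' one, of k] unfolding mass_one by simp
      qed
      then show ?thesis by (intro tendsto_intros) (simp add: LIM_zero_iff)
    qed
    ultimately have "\<bar>\<integral>z. \<phi> z \<partial>skew_measure\<bar> \<le> B * (real n + 1) powr - \<beta>"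
      by (intro LIMSEQ_le_const2) auto
    then show "\<bar>\<integral>z. (f ((F ^^ n) z) - (\<integral>z. f z \<partial>skew_measure)) * h z \<partial>skew_measure\<bar> \<le> B * (real n + 1) powr - \<beta>"
      unfolding \<phi>_def .
  qed
qed

end

section \<open>Hoelder observables\<close>

lemma seq_dist_le_of_agree:
  assumes "\<And>i. i < n \<Longrightarrow> \<omega> i = \<omega>' i"
  shows "seq_dist \<omega> \<omega>' \<le> (1 / 2) ^ n"
proof (cases "\<omega> = \<omega>'")
  case False
  then obtain k where "\<omega> k \<noteq> \<omega>' k" by auto
  then have "\<omega> (LEAST i. \<omega> i \<noteq> \<omega>' i) \<noteq> \<omega>' (LEAST i. \<omega> i \<noteq> \<omega>' i)"
    by (rule LeastI[of "\<lambda>i. \<omega> i \<noteq> \<omega>' i"])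
  then have "n \<le> (LEAST i. \<omega> i \<noteq> \<omega>' i)" using assms not_less by blast
  then have "(1 / 2 :: real) ^ Suc (LEAST i. \<omega> i \<noteq> \<omega>' i) \<le> (1 / 2) ^ n"
    by (intro power_decreasing) auto
  then show ?thesis using False by (simp add: seq_dist_def)
qed (simp add: seq_dist_def)

lemma skew_dist_eq_0_iff: "skew_dist z z' = 0 \<longleftrightarrow> z = z'"
proof -
  have "seq_dist \<omega> \<omega>' = 0 \<longleftrightarrow> \<omega> = \<omega>'" for \<omega> \<omega>' :: "nat \<Rightarrow> 'a" by (simp add: seq_dist_def)
  then show ?thesis using seq_dist_nonneg[of "fst z" "fst z'"]
    by (auto simp: skew_dist_def case_prod_unfold add_nonneg_eq_0_iff prod_eq_iff)
qed

lemma hoelder_class_bound: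
  fixes h :: "(nat \<Rightarrow> 'j) \<times> real \<Rightarrow> real"
  assumes "h \<in> hoelder_class \<alpha>"
  obtains C where "0 \<le> C"
    "\<And>z z'. z \<in> UNIV \<times> {0..1} \<Longrightarrow> z' \<in> UNIV \<times> {0..1} \<Longrightarrow> \<bar>h z - h z'\<bar> \<le> C * skew_dist z z' powr \<alpha>"
proof -
  let ?Q = "{\<bar>h z1 - h z2\<bar> / skew_dist z1 z2 powr \<alpha> | z1 z2.
     z1 \<in> UNIV \<times> {0..1} \<and> z2 \<in> UNIV \<times> {0..1} \<and> z1 \<noteq> z2}"
  have "bdd_above ?Q" using assms unfolding hoelder_class_def by (rule CollectD)
  then obtain C where Q: "\<forall>x\<in>?Q. x \<le> C" unfolding bdd_above_def by (rule exE)
  have C: "\<bar>h z - h z'\<bar> / skew_dist z z' powr \<alpha> \<le> C"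
    if "z \<in> UNIV \<times> {0..1}" "z' \<in> UNIV \<times> {0..1}" "z \<noteq> z'" for z z'
    by (rule bspec[OF Q]) (use that in blast)
  show thesis
  proof (rule that[of "max C 0"])
    fix z z' :: "(nat \<Rightarrow> 'j) \<times> real" assume z: "z \<in> UNIV \<times> {0..1}" "z' \<in> UNIV \<times> {0..1}"
    show "\<bar>h z - h z'\<bar> \<le> max C 0 * skew_dist z z' powr \<alpha>"
    proof (cases "z = z'")
      case False
      have "skew_dist z z' \<noteq> 0" using False skew_dist_eq_0_iff by blast
      then have "0 < skew_dist z z' powr \<alpha>" by simp
      then have "\<bar>h z - h z'\<bar> \<le> C * skew_dist z z' powr \<alpha>"
        using C[OF z False] by (simp add: pos_divide_le_eq)
      also have "\<dots> \<le> max C 0 * skew_dist z z' powr \<alpha>" by (intro mult_right_mono) auto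
      finally show ?thesis .
    qed simp
  qed simp
qed

text \<open>The function is the pointwise limit of functions that see just the first n symbols; for
  each word these are continuous in x, and there are finitely many words.\<close>

lemma hoelder_bounded_measurable:
  fixes h :: "(nat \<Rightarrow> 'j::finite) \<times> real \<Rightarrow> real" and p :: "'j pmf"
  assumes \<alpha>: "0 < \<alpha>" and C: "0 \<le> C"
    and h: "\<And>z z'. z \<in> UNIV \<times> {0..1} \<Longrightarrow> z' \<in> UNIV \<times> {0..1} \<Longrightarrow> \<bar>h z - h z'\<bar> \<le> C * skew_dist z z' powr \<alpha>"
  shows "h \<in> bounded_measurable (phase p)"
proof -
  \<comment> \<open>Any fixed filler beyond the word will do: agreement of the first n symbols
    bounds the distance by (1 / 2) ^ n.\<close>
  define pad where "pad s = (\<lambda>i. if i < length s then s ! i else undefined)" for s :: "'j list"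
  define \<omega>n where "\<omega>n n \<omega> = map \<omega> [0..<n]" for n and \<omega> :: "nat \<Rightarrow> 'j"
  have agree: "seq_dist (pad (\<omega>n n \<omega>)) \<omega> \<le> (1 / 2) ^ n" for n \<omega>
    by (rule seq_dist_le_of_agree) (simp add: pad_def \<omega>n_def)
  have cont: "(\<lambda>z. h (pad s, snd z)) \<in> borel_measurable (phase p)" for s
  proof -
    have "continuous_on {0..1} (\<lambda>x. h (pad s, x))"
      unfolding continuous_on_def
    proof
      fix x :: real assume x: "x \<in> {0..1}"
      have "((\<lambda>y. C * \<bar>y - x\<bar> powr \<alpha>) \<longlongrightarrow> C * 0) (at x within {0..1})"
      proof (intro tendsto_intros tendsto_zero_powrI[where b = \<alpha>])
        have "((\<lambda>y. y - x) \<longlongrightarrow> x - x) (at x within {0..1})" by (intro tendsto_intros)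
        then show "((\<lambda>y. \<bar>y - x\<bar>) \<longlongrightarrow> 0) (at x within {0..1})" by (simp add: tendsto_rabs_zero)
      qed (use \<alpha> in auto)
      then have lim: "((\<lambda>y. C * \<bar>y - x\<bar> powr \<alpha>) \<longlongrightarrow> 0) (at x within {0..1})" by simp
      have "((\<lambda>y. h (pad s, y) - h (pad s, x)) \<longlongrightarrow> 0) (at x within {0..1})"
      proof (rule Lim_null_comparison[OF _ lim])
        show "\<forall>\<^sub>F y in at x within {0..1}. norm (h (pad s, y) - h (pad s, x)) \<le> C * \<bar>y - x\<bar> powr \<alpha>"
          unfolding eventually_at_filter
        proof (intro always_eventually allI impI)
          fix y :: real assume "y \<in> {0..1}"
          then show "norm (h (pad s, y) - h (pad s, x)) \<le> C * \<bar>y - x\<bar> powr \<alpha>"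
            using h[of "(pad s, y)" "(pad s, x)"] x by (simp add: skew_dist_def seq_dist_def)
        qed
      qed
      then show "((\<lambda>x. h (pad s, x)) \<longlongrightarrow> h (pad s, x)) (at x within {0..1})" by (simp add: LIM_zero_iff)
    qed
    then have "(\<lambda>x. h (pad s, x)) \<in> borel_measurable (restrict_space borel {0..1})"
      by (rule borel_measurable_continuous_on_restrict)
    then show ?thesis by (rule measurable_compose[OF measurable_snd_phase])
  qed
  have words: "(\<lambda>z. \<omega>n n (fst z)) \<in> measurable (phase p) (count_space (words n))" for n
  proof (rule measurable_compose[OF measurable_fst_phase])
    show "\<omega>n n \<in> measurable (bernoulli_measure p) (count_space (words n))"
      unfolding measurable_count_space_eq2[OF finite_words]
    proof (intro conjI ballI)
      show "\<omega>n n \<in> space (bernoulli_measure p) \<rightarrow> words n" by (rule Pi_I) (simp add: \<omega>n_def words_def)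
      fix s :: "'j list" assume "s \<in> words n"
      then have len: "length s = n" by (simp add: words_def)
      have "\<omega>n n \<omega> = s \<longleftrightarrow> (\<forall>i\<in>{..<n}. \<omega> i = s ! i)" for \<omega>
        unfolding list_eq_iff_nth_eq by (simp add: \<omega>n_def len Ball_def)
      then have "\<omega>n n -` {s} \<inter> space (bernoulli_measure p) = {\<omega> \<in> space (bernoulli_measure p). \<forall>i\<in>{..<n}. \<omega> i = s ! i}"
        by auto
      also have "\<dots> \<in> sets (bernoulli_measure p)"
      proof (intro sets.sets_Collect_finite_All)
        fix i
        have "(\<lambda>\<omega>. \<omega> i) -` {s ! i} \<inter> space (bernoulli_measure p) \<in> sets (bernoulli_measure p)"
          by (rule measurable_sets[OF measurable_bernoulli_coord]) simp
        moreover have "(\<lambda>\<omega>. \<omega> i) -` {s ! i} \<inter> space (bernoulli_measure p) = {\<omega> \<in> space (bernoulli_measure p). \<omega> i = s ! i}"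
          by blast
        ultimately show "{\<omega> \<in> space (bernoulli_measure p). \<omega> i = s ! i} \<in> sets (bernoulli_measure p)" by simp
      qed simp
      finally show "\<omega>n n -` {s} \<inter> space (bernoulli_measure p) \<in> sets (bernoulli_measure p)" .
    qed
  qed
  have approx: "(\<lambda>z. h (pad (\<omega>n n (fst z)), snd z)) \<in> borel_measurable (phase p)" for n
    by (rule measurable_compose_countable'[OF cont words]) (simp add: countable_finite)
  have "h \<in> borel_measurable (phase p)"
  proof (rule borel_measurable_LIMSEQ_real[OF _ approx])
    fix z :: "(nat \<Rightarrow> 'j) \<times> real" assume z: "z \<in> space (phase p)"
    have "(\<lambda>n. C * ((1 / 2) ^ n) powr \<alpha>) \<longlonglongrightarrow> C * 0"
      by (intro tendsto_intros tendsto_zero_powrI[where b = \<alpha>] LIMSEQ_realpow_zero) (use \<alpha> in auto)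
    then have lim: "(\<lambda>n. C * ((1 / 2) ^ n) powr \<alpha>) \<longlonglongrightarrow> 0" by simp
    have "(\<lambda>n. h (pad (\<omega>n n (fst z)), snd z) - h z) \<longlonglongrightarrow> 0"
    proof (rule Lim_null_comparison[OF always_eventually lim], rule allI)
      fix n
      have "norm (h (pad (\<omega>n n (fst z)), snd z) - h z) \<le> C * skew_dist (pad (\<omega>n n (fst z)), snd z) z powr \<alpha>"
        using h[of "(pad (\<omega>n n (fst z)), snd z)" z] z by auto
      also have "\<dots> \<le> C * ((1 / 2) ^ n) powr \<alpha>"
        using agree[of n "fst z"] C \<alpha> by (intro mult_left_mono powr_mono2) (auto simp: skew_dist_def case_prod_unfold)
      finally show "norm (h (pad (\<omega>n n (fst z)), snd z) - h z) \<le> C * ((1 / 2) ^ n) powr \<alpha>" .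
    qed
    then show "(\<lambda>n. h (pad (\<omega>n n (fst z)), snd z)) \<longlonglongrightarrow> h z" by (simp add: LIM_zero_iff)
  qed
  moreover have "\<bar>h z\<bar> \<le> \<bar>h (undefined, 0)\<bar> + C * 2 powr \<alpha>" if z: "z \<in> space (phase p)" for z
  proof -
    have "skew_dist z (undefined, 0) \<le> 2"
      using z seq_dist_le_half[of "fst z" undefined] by (auto simp: skew_dist_def case_prod_unfold)
    then have "C * skew_dist z (undefined, 0) powr \<alpha> \<le> C * 2 powr \<alpha>"
      using C \<alpha> by (intro mult_left_mono powr_mono2) (auto simp: skew_dist_def case_prod_unfold)
    moreover have "\<bar>h z - h (undefined, 0)\<bar> \<le> C * skew_dist z (undefined, 0) powr \<alpha>"
      using z by (intro h) auto
    ultimately show ?thesis by linarith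
  qed
  ultimately show ?thesis by (rule bounded_measurableI)
qed

context acs_system
begin

text \<open>Two normalisations precede \<open>weighted_decay\<close>. Raising h by a constant leaves
  correlations unchanged because f minus its mean integrates to 0, also after n steps. Replacing f
  by a bounded function on a null set changes its composition with \<open>F ^^ n\<close> on a null
  set too, since the measure is invariant.\<close>

lemma correlation_bound:
  assumes f: "f \<in> ess_bounded skew_measure" and h: "h \<in> hoelder_class \<alpha>"
  obtains B where "\<And>n. \<bar>correlation p T \<mu> n f h\<bar> \<le> B * (real n + 1) powr - \<beta>"
proof -
  interpret N: prob_space skew_measure by (rule prob_space_skew_measure)
  obtain Ch where Ch: "0 \<le> Ch"
    "\<And>z z'. z \<in> UNIV \<times> {0..1} \<Longrightarrow> z' \<in> UNIV \<times> {0..1} \<Longrightarrow> \<bar>h z - h z'\<bar> \<le> Ch * skew_dist z z' powr \<alpha>"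
    by (rule hoelder_class_bound[OF h]) (rule that)
  have hb: "h \<in> bounded_measurable (phase p)" by (rule hoelder_bounded_measurable[OF \<alpha>(1) Ch])
  obtain H where "\<forall>z\<in>space (phase p). \<bar>h z\<bar> \<le> H" using hb by (auto simp: bounded_measurable_def)
  then have H: "\<bar>h z\<bar> \<le> H" if "z \<in> space (phase p)" for z using that by (rule bspec)
  \<comment> \<open>H makes the function nonnegative; Ch makes its values at least the Hoelder
    constant, hence its logarithm Hoelder with constant 1.\<close>
  define h' where "h' z = h z + (H + Ch)" for z
  have h'b: "h' \<in> bounded_measurable (phase p)"
    unfolding h'_def[abs_def] by (intro bounded_measurable_add hb bounded_measurable_const)
  have h'_ge: "Ch \<le> h' z" and h'_range: "0 \<le> h' z \<and> h' z \<le> 2 * H + Ch" if "z \<in> space (phase p)" for z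
    using H[OF that] Ch(1) by (auto simp: h'_def)
  have h'_exp: "h' z \<le> exp (skew_dist z z' powr \<alpha>) * h' z'" if z: "z \<in> space (phase p)" "z' \<in> space (phase p)" for z z'
  proof -
    let ?d = "skew_dist z z' powr \<alpha>"
    have "h' z \<le> h' z' + Ch * ?d" using Ch(2)[of z z'] z by (auto simp: h'_def)
    also have "\<dots> \<le> h' z' + h' z' * ?d" using h'_ge[OF z(2)] by (intro add_left_mono mult_right_mono) auto
    also have "\<dots> = (1 + ?d) * h' z'" by (simp add: algebra_simps)
    also have "\<dots> \<le> exp ?d * h' z'" using h'_range[OF z(2)] by (intro mult_right_mono exp_ge_add_one_self) auto
    finally show ?thesis .
  qed
  obtain C where fm: "f \<in> borel_measurable skew_measure" and C: "AE z in skew_measure. \<bar>f z\<bar> \<le> C"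
    using f by (auto simp: ess_bounded_def)
  define f' where "f' z = (if \<bar>f z\<bar> \<le> C then f z else 0)" for z
  have f'm: "f' \<in> borel_measurable skew_measure" unfolding f'_def[abs_def] using fm by measurable
  have f'b: "f' \<in> bounded_measurable (phase p)"
  proof -
    have "f' \<in> bounded_measurable skew_measure"
      by (rule bounded_measurableI[OF f'm, of "\<bar>C\<bar>"]) (auto simp: f'_def)
    then show ?thesis by (simp only: bounded_measurable_skew_measure)
  qed
  have ff': "AE z in skew_measure. f z = f' z" using C by eventually_elim (simp add: f'_def)
  have Fm: "(F ^^ n) \<in> measurable skew_measure skew_measure" for n
    using measurable_F_iterate[of n] measurable_cong_sets[OF sets_skew_measure sets_skew_measure] by blast
  have distr: "distr skew_measure skew_measure (F ^^ n) = skew_measure" for n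
  proof (rule measure_eqI)
    fix A assume "A \<in> sets (distr skew_measure skew_measure (F ^^ n))"
    then have A: "A \<in> sets skew_measure" by simp
    have ind: "indicator A \<in> bounded_measurable (phase p)"
      unfolding bounded_measurable_skew_measure[symmetric]
      by (rule bounded_measurableI[of _ _ 1]) (use A in \<open>auto simp: indicator_def\<close>)
    have "N.prob ((F ^^ n) -` A \<inter> space skew_measure) = (\<integral>z. indicator A ((F ^^ n) z) \<partial>skew_measure)"
    proof -
      have "(\<integral>z. indicator A ((F ^^ n) z) \<partial>skew_measure) = (\<integral>z. indicator ((F ^^ n) -` A \<inter> space skew_measure) z \<partial>skew_measure)"
        by (intro Bochner_Integration.integral_cong refl) (auto simp: indicator_def)
      also have "\<dots> = N.prob ((F ^^ n) -` A \<inter> space skew_measure)"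
        by (simp only: Bochner_Integration.integral_indicator) (simp only: Int_assoc Int_absorb)
      finally show ?thesis by simp
    qed
    also have "\<dots> = (\<integral>z. indicator A z \<partial>skew_measure)" by (rule integral_F_iterate[OF ind])
    also have "\<dots> = N.prob A" using sets.sets_into_space[OF A] by (simp add: Int_absorb2)
    finally show "emeasure (distr skew_measure skew_measure (F ^^ n)) A = emeasure skew_measure A"
      using emeasure_distr[OF Fm A, of n] by (simp add: N.emeasure_eq_measure)
  qed simp
  have corr: "correlation p T \<mu> n f h = (\<integral>z. (f' ((F ^^ n) z) - (\<integral>z. f' z \<partial>skew_measure)) * h' z \<partial>skew_measure)" for n
  proof -
    let ?c = "\<integral>z. f' z \<partial>skew_measure"
    have "AE z in distr skew_measure skew_measure (F ^^ n). f z = f' z" using ff' by (simp only: distr)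
    moreover have "{z \<in> space skew_measure. f z = f' z} \<in> sets skew_measure" using fm f'm by measurable
    ultimately have "AE z in skew_measure. f ((F ^^ n) z) = f' ((F ^^ n) z)"
      by (simp only: AE_distr_iff[OF Fm])
    moreover have hm: "h \<in> borel_measurable skew_measure"
      using bounded_measurable_measurable[of h skew_measure] hb by (simp only: bounded_measurable_skew_measure)
    ultimately have eq1: "(\<integral>z. f ((F ^^ n) z) * h z \<partial>skew_measure) = (\<integral>z. f' ((F ^^ n) z) * h z \<partial>skew_measure)"
      using measurable_compose[OF Fm fm, of n] measurable_compose[OF Fm f'm, of n]
      by (intro integral_cong_AE borel_measurable_times) auto
    have eq2: "(\<integral>z. f z \<partial>skew_measure) = ?c"
      by (rule integral_cong_AE[OF fm f'm ff'])
    have f'Fb: "(\<lambda>z. f' ((F ^^ n) z)) \<in> bounded_measurable skew_measure"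
      unfolding bounded_measurable_skew_measure by (rule bounded_measurable_compose[OF f'b measurable_F_iterate])
    have hbN: "h \<in> bounded_measurable skew_measure" unfolding bounded_measurable_skew_measure by (rule hb)
    have i1: "integrable skew_measure (\<lambda>z. f' ((F ^^ n) z) * h z)"
      by (rule N.integrable_bounded_measurable[OF bounded_measurable_mult[OF f'Fb hbN]])
    have i2: "integrable skew_measure (\<lambda>z. f' ((F ^^ n) z))" by (rule N.integrable_bounded_measurable[OF f'Fb])
    have i3: "integrable skew_measure h" by (rule N.integrable_bounded_measurable[OF hbN])
    have inv: "(\<integral>z. f' ((F ^^ n) z) \<partial>skew_measure) = ?c" by (rule integral_F_iterate[OF f'b])
    define K where "K = H + Ch"
    have "(\<integral>z. (f' ((F ^^ n) z) - ?c) * h' z \<partial>skew_measure) =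
        (\<integral>z. (f' ((F ^^ n) z) * h z + K * f' ((F ^^ n) z)) - (?c * h z + ?c * K) \<partial>skew_measure)"
      by (intro Bochner_Integration.integral_cong refl) (simp add: h'_def K_def algebra_simps)
    also have "\<dots> = (\<integral>z. f' ((F ^^ n) z) * h z + K * f' ((F ^^ n) z) \<partial>skew_measure) - (\<integral>z. ?c * h z + ?c * K \<partial>skew_measure)"
      by (rule Bochner_Integration.integral_diff)
         (intro Bochner_Integration.integrable_add integrable_mult_right i1 i2 i3 N.integrable_const)+
    also have "(\<integral>z. f' ((F ^^ n) z) * h z + K * f' ((F ^^ n) z) \<partial>skew_measure) = (\<integral>z. f' ((F ^^ n) z) * h z \<partial>skew_measure) + K * ?c"
      using Bochner_Integration.integral_add[OF i1 integrable_mult_right[OF i2, of K]] inv by simp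
    also have "(\<integral>z. ?c * h z + ?c * K \<partial>skew_measure) = ?c * (\<integral>z. h z \<partial>skew_measure) + ?c * K"
      using Bochner_Integration.integral_add[OF integrable_mult_right[OF i3, of ?c] N.integrable_const[of "?c * K"]]
        N.prob_space by simp
    finally have "(\<integral>z. (f' ((F ^^ n) z) - ?c) * h' z \<partial>skew_measure) =
        (\<integral>z. f' ((F ^^ n) z) * h z \<partial>skew_measure) - ?c * (\<integral>z. h z \<partial>skew_measure)" by simp
    then show ?thesis
      using eq1 eq2 unfolding correlation_def skew_measure_def[symmetric] by simp
  qed
  show thesis
  proof (rule weighted_decay[OF f'b h'b h'_range h'_exp])
    fix B assume "\<And>n. \<bar>\<integral>z. (f' ((F ^^ n) z) - (\<integral>z. f' z \<partial>skew_measure)) * h' z \<partial>skew_measure\<bar> \<le> B * (real n + 1) powr - \<beta>"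
    then show thesis by (intro that[of B]) (simp only: corr)
  qed
qed

end

text \<open>At x = 3 / 8 a good map takes a value of at least 3 / 4 and a bad map one of at most 1 /
  2. This puts the good label of the theorem outside the bad ones.\<close>

lemma not_good_and_bad:
  assumes "good_map T" "bad_map T"
  shows False
proof -
  obtain r l where r: "good_map_with r T" and l: "bad_map_with l T"
    using assms by (auto simp: good_map_def bad_map_def)
  have x: "3 / 8 \<in> {0..<1/2::real}" by auto
  have "2 powr r * (1 / 2 - 3 / 8) powr r = (1 / 4) powr r"
    by (simp flip: powr_mult)
  also have "\<dots> \<le> (1 / 4) powr 1" using r by (intro powr_mono') (auto simp: good_map_with_def)
  finally have le: "2 powr r * (1 / 2 - 3 / 8) powr r \<le> 1 / 4" by simp
  have "T (3 / 8) = 1 - 2 powr r * (1 / 2 - 3 / 8) powr r"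
    using r x unfolding good_map_with_def by blast
  with le have "3 / 4 \<le> T (3 / 8)" by linarith
  moreover have "T (3 / 8) = 1 / 2 - 2 powr (l - 1) * (1 / 2 - 3 / 8) powr l"
    using l x unfolding bad_map_with_def by blast
  then have "T (3 / 8) \<le> 1 / 2" by simp
  ultimately show False by simp
qed

theorem theorem1p3:
  fixes T :: "'j::finite \<Rightarrow> real \<Rightarrow> real"
    and p :: "'j pmf"
    and l :: "'j \<Rightarrow> real"
    and \<theta> l_max \<gamma>1 \<gamma> :: real
    and \<mu> :: "real measure"
    and f h :: "(nat \<Rightarrow> 'j) \<times> real \<Rightarrow> real"
  assumes "\<And>j. good_map (T j) \<or> bad_map (T j)"
    and "good_labels T \<noteq> {}"
    and "bad_labels T \<noteq> {}"
    and "\<And>b. b \<in> bad_labels T \<Longrightarrow> bad_map_with (l b) (T b)"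
    and "\<And>j. 0 < pmf p j"
    and "\<theta> = (\<Sum>b\<in>bad_labels T. pmf p b * l b)"
    and "l_max = Max (l ` bad_labels T)"
    and "\<gamma>1 = ln \<theta> / ln l_max"
    and "\<theta> < 1"
    and "acs_measure p T \<mu>"
    and "prob_space \<mu>"
    and "\<gamma> \<in> {\<gamma>1<..<0}"
    and "f \<in> ess_bounded (bernoulli_measure p \<Otimes>\<^sub>M \<mu>)"
    and "h \<in> hoelder_functions"
  shows "(\<lambda>n. \<bar>correlation p T \<mu> n f h\<bar>) \<in> O(\<lambda>n. real n powr \<gamma>)"
proof -
  let ?B = "bad_labels T"
  \<comment> \<open>For good labels some parameter exists and any choice serves; for bad labels the
    given l is taken.\<close>
  define e where "e j = (if j \<in> ?B then l j else SOME r. good_map_with r (T j))" for j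
  obtain \<alpha> where \<alpha>01: "0 < \<alpha>" "\<alpha> < 1" and hoelder: "h \<in> hoelder_class \<alpha>"
    using assms(14) by (auto simp: hoelder_functions_def)
  have l1: "1 < l b" if "b \<in> ?B" for b using assms(4)[OF that] by (simp add: bad_map_with_def)
  have l_le: "l b \<le> l_max" if "b \<in> ?B" for b unfolding assms(7) using that by (intro Max_ge) auto
  obtain b0 where b0: "b0 \<in> ?B" using assms(3) by blast
  have lmax: "1 < l_max" using l1[OF b0] l_le[OF b0] by simp
  have \<theta>0: "0 < \<theta>"
    unfolding assms(6)
  proof (rule sum_pos)
    show "0 < pmf p b * l b" if "b \<in> ?B" for b using l1[OF that] assms(5)[of b] by simp
  qed (use assms(3) in auto)
  \<comment> \<open>Of the 1 - \<gamma> powers of \<open>l j\<close> one is kept to form \<theta>,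
    and the other - \<gamma> are bounded by those of \<open>l_max\<close>.\<close>
  have moment: "(\<Sum>j\<in>?B. pmf p j * e j powr (1 + - \<gamma>)) < 1"
  proof -
    have "(\<Sum>j\<in>?B. pmf p j * e j powr (1 + - \<gamma>)) \<le> (\<Sum>j\<in>?B. pmf p j * l j * l_max powr - \<gamma>)"
    proof (rule sum_mono)
      fix j assume j: "j \<in> ?B"
      have "l j powr (1 + - \<gamma>) = l j * l j powr - \<gamma>" unfolding powr_add using l1[OF j] by simp
      also have "\<dots> \<le> l j * l_max powr - \<gamma>"
        using l1[OF j] l_le[OF j] assms(12) by (intro mult_left_mono powr_mono2) auto
      finally have "pmf p j * l j powr (1 + - \<gamma>) \<le> pmf p j * (l j * l_max powr - \<gamma>)"
        by (intro mult_left_mono) auto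
      then show "pmf p j * e j powr (1 + - \<gamma>) \<le> pmf p j * l j * l_max powr - \<gamma>"
        using j by (simp add: e_def mult.assoc)
    qed
    also have "\<dots> = \<theta> * l_max powr - \<gamma>" unfolding assms(6) by (simp only: sum_distrib_right)
    also have "\<dots> < 1"
    proof -
      have "ln \<theta> / ln l_max < \<gamma>" using assms(8,12) by simp
      then have "ln \<theta> < \<gamma> * ln l_max" using lmax by (simp add: pos_divide_less_eq)
      then have "ln (\<theta> * l_max powr - \<gamma>) < 0" using \<theta>0 lmax by (simp add: ln_mult_pos ln_powr)
      moreover have "0 < \<theta> * l_max powr - \<gamma>" using \<theta>0 lmax by simp
      ultimately show ?thesis by (simp only: ln_less_zero_iff)
    qed
    finally show ?thesis .
  qed
  interpret prob_space \<mu> by (rule assms(11))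
  interpret acs_system T p e ?B \<alpha> "- \<gamma>" \<mu>
  proof
    show "bad_map_with (e j) (T j)" if "j \<in> ?B" for j using assms(4)[OF that] that by (simp add: e_def)
    show "good_map_with (e j) (T j)" if "j \<notin> ?B" for j
    proof -
      have "good_map (T j)" using assms(1)[of j] that by (auto simp: bad_labels_def)
      then have "good_map_with (SOME r. good_map_with r (T j)) (T j)" unfolding good_map_def by (rule someI_ex)
      then show ?thesis using that by (simp add: e_def)
    qed
    obtain g where "good_map (T g)" using assms(2) by (auto simp: good_labels_def)
    then have "g \<notin> ?B" using not_good_and_bad by (auto simp: bad_labels_def)
    then show "\<exists>j. j \<notin> ?B \<and> 0 < pmf p j" using assms(5) by blast
    show "0 < - \<gamma>" using assms(12) by simp
  qed (fact \<alpha>01 moment assms(10))+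
  have f: "f \<in> ess_bounded skew_measure" using assms(13) by (simp only: skew_measure_def)
  show ?thesis
  proof (rule correlation_bound[OF f hoelder])
    fix B assume B: "\<And>n. \<bar>correlation p T \<mu> n f h\<bar> \<le> B * (real n + 1) powr - (- \<gamma>)"
    show ?thesis
    proof (rule bigoI)
      show "\<forall>\<^sub>F n in sequentially. norm \<bar>correlation p T \<mu> n f h\<bar> \<le> \<bar>B\<bar> * norm (real n powr \<gamma>)"
        using eventually_gt_at_top[of "0::nat"]
      proof eventually_elim
        case (elim n)
        have "\<bar>correlation p T \<mu> n f h\<bar> \<le> B * (real n + 1) powr \<gamma>" using B[of n] by simp
        also have "\<dots> \<le> \<bar>B\<bar> * (real n + 1) powr \<gamma>" by (intro mult_right_mono) auto
        \<comment> \<open>Positivity of n matters here: \<open>0 powr \<gamma>\<close> is 0.\<close>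
        also have "\<dots> \<le> \<bar>B\<bar> * real n powr \<gamma>"
          using elim assms(12) by (intro mult_left_mono powr_mono2') auto
        finally show ?case by simp
      qed
    qed
  qed
qed

end
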